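(* Let $\alpha,\beta,\nu$ be complex numbers with $\mathrm{Re}(\nu)>0$ and $\mathrm{Re}(\sqrt\alpha)\ge\mathrm{Re}(\sqrt\beta)>0$. Then $$\frac{2\pi}{(\alpha-\beta)^{\nu}}\sum_{n=1}^{\infty}r_2(n)\,I_{\nu}\big(\pi(\sqrt{n\alpha}-\sqrt{n\beta})\big)K_{\nu}\big(\pi(\sqrt{n\alpha}+\sqrt{n\beta})\big)$$ $$=\frac{\nu-\pi\sqrt{\alpha\beta}}{\nu\sqrt{\alpha\beta}\left(\sqrt{\alpha}+\sqrt{\beta}\right)^{2\nu}}+\sum_{n=1}^{\infty}\frac{r_2(n)}{\sqrt{n+\alpha}\sqrt{n+\beta}\left(\sqrt{n+\alpha}+\sqrt{n+\beta}\right)^{2\nu}}.$$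
   Context: $r_2(n)$ is the number of representations of $n$ as a sum of two squares of integers (different signs and orders counted as distinct). $I_\nu$ and $K_\nu$ are the modified Bessel functions of the first and second kind of order $\nu$. Square roots and powers are principal values, and $\sqrt{\alpha\beta}$ means $\sqrt\alpha\,\sqrt\beta$. When $\alpha=\beta$, each summand on the left, including the factor $(\alpha-\beta)^{-\nu}$, is understood as its limit as $\alpha\to\beta$. *)

theory Defs
  imports "HOL-Analysis.Analysis"
begin

definition r2 :: "nat \<Rightarrow> nat" where
  "r2 n = card {(a::int, b::int). a\<^sup>2 + b\<^sup>2 = int n}"

text \<open>
  The power series of the modified Bessel function of the first kind, with the principal value of
  \<open>(z/2)\<^sup>\<nu>\<close>. The entire function \<open>rGamma\<close> is the reciprocal of \<open>Gamma\<close>, so that negative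
  integer orders are covered. At \<open>z = 0\<close> the value is the library's \<open>0 powr \<nu> = 0\<close>, which is not
  the usual one for \<open>\<nu> = 0\<close>; the point \<open>z = 0\<close> is not used below.
\<close>

definition bessel_I :: "complex \<Rightarrow> complex \<Rightarrow> complex" where
  "bessel_I \<nu> z =
     (z / 2) powr \<nu> * (\<Sum>k. (z / 2) ^ (2 * k) / fact k * rGamma (\<nu> + of_nat k + 1))"

text \<open>
  For integer order the quotient is 0/0 and the modified Bessel function of the second kind is the
  limit in the order.
\<close>

definition bessel_K_quot :: "complex \<Rightarrow> complex \<Rightarrow> complex" where
  "bessel_K_quot \<nu> z =
     of_real pi / 2 * (bessel_I (- \<nu>) z - bessel_I \<nu> z) / sin (\<nu> * of_real pi)"

definition bessel_K :: "complex \<Rightarrow> complex \<Rightarrow> complex" where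
  "bessel_K \<nu> z =
     (if \<nu> \<in> \<int> then Lim (at \<nu>) (\<lambda>\<mu>. bessel_K_quot \<mu> z) else bessel_K_quot \<nu> z)"

definition IK_quot :: "complex \<Rightarrow> complex \<Rightarrow> complex \<Rightarrow> nat \<Rightarrow> complex" where
  "IK_quot \<nu> \<alpha> \<beta> n =
     of_nat (r2 n)
     * bessel_I \<nu> (of_real pi * (csqrt (of_nat n * \<alpha>) - csqrt (of_nat n * \<beta>)))
     * bessel_K \<nu> (of_real pi * (csqrt (of_nat n * \<alpha>) + csqrt (of_nat n * \<beta>)))
     / (\<alpha> - \<beta>) powr \<nu>"

text \<open>
  For \<open>\<alpha> = \<beta>\<close> the summand is the limit as the first parameter tends to the second. The limit is
  taken within the region \<open>Re (csqrt a) \<ge> Re (csqrt \<beta>)\<close> where the identity is considered: there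
  \<open>(a - \<beta>) powr \<nu>\<close> is the product of the principal powers of \<open>csqrt a - csqrt \<beta>\<close> and
  \<open>csqrt a + csqrt \<beta>\<close>, whereas a full neighbourhood of a non-real \<open>\<beta>\<close> contains points where the
  branches disagree, and the unrestricted limit need not exist unless \<open>\<nu>\<close> is an integer.
\<close>

definition IK_summand :: "complex \<Rightarrow> complex \<Rightarrow> complex \<Rightarrow> nat \<Rightarrow> complex" where
  "IK_summand \<nu> \<alpha> \<beta> n =
     (if \<alpha> = \<beta>
      then Lim (at \<beta> within {a. Re (csqrt a) \<ge> Re (csqrt \<beta>)}) (\<lambda>a. IK_quot \<nu> a \<beta> n)
      else IK_quot \<nu> \<alpha> \<beta> n)"

definition sqrt_summand :: "complex \<Rightarrow> complex \<Rightarrow> complex \<Rightarrow> nat \<Rightarrow> complex" where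
  "sqrt_summand \<nu> \<alpha> \<beta> n =
     of_nat (r2 n)
     / (csqrt (of_nat n + \<alpha>) * csqrt (of_nat n + \<beta>)
        * (csqrt (of_nat n + \<alpha>) + csqrt (of_nat n + \<beta>)) powr (2 * \<nu>))"

end

theory Submission
  imports Defs "HOL-Complex_Analysis.Complex_Analysis" "HOL-Real_Asymp.Real_Asymp"
    "HOL-Probability.Characteristic_Functions"
begin

text \<open>
  Put \<open>p = csqrt \<alpha>\<close>, \<open>q = csqrt \<beta>\<close>, \<open>s = p + q\<close> and \<open>d = p - q\<close>. The identity is Poisson
  summation over the lattice \<open>\<int>\<^sup>2\<close> for the radial function
  \<open>f x = 1 / (sqrt (x + \<alpha>) * sqrt (x + \<beta>) * (sqrt (x + \<alpha>) + sqrt (x + \<beta>)) powr (2 * \<nu>))\<close> of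
  \<open>x = a\<^sup>2 + b\<^sup>2\<close>. The closed expression on the right-hand side is \<open>f 0\<close> minus \<open>\<pi>\<close> times the
  integral of \<open>f\<close> over \<open>x > 0\<close>, the latter being the term of index 0 on the Bessel side.

  For positive \<open>p \<ge> q\<close> with \<open>d\<close> small compared to \<open>s\<close>, the function \<open>f\<close> is a Laplace transform:
  \<open>f x\<close> is the integral of \<open>exp (- x * t) * g t\<close> over \<open>t > 0\<close>, where \<open>g\<close> is
  \<open>exp (- (\<alpha> + \<beta>) * t / 2) * I\<^sub>\<nu> ((\<alpha> - \<beta>) * t / 2)\<close> divided by \<open>(\<alpha> - \<beta>) powr \<nu>\<close>. Summed against
  \<open>r2\<close>, the exponentials give the square of a theta function, whose inversion \<open>t \<mapsto> \<pi>\<^sup>2 / t\<close>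
  (\<open>theta2_inversion\<close>) turns \<open>exp (- n * t)\<close> into \<open>(\<pi> / t) * exp (- \<pi>\<^sup>2 * n / t)\<close>. It remains to
  integrate \<open>g\<close> against \<open>exp (- n * t)\<close>, against \<open>1 / t\<close> and against \<open>exp (- \<pi>\<^sup>2 * n / t) / t\<close>. All
  three integrals come from one device: \<open>g\<close> is expanded in powers of \<open>d\<^sup>2\<close> with \<open>s\<close> held fixed.
  The coefficients are Laguerre polynomials in \<open>s\<^sup>2 * t / 4\<close> times a Gamma density, and the
  three-term recurrence of the Macdonald integral makes their moments satisfy a recurrence in
  the degree (\<open>laguerre_moment_recurrence\<close>) that can be solved explicitly in all three cases. The
  expansion becomes a geometric series in the first case, a single term in the second, and the power
  series of \<open>I\<^sub>\<nu>\<close> times one value of \<open>K\<^sub>\<nu>\<close> in the third. This is \<open>real_identity\<close>.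

  Both sides of the identity are then holomorphic in \<open>p\<close> and in \<open>q\<close> on the right half-plane. Indeed
  \<open>I\<^sub>\<nu> (x * (p - q)) / (p - q) powr \<nu>\<close> is entire in \<open>p - q\<close> and bounded by a power of
  \<open>x\<close> times \<open>exp \<bar>x * Re (p - q)\<bar>\<close>, up to a constant (\<open>clifford_exp_bound\<close>), while \<open>K\<^sub>\<nu> (x * (p + q))\<close> is
  \<open>O (exp (- x * Re (p + q)))\<close>, so the Bessel series converges locally uniformly. Two
  applications of the identity theorem, first in \<open>p\<close> and then in \<open>q\<close>, give the general case
  (\<open>poisson_defect_zero\<close>).

  The function \<open>bessel_K\<close> is given by a quotient of series and a limit in the order, and is identified
  with Macdonald's integral in \<open>bessel_K_eq_macdonald\<close>: for \<open>-1 < Re \<nu> < 0\<close> a Wronskian argument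
  applies, for other orders that are not integers the identity theorem in \<open>\<nu>\<close>, and for integers
  continuity.
\<close>

section \<open>The Bessel-Clifford function\<close>

text \<open>
  The Bessel-Clifford function: \<open>I\<^sub>\<nu> z = (z / 2) powr \<nu> * clifford \<nu> (z\<^sup>2 / 4)\<close>. Splitting off the
  power leaves a function that is entire in both variables, so no branch of \<open>(p - q) powr \<nu>\<close> enters
  the continuation in \<open>p\<close> and \<open>q\<close>.
\<close>

definition clifford :: "complex \<Rightarrow> complex \<Rightarrow> complex" where
  "clifford \<nu> w = (\<Sum>k. w ^ k / fact k * rGamma (\<nu> + of_nat k + 1))"

text \<open>
  Locally uniform in \<open>\<nu>\<close>: once \<open>k \<ge> R\<close>, the step from \<open>k\<close> to \<open>k + 1\<close> divides by a number of modulus at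
  least 1, and the finitely many earlier arguments stay in a compact ball.
\<close>

lemma rGamma_shift_bounded:
  fixes R :: real
  obtains C where "C > 0" "\<And>\<nu> k. norm \<nu> \<le> R \<Longrightarrow> norm (rGamma (\<nu> + of_nat k + 1) :: complex) \<le> C"
proof -
  define N where "N = nat \<lceil>R\<rceil> + 1"
  have N: "real N \<ge> R + 1 \<or> R < 0" "real N \<ge> R"
    unfolding N_def by linarith+
  have "compact ((rGamma :: complex \<Rightarrow> complex) ` cball 0 (R + real N + 1))"
    by (intro compact_continuous_image continuous_intros) auto
  then obtain C where C: "C > 0" "\<And>x. x \<in> cball 0 (R + real N + 1) \<Longrightarrow> norm (rGamma x :: complex) \<le> C"
    by (metis (no_types, lifting) bounded_pos compact_imp_bounded imageI)
  have "norm (rGamma (\<nu> + of_nat k + 1) :: complex) \<le> C" if \<nu>: "norm \<nu> \<le> R" for \<nu> k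
  proof (induction k)
    case 0
    have "norm (\<nu> + 1) \<le> R + real N + 1" using \<nu> norm_triangle_ineq[of \<nu> 1] by simp
    then show ?case using C(2)[of "\<nu> + 1"] by simp
  next
    case (Suc k)
    show ?case
    proof (cases "Suc k \<le> N")
      case True
      have "norm (\<nu> + of_nat (Suc k) + 1) \<le> R + real (Suc k) + 1"
        using \<nu> norm_triangle_ineq[of "\<nu> + of_nat (Suc k)" 1] norm_triangle_ineq[of \<nu> "of_nat (Suc k)"]
        by (simp del: of_nat_Suc)
      also have "\<dots> \<le> R + real N + 1" using True by simp
      finally show ?thesis using C(2)[of "\<nu> + of_nat (Suc k) + 1"] by simp
    next
      case False
      define z where "z = \<nu> + of_nat k + 1"
      have "R \<ge> 0" using \<nu> norm_ge_zero order_trans by blast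
      then have "real k \<ge> R" using False N by linarith
      moreover have "norm (of_nat k + 1 :: complex) = real k + 1"
        by (metis norm_of_nat of_nat_Suc add.commute)
      ultimately have "norm z \<ge> 1" using \<nu> norm_triangle_ineq2[of "of_nat k + 1" "- \<nu>"]
        unfolding z_def by (simp add: algebra_simps)
      have "norm (rGamma (z + 1)) \<le> norm z * norm (rGamma (z + 1))"
        using \<open>norm z \<ge> 1\<close> by (simp add: mult_le_cancel_right1)
      also have "\<dots> = norm (rGamma z)" using rGamma_plus1[of z] by (metis norm_mult)
      also have "\<dots> \<le> C" using Suc z_def by simp
      finally show ?thesis by (simp add: z_def algebra_simps)
    qed
  qed
  with C(1) show thesis using that by blast
qed

lemma exp_terms_summable: "summable (\<lambda>k. (x::real) ^ k / fact k)"
  using summable_exp_generic[of x] by (simp add: divide_inverse mult.commute)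

lemma clifford_summable_norm: "summable (\<lambda>k. norm (w ^ k / fact k * rGamma (\<nu> + of_nat k + 1) :: complex))"
proof -
  obtain C where C: "C > 0" "\<And>\<nu>' k. norm \<nu>' \<le> norm \<nu> \<Longrightarrow> norm (rGamma (\<nu>' + of_nat k + 1) :: complex) \<le> C"
    using rGamma_shift_bounded by blast
  show ?thesis
  proof (rule summable_comparison_test)
    show "summable (\<lambda>k. norm w ^ k / fact k * C)"
      by (intro summable_mult2 exp_terms_summable)
    show "\<exists>N. \<forall>n\<ge>N. norm (norm (w ^ n / fact n * rGamma (\<nu> + of_nat n + 1))) \<le> norm w ^ n / fact n * C"
      using C by (auto simp: norm_mult norm_divide norm_power intro!: divide_right_mono mult_left_mono)
  qed
qed

lemma clifford_sums: "(\<lambda>k. w ^ k / fact k * rGamma (\<nu> + of_nat k + 1)) sums clifford \<nu> w"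
  unfolding clifford_def by (intro summable_sums summable_norm_cancel[OF clifford_summable_norm])

lemma clifford_has_field_derivative:
  "(clifford \<nu> has_field_derivative clifford (\<nu> + 1) w) (at w)"
proof -
  define c where "c k = rGamma (\<nu> + of_nat k + 1) / fact k" for k
  have s: "summable (\<lambda>k. c k * x ^ k)" for x
    using clifford_sums[of x \<nu>, THEN sums_summable] by (simp add: c_def mult.commute)
  have "((\<lambda>x. \<Sum>k. c k * x ^ k) has_field_derivative (\<Sum>k. diffs c k * w ^ k)) (at w)"
    by (rule termdiffs_strong_converges_everywhere) (rule s)
  moreover have "(\<lambda>x. \<Sum>k. c k * x ^ k) = clifford \<nu>"
    by (intro ext) (simp add: clifford_def c_def mult.commute)
  moreover have "diffs c k * w ^ k = w ^ k / fact k * rGamma (\<nu> + 1 + of_nat k + 1)" for k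
    by (simp add: diffs_def c_def add_ac del: of_nat_Suc) (simp add: divide_simps add_ac)
  ultimately show ?thesis by (simp add: clifford_def)
qed

lemma clifford_has_field_derivative' [derivative_intros]:
  assumes "(f has_field_derivative f') (at x within S)"
  shows "((\<lambda>x. clifford \<nu> (f x)) has_field_derivative (clifford (\<nu> + 1) (f x) * f')) (at x within S)"
  using DERIV_chain2[OF clifford_has_field_derivative assms] .

lemma clifford_holomorphic [holomorphic_intros]:
  "f holomorphic_on A \<Longrightarrow> (\<lambda>z. clifford \<nu> (f z)) holomorphic_on A"
proof -
  assume "f holomorphic_on A"
  moreover have "clifford \<nu> holomorphic_on UNIV"
    using clifford_has_field_derivative holomorphic_on_open by blast
  ultimately show ?thesis
    using holomorphic_on_compose_gen[of f A "clifford \<nu>" UNIV] by (simp add: o_def)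
qed

lemma clifford_continuous [continuous_intros]:
  assumes "continuous_on A f" shows "continuous_on A (\<lambda>z. clifford \<nu> (f z))"
proof -
  have "continuous_on UNIV (clifford \<nu>)"
    by (intro holomorphic_on_imp_continuous_on clifford_holomorphic[of "\<lambda>x. x"]) auto
  then show ?thesis using assms continuous_on_compose2 by blast
qed

lemma clifford_0: "clifford \<nu> 0 = rGamma (\<nu> + 1)"
proof -
  have "(\<lambda>k. 0 ^ k / fact k * rGamma (\<nu> + of_nat k + 1)) = (\<lambda>k. if k = 0 then rGamma (\<nu> + 1) else 0)"
    by (auto simp: power_0_left)
  then show ?thesis using sums_unique2[OF clifford_sums[of 0 \<nu>]] sums_single[of 0 "\<lambda>_. rGamma (\<nu> + 1)"] by simp
qed

lemma clifford_recurrence: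
  "clifford \<nu> w = (\<nu> + 1) * clifford (\<nu> + 1) w + w * clifford (\<nu> + 2) w"
proof -
  have 1: "(\<lambda>k. (\<nu> + 1) * (w ^ k / fact k * rGamma (\<nu> + 1 + of_nat k + 1))) sums ((\<nu> + 1) * clifford (\<nu> + 1) w)"
    by (intro sums_mult clifford_sums)
  have "(\<lambda>k. w * (w ^ k / fact k * rGamma (\<nu> + 2 + of_nat k + 1))) sums (w * clifford (\<nu> + 2) w)"
    by (intro sums_mult clifford_sums)
  moreover have "w * (w ^ k / fact k * rGamma (\<nu> + 2 + of_nat k + 1))
        = of_nat (Suc k) * w ^ Suc k / fact (Suc k) * rGamma (\<nu> + 1 + of_nat (Suc k) + 1)" for k
  proof -
    have "fact (Suc k) = (of_nat (Suc k) * fact k :: complex)" by (simp del: of_nat_Suc)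
    moreover have "(of_nat (Suc k) :: complex) \<noteq> 0" by (rule of_nat_neq_0)
    ultimately show ?thesis by (simp add: add_ac del: fact_Suc of_nat_Suc) (simp add: add_ac)
  qed
  ultimately have "(\<lambda>k. of_nat (Suc k) * w ^ Suc k / fact (Suc k) * rGamma (\<nu> + 1 + of_nat (Suc k) + 1))
      sums (w * clifford (\<nu> + 2) w)" by simp
  then have 2: "(\<lambda>k. of_nat k * w ^ k / fact k * rGamma (\<nu> + 1 + of_nat k + 1)) sums (w * clifford (\<nu> + 2) w)"
    by (subst (asm) sums_Suc_iff) simp
  have "(\<nu> + 1) * (w ^ k / fact k * rGamma (\<nu> + 1 + of_nat k + 1))
      + of_nat k * w ^ k / fact k * rGamma (\<nu> + 1 + of_nat k + 1)
      = w ^ k / fact k * rGamma (\<nu> + of_nat k + 1)" for k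
  proof -
    define g where "g = rGamma (\<nu> + 1 + of_nat k + 1)"
    have "rGamma (\<nu> + of_nat k + 1) = (\<nu> + of_nat k + 1) * g"
      using rGamma_plus1[of "\<nu> + of_nat k + 1"] by (simp add: g_def add_ac)
    then show ?thesis unfolding g_def[symmetric] by (simp add: field_simps)
  qed
  then show ?thesis using sums_unique2[OF clifford_sums] sums_add[OF 1 2] by simp
qed

lemma series_holomorphic:
  assumes S: "open S" and f: "\<And>n. f n holomorphic_on S"
    and b: "\<And>x. x \<in> S \<Longrightarrow> \<exists>d h. 0 < d \<and> summable h \<and> (\<forall>\<^sub>F n in sequentially. \<forall>y\<in>ball x d \<inter> S. norm (f n y :: complex) \<le> h n)"
  shows "(\<lambda>x. \<Sum>n. f n x) holomorphic_on S"
proof -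
  have "\<exists>g g'. \<forall>x \<in> S. ((\<lambda>n. f n x) sums g x) \<and> ((\<lambda>n. deriv (f n) x) sums g' x) \<and> (g has_field_derivative g' x) (at x)"
    by (rule series_and_derivative_comparison_local[OF S _ b]) (use f S holomorphic_derivI in blast)+
  then obtain g g' where g: "\<And>x. x \<in> S \<Longrightarrow> (\<lambda>n. f n x) sums g x" "\<And>x. x \<in> S \<Longrightarrow> (g has_field_derivative g' x) (at x)"
    by blast
  have "g holomorphic_on S" using g(2) S by (auto simp: holomorphic_on_open)
  then show ?thesis by (rule holomorphic_transform) (use g(1) sums_unique in blast)
qed

text \<open>
  Needed to continue the formula for \<open>K\<^sub>\<nu>\<close> in the order \<open>\<nu>\<close>.
\<close>

lemma clifford_holomorphic_order: "(\<lambda>\<nu>. clifford \<nu> w) holomorphic_on UNIV"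
  unfolding clifford_def
proof (rule series_holomorphic)
  let ?f = "\<lambda>k \<nu>. w ^ k / fact k * rGamma (\<nu> + of_nat k + 1)"
  show "?f k holomorphic_on UNIV" for k by (intro holomorphic_intros)
  fix x :: complex
  obtain C where C: "C > 0" "\<And>\<nu>' k. norm \<nu>' \<le> norm x + 1 \<Longrightarrow> norm (rGamma (\<nu>' + of_nat k + 1) :: complex) \<le> C"
    using rGamma_shift_bounded by blast
  have "norm (?f k y) \<le> norm w ^ k / fact k * C" if "y \<in> ball x 1" for k y
  proof -
    have "norm y \<le> norm x + 1" using that norm_triangle_ineq2[of y x] by (simp add: dist_norm norm_minus_commute)
    then show ?thesis using C
      by (auto simp: norm_mult norm_divide norm_power intro!: divide_right_mono mult_left_mono)
  qed
  moreover have "summable (\<lambda>k. norm w ^ k / fact k * C)"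
    by (intro summable_mult2 exp_terms_summable)
  ultimately show "\<exists>d h. 0 < d \<and> summable h \<and> (\<forall>\<^sub>F n in sequentially. \<forall>y\<in>ball x d \<inter> UNIV. norm (?f n y) \<le> h n)"
    by (intro exI[of _ 1] exI[of _ "\<lambda>k. norm w ^ k / fact k * C"]) (auto intro!: always_eventually)
qed auto

lemma rGamma_shift_le_fact:
  assumes "Re \<nu> \<ge> 0"
  shows "norm (rGamma (\<nu> + of_nat k + 1) :: complex) \<le> norm (rGamma (\<nu> + 1)) / fact k"
proof (induction k)
  case (Suc k)
  define z where "z = \<nu> + of_nat k + 1"
  have "real (Suc k) \<le> Re z" using assms by (simp add: z_def)
  also have "\<dots> \<le> norm z" by (rule complex_Re_le_cmod)
  finally have "real (Suc k) * norm (rGamma (z + 1)) \<le> norm z * norm (rGamma (z + 1))"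
    by (intro mult_right_mono) auto
  also have "\<dots> = norm (rGamma z)" using rGamma_plus1[of z] by (metis norm_mult)
  also have "\<dots> \<le> norm (rGamma (\<nu> + 1)) / fact k" using Suc z_def by simp
  finally have "norm (rGamma (z + 1)) \<le> norm (rGamma (\<nu> + 1)) / fact k / real (Suc k)"
    by (simp add: pos_le_divide_eq mult_ac del: of_nat_Suc)
  moreover have "z + 1 = \<nu> + of_nat (Suc k) + 1" by (simp add: z_def)
  ultimately show ?case by (simp add: mult.commute del: of_nat_Suc)
qed simp

text \<open>
  The bound holds because \<open>1 / \<bar>\<Gamma> (\<nu> + k + 1)\<bar>\<close> is at most \<open>1 / k!\<close> up to a constant, and the sum of the
  squares \<open>(x ^ k / k!)\<^sup>2\<close> is at most \<open>(exp x)\<^sup>2\<close>. It provides the dominating function for integrating the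
  Laguerre expansion term by term; for that, the sum of the absolute values has to be controlled.
\<close>

lemma clifford_majorant:
  assumes "Re \<nu> \<ge> 0" "x \<ge> 0"
  shows "(\<Sum>k. (x\<^sup>2) ^ k / fact k * norm (rGamma (\<nu> + of_nat k + 1) :: complex)) \<le> norm (rGamma (\<nu> + 1)) * exp (2 * x)"
proof -
  have le: "(x\<^sup>2) ^ k / fact k * norm (rGamma (\<nu> + of_nat k + 1) :: complex)
     \<le> norm (rGamma (\<nu> + 1)) * exp x * (x ^ k / fact k)" for k
  proof -
    have "x ^ k / fact k \<le> (\<Sum>k. x ^ k / fact k)"
      using sum_le_suminf[OF exp_terms_summable, of "{k}" x] assms by simp
    also have "\<dots> = exp x" by (simp add: exp_def divide_inverse mult.commute)
    finally have e: "x ^ k / fact k \<le> exp x" .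
    have "(x\<^sup>2) ^ k / fact k * norm (rGamma (\<nu> + of_nat k + 1) :: complex)
       \<le> (x\<^sup>2) ^ k / fact k * (norm (rGamma (\<nu> + 1)) / fact k)"
      by (intro mult_left_mono rGamma_shift_le_fact assms) (use assms in auto)
    also have "\<dots> = norm (rGamma (\<nu> + 1)) * (x ^ k / fact k) * (x ^ k / fact k)"
      by (simp add: power2_eq_square power_mult_distrib)
    also have "\<dots> \<le> norm (rGamma (\<nu> + 1)) * exp x * (x ^ k / fact k)"
      by (intro mult_right_mono mult_left_mono e) (use assms in auto)
    finally show ?thesis .
  qed
  have s: "summable (\<lambda>k. norm (rGamma (\<nu> + 1)) * exp x * (x ^ k / fact k))"
    by (intro summable_mult exp_terms_summable)
  have "(\<Sum>k. (x\<^sup>2) ^ k / fact k * norm (rGamma (\<nu> + of_nat k + 1) :: complex))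
     \<le> (\<Sum>k. norm (rGamma (\<nu> + 1)) * exp x * (x ^ k / fact k))"
  proof (rule suminf_le[OF le _ s])
    show "summable (\<lambda>k. (x\<^sup>2) ^ k / fact k * norm (rGamma (\<nu> + of_nat k + 1)))"
      using clifford_summable_norm[of "of_real (x\<^sup>2)" \<nu>] by (simp add: norm_mult norm_divide norm_power)
  qed
  also have "\<dots> = norm (rGamma (\<nu> + 1)) * exp x * exp x"
    by (subst suminf_mult[OF exp_terms_summable]) (simp add: exp_def divide_inverse mult.commute)
  finally show ?thesis by (simp add: mult.assoc mult_exp_exp)
qed

text \<open>
  The power series alone gives growth \<open>exp \<bar>z\<bar>\<close>; the convergence of the Bessel series for complex
  parameters requires \<open>exp \<bar>Re z\<bar>\<close>. This is an energy estimate: \<open>y z = clifford \<nu> (z\<^sup>2 / 4)\<close> satisfies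
  \<open>y'' = y - (2 * \<nu> + 1) / z * y'\<close>, and along a ray of direction \<open>\<omega>\<close> the derivative of
  \<open>\<bar>y\<bar>\<^sup>2 + \<bar>y'\<bar>\<^sup>2\<close> is at most \<open>2 * \<bar>Re \<omega>\<bar>\<close> times this quantity, since the damping term has the
  favourable sign for \<open>Re \<nu> \<ge> -1/2\<close>.
\<close>

lemma clifford_exp_bound:
  assumes \<nu>: "Re \<nu> \<ge> - 1 / 2"
  shows "norm (clifford \<nu> (z\<^sup>2 / 4)) \<le> norm (rGamma (\<nu> + 1)) * exp \<bar>Re z\<bar>"
proof (cases "z = 0")
  case True then show ?thesis by (simp add: clifford_0)
next
  case False
  define \<omega> where "\<omega> = sgn z"
  define r where "r = norm z"
  define c where "c = \<bar>Re \<omega>\<bar>"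
  have z: "z = of_real r * \<omega>" unfolding \<omega>_def r_def sgn_eq using False by simp
  have \<omega>: "cnj \<omega> * \<omega> = 1"
  proof -
    have "norm \<omega> = 1" using False by (simp add: \<omega>_def norm_sgn)
    then show ?thesis using complex_norm_square[of \<omega>] by (simp add: mult.commute)
  qed
  define y where "y x = clifford \<nu> ((of_real x * \<omega>)\<^sup>2 / 4)" for x :: real
  define y1 where "y1 x = clifford (\<nu> + 1) ((of_real x * \<omega>)\<^sup>2 / 4)" for x :: real
  define v where "v x = (of_real x * \<omega> / 2) * y1 x" for x :: real
  have dy: "(y has_vector_derivative \<omega> * v x) (at x)" for x
  proof -
    have "((\<lambda>u. clifford \<nu> ((u * \<omega>)\<^sup>2 / 4)) has_field_derivative \<omega> * v x) (at (of_real x))"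
      by (rule derivative_eq_intros refl | simp)+ (simp add: v_def y1_def)
    from has_vector_derivative_real_field[OF this] show ?thesis by (simp add: y_def[abs_def])
  qed
  have dv: "(v has_vector_derivative \<omega> * (y x - (\<nu> + 1 / 2) * y1 x)) (at x)" for x
  proof -
    have r: "y x = (\<nu> + 1) * y1 x + (of_real x * \<omega>)\<^sup>2 / 4 * clifford (\<nu> + 2) ((of_real x * \<omega>)\<^sup>2 / 4)"
      unfolding y_def y1_def by (rule clifford_recurrence)
    have "((\<lambda>u. (u * \<omega> / 2) * clifford (\<nu> + 1) ((u * \<omega>)\<^sup>2 / 4)) has_field_derivative
       \<omega> * (y x - (\<nu> + 1 / 2) * y1 x)) (at (of_real x))"
      unfolding r by (rule derivative_eq_intros refl | simp)+
         (simp add: y1_def add.assoc power2_eq_square field_simps)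
    from has_vector_derivative_real_field[OF this] show ?thesis
      by (simp add: v_def[abs_def] y1_def[abs_def])
  qed
  define E where "E x = (norm (y x))\<^sup>2 + (norm (v x))\<^sup>2" for x
  have nsq: "((\<lambda>x. (norm (f x))\<^sup>2) has_real_derivative 2 * Re (cnj (f x) * f')) (at x)"
    if "(f has_vector_derivative f') (at x)" for f :: "real \<Rightarrow> complex" and f' x
  proof -
    have 1: "((\<lambda>x. Re (f x)) has_real_derivative Re f') (at x)"
      using bounded_linear.has_vector_derivative[OF bounded_linear_Re that]
      by (simp add: has_real_derivative_iff_has_vector_derivative)
    have 2: "((\<lambda>x. Im (f x)) has_real_derivative Im f') (at x)"
      using bounded_linear.has_vector_derivative[OF bounded_linear_Im that]
      by (simp add: has_real_derivative_iff_has_vector_derivative)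
    have "((\<lambda>x. (Re (f x))\<^sup>2 + (Im (f x))\<^sup>2) has_real_derivative 2 * Re (f x) * Re f' + 2 * Im (f x) * Im f') (at x)"
      by (rule derivative_eq_intros 1 2 refl | simp)+
    then show ?thesis by (simp add: cmod_power2 algebra_simps)
  qed
  define E' where "E' x = 2 * Re (cnj (y x) * (\<omega> * v x)) + 2 * Re (cnj (v x) * (\<omega> * (y x - (\<nu> + 1 / 2) * y1 x)))" for x
  have dE: "(E has_real_derivative E' x) (at x)" for x
    unfolding E_def E'_def by (intro DERIV_add nsq dy dv)
  \<comment> \<open>The term with \<open>Re \<nu> + 1 / 2\<close> is the damping term; it is dropped.\<close>
  have E'_le: "E' x \<le> 2 * c * E x" if "x \<ge> 0" for x
  proof -
    have a: "cnj (v x) * (\<omega> * y1 x) = of_real (x / 2 * (norm (y1 x))\<^sup>2)"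
    proof -
      have "cnj (v x) * (\<omega> * y1 x) = of_real (x / 2) * (cnj \<omega> * \<omega>) * (cnj (y1 x) * y1 x)"
        by (simp add: v_def)
      also have "cnj (y1 x) * y1 x = of_real ((norm (y1 x))\<^sup>2)"
        by (metis complex_norm_square mult.commute of_real_power)
      finally show ?thesis by (simp add: \<omega>)
    qed
    have b: "Re (cnj (v x) * (\<omega> * ((\<nu> + 1 / 2) * y1 x))) = (Re \<nu> + 1 / 2) * (x / 2 * (norm (y1 x))\<^sup>2)"
    proof -
      have "cnj (v x) * (\<omega> * ((\<nu> + 1 / 2) * y1 x)) = (\<nu> + 1 / 2) * (cnj (v x) * (\<omega> * y1 x))" by simp
      then show ?thesis unfolding a by (simp only:) (simp del: of_real_mult of_real_power of_real_divide)
    qed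
    have "E' x = 2 * Re (\<omega> * (cnj (y x) * v x + cnj (cnj (y x) * v x)))
        - 2 * ((Re \<nu> + 1 / 2) * (x / 2 * (norm (y1 x))\<^sup>2))"
      unfolding E'_def b[symmetric] by (simp add: algebra_simps)
    also have "\<dots> \<le> 2 * Re (\<omega> * (cnj (y x) * v x + cnj (cnj (y x) * v x)))"
      using \<nu> that by simp
    also have "\<dots> = 4 * (Re \<omega> * Re (cnj (y x) * v x))"
      by (subst complex_add_cnj) simp
    also have "\<dots> \<le> 4 * (c * (E x / 2))"
    proof -
      have "Re \<omega> * Re (cnj (y x) * v x) \<le> c * \<bar>Re (cnj (y x) * v x)\<bar>"
        unfolding c_def by (metis abs_ge_self abs_mult)
      also have "\<dots> \<le> c * (norm (y x) * norm (v x))"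
        using abs_Re_le_cmod[of "cnj (y x) * v x"] by (intro mult_left_mono) (simp_all only: norm_mult complex_mod_cnj c_def abs_ge_zero)
      also have "\<dots> \<le> c * (E x / 2)"
        using sum_squares_bound[of "norm (y x)" "norm (v x)"] by (intro mult_left_mono) (simp_all add: E_def c_def)
      finally show ?thesis by simp
    qed
    finally show ?thesis by simp
  qed
  define h where "h x = exp (- 2 * c * x) * E x" for x
  have "h r \<le> h 0"
  proof (rule DERIV_nonpos_imp_nonincreasing[of 0 r h])
    show "0 \<le> r" by (simp add: r_def)
    fix x assume "0 \<le> x" "x \<le> r"
    have "(h has_real_derivative exp (- 2 * c * x) * (E' x - 2 * c * E x)) (at x)"
      unfolding h_def by (rule derivative_eq_intros dE refl | simp)+ (simp add: algebra_simps)
    moreover have "exp (- 2 * c * x) * (E' x - 2 * c * E x) \<le> 0"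
      using E'_le[OF \<open>0 \<le> x\<close>] by (simp add: mult_le_0_iff)
    ultimately show "\<exists>y. (h has_real_derivative y) (at x) \<and> y \<le> 0" by blast
  qed
  moreover have "h 0 = (norm (rGamma (\<nu> + 1)))\<^sup>2"
    by (simp add: h_def E_def y_def v_def clifford_0)
  ultimately have "E r \<le> exp (2 * c * r) * (norm (rGamma (\<nu> + 1)))\<^sup>2"
    by (simp add: h_def exp_minus field_simps)
  moreover have "(norm (y r))\<^sup>2 \<le> E r" by (simp add: E_def)
  ultimately have "(norm (y r))\<^sup>2 \<le> exp (2 * c * r) * (norm (rGamma (\<nu> + 1)))\<^sup>2"
    by linarith
  also have "\<dots> = (norm (rGamma (\<nu> + 1)) * exp (c * r))\<^sup>2"
    by (simp add: power_mult_distrib exp_double[of "c * r"] mult.assoc mult.commute[of "exp _"])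
  finally have "norm (y r) \<le> norm (rGamma (\<nu> + 1)) * exp (c * r)"
    by (rule power2_le_imp_le) simp
  moreover have "c * r = \<bar>Re z\<bar>" 
    by (subst z) (simp add: c_def abs_mult r_def)
  ultimately show ?thesis by (simp add: y_def flip: z)
qed

section \<open>Exponential integrals on the real line\<close>

text \<open>
  Differentiation under the integral sign in a complex parameter: the bound on \<open>f'\<close> over a ball also bounds
  the difference quotients, so dominated convergence applies.
\<close>

lemma has_field_derivative_integral:
  fixes f f' :: "complex \<Rightarrow> real \<Rightarrow> complex"
  assumes r: "r > 0"
    and der: "\<And>z t. z \<in> ball z0 r \<Longrightarrow> ((\<lambda>z. f z t) has_field_derivative f' z t) (at z)"
    and bound: "\<And>z t. z \<in> ball z0 r \<Longrightarrow> norm (f' z t) \<le> g t"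
    and g: "integrable lborel g"
    and f: "\<And>z. z \<in> ball z0 r \<Longrightarrow> integrable lborel (f z)"
    and meas [measurable]: "f' z0 \<in> borel_measurable lborel"
  shows "((\<lambda>z. \<integral>t. f z t \<partial>lborel) has_field_derivative (\<integral>t. f' z0 t \<partial>lborel)) (at z0)"
  unfolding has_field_derivative_iff tendsto_at_iff_sequentially comp_def
proof (intro allI impI)
  let ?F = "\<lambda>z. \<integral>t. f z t \<partial>lborel"
  fix X :: "nat \<Rightarrow> complex"
  assume X: "\<forall>i. X i \<in> UNIV - {z0}" "X \<longlonglongrightarrow> z0"
  have "\<forall>\<^sub>F i in sequentially. X i \<in> ball z0 r"
    using X(2) r by (metis centre_in_ball open_ball topological_tendstoD)
  then obtain N where N: "\<And>i. X (i + N) \<in> ball z0 r"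
    by (auto simp: eventually_sequentially) (metis le_add2)
  have z0: "z0 \<in> ball z0 r" using r by simp
  have "(\<lambda>i. \<integral>t. (f (X (i + N)) t - f z0 t) / (X (i + N) - z0) \<partial>lborel) \<longlonglongrightarrow> (\<integral>t. f' z0 t \<partial>lborel)"
  proof (rule integral_dominated_convergence[where w = g])
    show "(\<lambda>t. (f (X (i + N)) t - f z0 t) / (X (i + N) - z0)) \<in> borel_measurable lborel" for i
      using f[OF N[of i]] f[OF z0] by measurable
    show "AE t in lborel. (\<lambda>i. (f (X (i + N)) t - f z0 t) / (X (i + N) - z0)) \<longlonglongrightarrow> f' z0 t"
    proof (rule AE_I2)
      fix t
      have "((\<lambda>y. (f y t - f z0 t) / (y - z0)) \<longlongrightarrow> f' z0 t) (at z0)"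
        using der[OF z0, of t] by (simp add: has_field_derivative_iff)
      then have "(\<lambda>i. (f (X i) t - f z0 t) / (X i - z0)) \<longlonglongrightarrow> f' z0 t"
        using X unfolding tendsto_at_iff_sequentially comp_def by blast
      then show "(\<lambda>i. (f (X (i + N)) t - f z0 t) / (X (i + N) - z0)) \<longlonglongrightarrow> f' z0 t"
        by (rule LIMSEQ_ignore_initial_segment)
    qed
    show "AE t in lborel. norm ((f (X (i + N)) t - f z0 t) / (X (i + N) - z0)) \<le> g t" for i
    proof (rule AE_I2)
      fix t
      have "norm (f (X (i + N)) t - f z0 t) \<le> g t * norm (X (i + N) - z0)"
        by (rule field_differentiable_bound[of "ball z0 r" "\<lambda>z. f z t" "\<lambda>z. f' z t"])
           (use der bound N z0 in \<open>auto intro: has_field_derivative_at_within\<close>)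
      then show "norm ((f (X (i + N)) t - f z0 t) / (X (i + N) - z0)) \<le> g t"
        using X(1) by (simp add: norm_divide divide_le_eq)
    qed
  qed (use g in auto)
  moreover have "(\<integral>t. (f (X (i + N)) t - f z0 t) / (X (i + N) - z0) \<partial>lborel)
      = (?F (X (i + N)) - ?F z0) / (X (i + N) - z0)" for i
    using f[OF N[of i]] f[OF z0] by (subst integral_divide_zero) (simp add: Bochner_Integration.integral_diff)
  ultimately have "(\<lambda>i. (?F (X (i + N)) - ?F z0) / (X (i + N) - z0)) \<longlonglongrightarrow> (\<integral>t. f' z0 t \<partial>lborel)"
    by (simp only:)
  then show "(\<lambda>i. (?F (X i) - ?F z0) / (X i - z0)) \<longlonglongrightarrow> (\<integral>t. f' z0 t \<partial>lborel)"
    by (rule LIMSEQ_offset)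
qed

text \<open>
  Integrals over \<open>t > 0\<close> with respect to \<open>dt / t\<close> are transported to the whole line by \<open>t = exp \<tau>\<close>. The
  scaling of \<open>t\<close> then becomes a translation and the inversion of \<open>t\<close> a reflection, and these are the only
  changes of variables used below. The kernel is \<open>t powr \<mu> * exp (- a * t - b / t)\<close>.
\<close>

definition exp_ker :: "complex \<Rightarrow> complex \<Rightarrow> complex \<Rightarrow> real \<Rightarrow> complex" where
  "exp_ker \<mu> a b \<tau> = exp (\<mu> * of_real \<tau> - a * of_real (exp \<tau>) - b * of_real (exp (- \<tau>)))"

definition exp_int :: "complex \<Rightarrow> complex \<Rightarrow> complex \<Rightarrow> complex" where
  "exp_int \<mu> a b = (\<integral>\<tau>. exp_ker \<mu> a b \<tau> \<partial>lborel)"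

lemma exp_ker_measurable [measurable]: "exp_ker \<mu> a b \<in> borel_measurable borel"
  unfolding exp_ker_def[abs_def]
  by (intro borel_measurable_continuous_onI continuous_intros)

lemma norm_exp_ker: "norm (exp_ker \<mu> a b \<tau>) = exp (Re \<mu> * \<tau> - Re a * exp \<tau> - Re b * exp (- \<tau>))"
  by (simp add: exp_ker_def)

lemma exp_ker_shift: "exp_ker \<mu> a b \<tau> * exp (of_real \<tau>) = exp_ker (\<mu> + 1) a b \<tau>"
                "exp_ker \<mu> a b \<tau> * exp (- of_real \<tau>) = exp_ker (\<mu> - 1) a b \<tau>"
  by (simp_all add: exp_ker_def algebra_simps flip: exp_add)

text \<open>
  Euler's integral in the logarithmic variable.
\<close>

lemma Gamma_exp_integral:
  assumes "Re \<mu> > 0"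
  shows "has_bochner_integral lborel (exp_ker \<mu> 1 0) (Gamma \<mu>)"
proof -
  let ?f = "\<lambda>t::real. of_real t powr (\<mu> - 1) / of_real (exp t) :: complex"
  have rng: "range exp = ({0<..} :: real set)"
    by (metis UNIV_eq_I exp_gt_zero exp_ln greaterThan_iff image_iff subsetI subset_antisym image_subsetI rangeI)
  have fe: "\<bar>exp \<tau>\<bar> *\<^sub>R ?f (exp \<tau>) = exp_ker \<mu> 1 0 \<tau>" for \<tau>
    by (simp add: exp_ker_def powr_def scaleR_conv_of_real exp_of_real[symmetric] Ln_of_real exp_diff ring_distribs
             exp_add[symmetric] field_simps flip: exp_minus)
  have ai: "?f absolutely_integrable_on exp ` UNIV"
    unfolding rng using absolutely_integrable_Gamma_integral'[OF assms] .
  have der: "\<And>x. x \<in> UNIV \<Longrightarrow> (exp has_field_derivative exp x) (at x within UNIV)" for x :: real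
    by (auto intro!: derivative_eq_intros)
  have "exp_ker \<mu> 1 0 absolutely_integrable_on UNIV"
    using absolutely_integrable_change_of_variables_real[of UNIV exp exp ?f] ai der
    by (simp only: fe) (simp add: inj_on_def)
  then have int: "integrable lborel (exp_ker \<mu> 1 0)"
    by (simp add: set_integrable_def integrable_completion)
  have hi: "(?f has_integral Gamma \<mu>) {0<..}"
    using Gamma_integral_complex'[OF assms] .
  have part: "(\<integral>\<tau>. L (exp_ker \<mu> 1 0 \<tau>) \<partial>lborel) = L (Gamma \<mu>)"
    if L: "bounded_linear L" for L :: "complex \<Rightarrow> real"
  proof -
    have a1: "(\<lambda>t. L (?f t)) absolutely_integrable_on exp ` UNIV"
      using absolutely_integrable_linear[OF ai L] by (simp add: o_def)
    have a2: "integral (exp ` UNIV) (\<lambda>t. L (?f t)) = L (Gamma \<mu>)"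
      using has_integral_linear[OF hi L] unfolding rng by (simp add: o_def integral_unique)
    have "(\<lambda>x. \<bar>exp x\<bar> * L (?f (exp x))) absolutely_integrable_on UNIV \<and>
          integral UNIV (\<lambda>x. \<bar>exp x\<bar> * L (?f (exp x))) = L (Gamma \<mu>)"
      by (rule has_absolute_integral_change_of_variables_1'[THEN iffD2]) (use a1 a2 der in \<open>auto simp: inj_on_def\<close>)
    moreover have "\<bar>exp x\<bar> * L (?f (exp x)) = L (exp_ker \<mu> 1 0 x)" for x
      unfolding fe[symmetric] using linear_scale[OF bounded_linear.linear[OF L]] by simp
    ultimately have "integral UNIV (\<lambda>x. L (exp_ker \<mu> 1 0 x)) = L (Gamma \<mu>)" by simp
    moreover have "integrable lborel (\<lambda>x. L (exp_ker \<mu> 1 0 x))"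
      using integrable_bounded_linear[OF L int] .
    ultimately show ?thesis by (simp add: integral_lborel)
  qed
  have "integral\<^sup>L lborel (exp_ker \<mu> 1 0) = Gamma \<mu>"
    using part[OF bounded_linear_Re] part[OF bounded_linear_Im] int
    by (intro complex_eqI) simp_all
  with int show ?thesis by (simp add: has_bochner_integral_iff)
qed

lemma exp_real_integrable_right:
  assumes "a > 0" "m > 0"
  shows "integrable lborel (\<lambda>\<tau>::real. exp (m * \<tau> - a * exp \<tau>))"
proof -
  have "integrable lborel (exp_ker (of_real m) 1 0)"
    using Gamma_exp_integral[of "of_real m"] assms by (simp add: has_bochner_integral_iff)
  then have "integrable lborel (\<lambda>\<tau>. norm (exp_ker (of_real m) 1 0 \<tau>))" by (rule integrable_norm)
  then have "integrable lborel (\<lambda>\<tau>. norm (exp_ker (of_real m) 1 0 (ln a + 1 * \<tau>)))"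
    by (rule lborel_integrable_real_affine) simp
  then have "integrable lborel (\<lambda>\<tau>. a powr m * exp (m * \<tau> - a * exp \<tau>))"
    using assms by (simp add: norm_exp_ker exp_add ring_distribs exp_diff powr_def mult_ac)
  then show ?thesis using assms by simp
qed

lemma exp_real_integrable:
  assumes "a > 0" "b > 0"
  shows "integrable lborel (\<lambda>\<tau>::real. exp (m * \<tau> - a * exp \<tau> - b * exp (- \<tau>)))"
proof -
  have 1: "integrable lborel (\<lambda>\<tau>::real. exp ((\<bar>m\<bar> + 1) * \<tau> - a * exp \<tau>))"
    by (rule exp_real_integrable_right) (use assms in auto)
  have "integrable lborel (\<lambda>\<tau>::real. exp ((\<bar>m\<bar> + 1) * \<tau> - b * exp \<tau>))"
    by (rule exp_real_integrable_right) (use assms in auto)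
  then have 2: "integrable lborel (\<lambda>\<tau>::real. exp ((\<bar>m\<bar> + 1) * (0 + (-1) * \<tau>) - b * exp (0 + (-1) * \<tau>)))"
    by (rule lborel_integrable_real_affine) simp
  show ?thesis
  proof (rule Bochner_Integration.integrable_bound[OF Bochner_Integration.integrable_add[OF 1 2]])
    show "AE \<tau> in lborel. norm (exp (m * \<tau> - a * exp \<tau> - b * exp (- \<tau>)))
       \<le> norm (exp ((\<bar>m\<bar> + 1) * \<tau> - a * exp \<tau>) + exp ((\<bar>m\<bar> + 1) * (0 + -1 * \<tau>) - b * exp (0 + -1 * \<tau>)))"
    proof (rule AE_I2)
      fix \<tau> :: real
      have ab: "a * exp \<tau> \<ge> 0" "b * exp (- \<tau>) \<ge> 0" using assms by auto
      have "m * \<tau> \<le> \<bar>m\<bar> * \<bar>\<tau>\<bar>" by (metis abs_ge_self abs_mult)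
      show "norm (exp (m * \<tau> - a * exp \<tau> - b * exp (- \<tau>)))
       \<le> norm (exp ((\<bar>m\<bar> + 1) * \<tau> - a * exp \<tau>) + exp ((\<bar>m\<bar> + 1) * (0 + -1 * \<tau>) - b * exp (0 + -1 * \<tau>)))"
      proof (cases "\<tau> \<ge> 0")
        case True
        have "exp (m * \<tau> - a * exp \<tau> - b * exp (- \<tau>)) \<le> exp ((\<bar>m\<bar> + 1) * \<tau> - a * exp \<tau>)"
          using ab True \<open>m * \<tau> \<le> \<bar>m\<bar> * \<bar>\<tau>\<bar>\<close> by (simp add: algebra_simps)
        then show ?thesis by (simp add: add_increasing2)
      next
        case False
        have "exp (m * \<tau> - a * exp \<tau> - b * exp (- \<tau>)) \<le> exp ((\<bar>m\<bar> + 1) * (- \<tau>) - b * exp (- \<tau>))"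
          using ab False \<open>m * \<tau> \<le> \<bar>m\<bar> * \<bar>\<tau>\<bar>\<close> by (simp add: algebra_simps)
        then show ?thesis by (simp add: add_increasing)
      qed
    qed
  qed measurable
qed

lemma exp_ker_integrable:
  assumes "Re a > 0" "Re b > 0 \<or> (Re b = 0 \<and> Re \<mu> > 0)"
  shows "integrable lborel (exp_ker \<mu> a b)"
proof (rule integrable_norm_cancel)
  show "integrable lborel (\<lambda>\<tau>. norm (exp_ker \<mu> a b \<tau>))"
    using assms exp_real_integrable[of "Re a" "Re b" "Re \<mu>"] exp_real_integrable_right[of "Re a" "Re \<mu>"]
    by (auto simp: norm_exp_ker)
qed simp

lemma exp_int_translate: "exp_int \<mu> a b = exp (\<mu> * of_real h) * exp_int \<mu> (a * of_real (exp h)) (b * of_real (exp (- h)))"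
proof -
  have "exp_int \<mu> a b = (\<integral>\<tau>. exp_ker \<mu> a b (h + 1 * \<tau>) \<partial>lborel)"
    unfolding exp_int_def by (subst lborel_integral_real_affine[of 1 _ h]) auto
  also have "(\<lambda>\<tau>. exp_ker \<mu> a b (h + 1 * \<tau>)) = (\<lambda>\<tau>. exp (\<mu> * of_real h) * exp_ker \<mu> (a * of_real (exp h)) (b * of_real (exp (- h))) \<tau>)"
    by (intro ext) (simp add: exp_ker_def algebra_simps exp_add[of "of_real _" "of_real _"] exp_add[of "_::real"] exp_diff[of "- _::real"] exp_minus[of h] divide_inverse flip: exp_add[of "\<mu> * _"])
  finally show ?thesis by (simp add: exp_int_def)
qed

lemma exp_int_reflect: "exp_int (- \<mu>) b a = exp_int \<mu> a b"
proof -
  have "exp_int \<mu> a b = (\<integral>\<tau>. exp_ker \<mu> a b (0 + (-1) * \<tau>) \<partial>lborel)"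
    unfolding exp_int_def by (subst lborel_integral_real_affine[of "-1" _ 0]) auto
  also have "(\<lambda>\<tau>. exp_ker \<mu> a b (0 + (-1) * \<tau>)) = exp_ker (- \<mu>) b a"
    by (intro ext) (simp add: exp_ker_def algebra_simps)
  finally show ?thesis by (simp add: exp_int_def)
qed

lemma exp_int_Gamma:
  assumes "Re \<mu> > 0" "a > 0"
  shows "exp_int \<mu> (of_real a) 0 = Gamma \<mu> * of_real a powr (- \<mu>)"
proof -
  have "exp_int \<mu> (of_real a) 0 = exp (\<mu> * of_real (- ln a)) * exp_int \<mu> (of_real a * of_real (exp (- ln a))) 0"
    using exp_int_translate[of \<mu> "of_real a" 0 "- ln a"] by simp
  also have "of_real a * of_real (exp (- ln a)) = (1::complex)"
    using assms by (simp add: exp_minus flip: of_real_mult)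
  also have "exp_int \<mu> 1 0 = Gamma \<mu>"
    unfolding exp_int_def using Gamma_exp_integral[OF assms(1)] by (simp add: has_bochner_integral_iff)
  also have "exp (\<mu> * of_real (- ln a)) = of_real a powr (- \<mu>)"
    using assms by (simp add: powr_def Ln_of_real)
  finally show ?thesis by simp
qed

lemma exp_ker_tendsto_0:
  assumes "Re a > 0" "Re b > 0 \<or> (Re b = 0 \<and> Re \<mu> > 0)"
  shows "(exp_ker \<mu> a b \<longlongrightarrow> 0) at_top" "(exp_ker \<mu> a b \<longlongrightarrow> 0) at_bot"
proof -
  have "((\<lambda>\<tau>. exp (Re \<mu> * \<tau> - Re a * exp \<tau>)) \<longlongrightarrow> 0) at_top"
    using assms(1) by real_asymp
  then show "(exp_ker \<mu> a b \<longlongrightarrow> 0) at_top"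
    by (rule Lim_null_comparison[rotated]) (use assms in \<open>auto simp: norm_exp_ker\<close>)
  show "(exp_ker \<mu> a b \<longlongrightarrow> 0) at_bot"
  proof (cases "Re b > 0")
    case True
    then have "((\<lambda>\<tau>. exp (Re \<mu> * \<tau> - Re b * exp (- \<tau>))) \<longlongrightarrow> 0) at_bot"
      by real_asymp
    then show ?thesis
      by (rule Lim_null_comparison[rotated]) (use assms in \<open>auto simp: norm_exp_ker\<close>)
  next
    case False
    then have "Re \<mu> > 0" "Re b = 0" using assms by auto
    then have "((\<lambda>\<tau>. exp (Re \<mu> * \<tau>)) \<longlongrightarrow> 0) at_bot"
      by real_asymp
    then show ?thesis
      by (rule Lim_null_comparison[rotated]) (use assms \<open>Re b = 0\<close> in \<open>auto simp: norm_exp_ker\<close>)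
  qed
qed

text \<open>
  The integral of the derivative of the kernel vanishes. For \<open>b = 0\<close> this is the functional equation of
  \<open>Gamma\<close>, for \<open>a = b = z / 2\<close> the recurrence of \<open>K\<^sub>\<nu>\<close> in the order.
\<close>

lemma exp_int_recurrence:
  assumes "Re a > 0" "Re b > 0 \<or> (b = 0 \<and> Re \<mu> > 0)"
  shows "\<mu> * exp_int \<mu> a b = a * exp_int (\<mu> + 1) a b - b * exp_int (\<mu> - 1) a b"
proof -
  let ?f = "\<lambda>\<tau>. \<mu> * exp_ker \<mu> a b \<tau> - a * exp_ker (\<mu> + 1) a b \<tau> + b * exp_ker (\<mu> - 1) a b \<tau>"
  have i0: "integrable lborel (exp_ker \<mu> a b)" "integrable lborel (exp_ker (\<mu> + 1) a b)"
    by (rule exp_ker_integrable; use assms in auto)+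
  have i1: "integrable lborel (\<lambda>\<tau>. b * exp_ker (\<mu> - 1) a b \<tau>)"
    using exp_ker_integrable[of a b "\<mu> - 1"] assms by (cases "b = 0") auto
  have int: "integrable lborel ?f"
    using i0 i1 by auto
  have der: "(exp_ker \<mu> a b has_vector_derivative ?f \<tau>) (at \<tau>)" for \<tau>
  proof -
    have "((\<lambda>\<tau>. exp (\<mu> * \<tau> - a * exp \<tau> - b * exp (- \<tau>))) has_field_derivative ?f \<tau>) (at (of_real \<tau>))"
      by (rule derivative_eq_intros refl | simp)+
         (simp add: exp_ker_def exp_of_real[symmetric] algebra_simps flip: exp_add)
    from has_vector_derivative_real_field[OF this] show ?thesis
      by (simp add: exp_ker_def[abs_def] flip: exp_of_real)
  qed
  have cont: "continuous_on UNIV ?f" 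
    unfolding exp_ker_def by (intro continuous_intros)
  have "(LBINT \<tau>=-\<infinity>..\<infinity>. ?f \<tau>) = 0 - 0"
  proof (rule interval_integral_FTC_integrable)
    show "set_integrable lborel (einterval (-\<infinity>) \<infinity>) ?f"
      using int by (simp add: set_integrable_def)
    show "((exp_ker \<mu> a b \<circ> real_of_ereal) \<longlongrightarrow> 0) (at_right (-\<infinity>))"
      using exp_ker_tendsto_0(2)[of a b \<mu>] assms by (auto simp: at_right_MInf comp_def filterlim_filtermap tendsto_compose_filtermap)
    show "((exp_ker \<mu> a b \<circ> real_of_ereal) \<longlongrightarrow> 0) (at_left \<infinity>)"
      using exp_ker_tendsto_0(1)[of a b \<mu>] assms by (auto simp: at_left_PInf comp_def filterlim_filtermap tendsto_compose_filtermap)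
    show "isCont ?f \<tau>" for \<tau> using cont by (simp add: continuous_on_eq_continuous_at)
  qed (use der in auto)
  then have "(\<integral>\<tau>. ?f \<tau> \<partial>lborel) = 0"
    by (simp add: interval_lebesgue_integral_def set_lebesgue_integral_def)
  then show ?thesis
    using i0 i1 by (simp add: exp_int_def algebra_simps)
qed

lemma exp_int_tendsto_Gamma:
  assumes "Re \<mu> > 0" "X \<longlonglongrightarrow> 0" "\<And>n. X n \<ge> (0::real)"
  shows "(\<lambda>n. exp_int \<mu> 1 (of_real (X n))) \<longlonglongrightarrow> Gamma \<mu>"
proof -
  have "(\<lambda>n. exp_int \<mu> 1 (of_real (X n))) \<longlonglongrightarrow> (\<integral>\<tau>. exp_ker \<mu> 1 0 \<tau> \<partial>lborel)"
    unfolding exp_int_def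
  proof (rule integral_dominated_convergence[where w = "\<lambda>\<tau>. norm (exp_ker \<mu> 1 0 \<tau>)"])
    show "integrable lborel (\<lambda>\<tau>. norm (exp_ker \<mu> 1 0 \<tau>))"
      using exp_ker_integrable[of 1 0 \<mu>] assms by auto
    show "AE \<tau> in lborel. (\<lambda>n. exp_ker \<mu> 1 (of_real (X n)) \<tau>) \<longlonglongrightarrow> exp_ker \<mu> 1 0 \<tau>"
    proof (rule AE_I2)
      fix \<tau>
      have "(\<lambda>n. exp_ker \<mu> 1 (of_real (X n)) \<tau>) \<longlonglongrightarrow> exp_ker \<mu> 1 (of_real 0) \<tau>"
        unfolding exp_ker_def by (intro tendsto_intros assms)
      then show "(\<lambda>n. exp_ker \<mu> 1 (of_real (X n)) \<tau>) \<longlonglongrightarrow> exp_ker \<mu> 1 0 \<tau>" by simp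
    qed
    show "AE \<tau> in lborel. norm (exp_ker \<mu> 1 (of_real (X n)) \<tau>) \<le> norm (exp_ker \<mu> 1 0 \<tau>)" for n
      using assms(3)[of n] by (simp add: norm_exp_ker)
  qed simp_all
  then show ?thesis using Gamma_exp_integral[OF assms(1)] by (simp add: has_bochner_integral_iff)
qed

lemma exp_int_holomorphic_order:
  assumes "Re a > 0" "Re b > 0"
  shows "(\<lambda>\<mu>. exp_int \<mu> a b) holomorphic_on UNIV"
proof -
  have "((\<lambda>\<mu>. exp_int \<mu> a b) has_field_derivative (\<integral>\<tau>. of_real \<tau> * exp_ker \<mu> a b \<tau> \<partial>lborel)) (at \<mu>)" for \<mu>
    unfolding exp_int_def
  proof (rule has_field_derivative_integral[where r = 1 and f' = "\<lambda>\<mu> \<tau>. of_real \<tau> * exp_ker \<mu> a b \<tau>"])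
    let ?g = "\<lambda>m \<tau>. exp (m * \<tau> - Re a * exp \<tau> - Re b * exp (- \<tau>))"
    let ?R = "\<bar>Re \<mu>\<bar> + 2"
    show "integrable lborel (\<lambda>\<tau>. ?g ?R \<tau> + ?g (- ?R) \<tau>)"
      by (intro Bochner_Integration.integrable_add exp_real_integrable assms)
    show "norm (of_real \<tau> * exp_ker z a b \<tau>) \<le> ?g ?R \<tau> + ?g (- ?R) \<tau>" if "z \<in> ball \<mu> 1" for z \<tau>
    proof -
      have "\<bar>Re z - Re \<mu>\<bar> \<le> 1" using that abs_Re_le_cmod[of "z - \<mu>"] by (simp add: dist_norm norm_minus_commute)
      then have "\<bar>Re z\<bar> \<le> ?R - 1" by linarith
      have "Re z * \<tau> \<le> \<bar>Re z\<bar> * \<bar>\<tau>\<bar>" by (metis abs_ge_self abs_mult)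
      also have "\<dots> \<le> (?R - 1) * \<bar>\<tau>\<bar>" by (intro mult_right_mono \<open>\<bar>Re z\<bar> \<le> ?R - 1\<close>) auto
      finally have z: "Re z * \<tau> + \<bar>\<tau>\<bar> \<le> ?R * \<bar>\<tau>\<bar>" by (simp add: algebra_simps)
      have "\<bar>\<tau>\<bar> \<le> exp \<bar>\<tau>\<bar>" using exp_ge_add_one_self[of "\<bar>\<tau>\<bar>"] by linarith
      then have "norm (of_real \<tau> * exp_ker z a b \<tau>) \<le> exp \<bar>\<tau>\<bar> * exp (Re z * \<tau> - Re a * exp \<tau> - Re b * exp (- \<tau>))"
        by (simp add: norm_mult norm_exp_ker mult_right_mono)
      also have "\<dots> \<le> exp (?R * \<bar>\<tau>\<bar> - Re a * exp \<tau> - Re b * exp (- \<tau>))"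
        unfolding exp_add[symmetric] using z by simp
      also have "\<dots> \<le> ?g ?R \<tau> + ?g (- ?R) \<tau>"
      proof (cases "\<tau> \<ge> 0")
        case False
        then have "?R * \<bar>\<tau>\<bar> = (- ?R) * \<tau>" by (simp add: algebra_simps)
        then show ?thesis by (simp only:) simp
      qed simp
      finally show ?thesis .
    qed
    show "((\<lambda>\<mu>. exp_ker \<mu> a b \<tau>) has_field_derivative of_real \<tau> * exp_ker z a b \<tau>) (at z)" for z \<tau>
      unfolding exp_ker_def by (rule derivative_eq_intros refl | simp)+
    show "integrable lborel (exp_ker z a b)" for z by (rule exp_ker_integrable) (use assms in auto)
  qed auto
  then show ?thesis using holomorphic_on_open by blast
qed

section \<open>Macdonald's integral\<close>

text \<open>
  The integral of \<open>exp (- z * cosh \<tau> + \<nu> * \<tau>) / 2\<close> over the real line; it equals \<open>K\<^sub>\<nu> z\<close> for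
  \<open>Re z > 0\<close>.
\<close>

definition macdonald :: "complex \<Rightarrow> complex \<Rightarrow> complex" where
  "macdonald \<nu> z = exp_int \<nu> (z / 2) (z / 2) / 2"

lemma macdonald_minus: "macdonald (- \<nu>) z = macdonald \<nu> z"
  by (simp add: macdonald_def exp_int_reflect)

lemma macdonald_recurrence:
  assumes "Re z > 0"
  shows "z * macdonald (\<nu> - 1) z = z * macdonald (\<nu> + 1) z - 2 * \<nu> * macdonald \<nu> z"
  using exp_int_recurrence[of "z / 2" "z / 2" \<nu>] assms by (simp add: macdonald_def field_simps)

lemma macdonald_has_field_derivative:
  assumes z: "Re z > 0"
  shows "(macdonald \<nu> has_field_derivative \<nu> / z * macdonald \<nu> z - macdonald (\<nu> + 1) z) (at z)"
proof -
  define x where "x = Re z / 2"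
  let ?f' = "\<lambda>z \<tau>. - (exp_ker (\<nu> + 1) (z/2) (z/2) \<tau> + exp_ker (\<nu> - 1) (z/2) (z/2) \<tau>) / 2"
  have x: "x > 0" using z by (simp add: x_def)
  have Re_ball: "Re w > x" if "w \<in> ball z x" for w
    using that abs_Re_le_cmod[of "z - w"] by (simp add: dist_norm x_def)
  have "((\<lambda>z. \<integral>\<tau>. exp_ker \<nu> (z/2) (z/2) \<tau> \<partial>lborel) has_field_derivative (\<integral>\<tau>. ?f' z \<tau> \<partial>lborel)) (at z)"
  proof (rule has_field_derivative_integral[where r = x])
    let ?g = "\<lambda>m \<tau>. exp (m * \<tau> - x / 2 * exp \<tau> - x / 2 * exp (- \<tau>))"
    show "integrable lborel (\<lambda>\<tau>. ?g (Re \<nu> + 1) \<tau> + ?g (Re \<nu> - 1) \<tau>)"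
      by (intro Bochner_Integration.integrable_add exp_real_integrable) (use x in auto)
    show "norm (?f' w \<tau>) \<le> ?g (Re \<nu> + 1) \<tau> + ?g (Re \<nu> - 1) \<tau>" if "w \<in> ball z x" for w \<tau>
    proof -
      have le: "norm (exp_ker \<mu> (w/2) (w/2) \<tau>) \<le> ?g (Re \<mu>) \<tau>" for \<mu>
      proof -
        have "x / 2 * exp \<tau> \<le> Re w / 2 * exp \<tau>" "x / 2 * exp (-\<tau>) \<le> Re w / 2 * exp (-\<tau>)"
          using Re_ball[OF that] by (intro mult_right_mono; simp)+
        then have "Re \<mu> * \<tau> - Re w / 2 * exp \<tau> - Re w / 2 * exp (-\<tau>)
          \<le> Re \<mu> * \<tau> - x / 2 * exp \<tau> - x / 2 * exp (-\<tau>)" by linarith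
        then show ?thesis unfolding norm_exp_ker by simp
      qed
      have "norm (?f' w \<tau>) \<le> norm (exp_ker (\<nu> + 1) (w/2) (w/2) \<tau>) + norm (exp_ker (\<nu> - 1) (w/2) (w/2) \<tau>)"
        using norm_triangle_ineq[of "exp_ker (\<nu> + 1) (w/2) (w/2) \<tau>" "exp_ker (\<nu> - 1) (w/2) (w/2) \<tau>"] by (simp add: norm_divide norm_minus_commute del: minus_add_distrib) (smt (verit) norm_ge_zero)
      then show ?thesis using le[of "\<nu> + 1"] le[of "\<nu> - 1"] by simp
    qed
    show "((\<lambda>z. exp_ker \<nu> (z/2) (z/2) \<tau>) has_field_derivative ?f' w \<tau>) (at w)" for w \<tau>
      unfolding exp_ker_shift[symmetric]
      unfolding exp_ker_def by (rule derivative_eq_intros refl | simp)+ (simp add: field_simps, simp flip: exp_of_real)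
    show "integrable lborel (exp_ker \<nu> (w/2) (w/2))" if "w \<in> ball z x" for w
      by (rule exp_ker_integrable) (use Re_ball[OF that] x in auto)
  qed (use x in auto)
  moreover have "(\<integral>\<tau>. ?f' z \<tau> \<partial>lborel) = - (macdonald (\<nu> + 1) z + macdonald (\<nu> - 1) z)"
    using exp_ker_integrable[of "z/2" "z/2" "\<nu> + 1"] exp_ker_integrable[of "z/2" "z/2" "\<nu> - 1"] z
    by (simp add: macdonald_def exp_int_def)
  ultimately have "((\<lambda>z. \<integral>\<tau>. exp_ker \<nu> (z/2) (z/2) \<tau> \<partial>lborel) has_field_derivative - (macdonald (\<nu> + 1) z + macdonald (\<nu> - 1) z)) (at z)"
    by (simp only:)
  from DERIV_cdivide[OF this, of 2]
  have "(macdonald \<nu> has_field_derivative - (macdonald (\<nu> + 1) z + macdonald (\<nu> - 1) z) / 2) (at z)"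
    by (simp add: macdonald_def[abs_def] exp_int_def)
  moreover have "- (macdonald (\<nu> + 1) z + macdonald (\<nu> - 1) z) / 2 = \<nu> / z * macdonald \<nu> z - macdonald (\<nu> + 1) z"
  proof -
    have "z \<noteq> 0" using z by auto
    then have "macdonald (\<nu> - 1) z = macdonald (\<nu> + 1) z - 2 * \<nu> / z * macdonald \<nu> z"
      using macdonald_recurrence[OF z, of \<nu>] by (simp add: field_simps)
    then show ?thesis by (simp add: field_simps)
  qed
  ultimately show ?thesis by (simp only:)
qed

lemma macdonald_exp_bound:
  assumes x: "x > 0"
  obtains C where "C \<ge> 0" "\<And>z. Re z \<ge> x \<Longrightarrow> norm (macdonald \<nu> z) \<le> C * exp (- Re z)"
proof -
  let ?g = "\<lambda>\<tau>. exp (Re \<nu> * \<tau> - x / 2 * exp \<tau> - x / 2 * exp (- \<tau>))"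
  define C where "C = exp x * (\<integral>\<tau>. ?g \<tau> \<partial>lborel)"
  have g: "integrable lborel ?g" by (rule exp_real_integrable) (use x in auto)
  have "norm (macdonald \<nu> z) \<le> C * exp (- Re z)" if z: "Re z \<ge> x" for z
  proof -
    have "norm (exp_int \<nu> (z/2) (z/2)) \<le> (\<integral>\<tau>. norm (exp_ker \<nu> (z/2) (z/2) \<tau>) \<partial>lborel)"
      unfolding exp_int_def by (rule integral_norm_bound)
    also have "\<dots> \<le> (\<integral>\<tau>. exp (x - Re z) * ?g \<tau> \<partial>lborel)"
    proof (rule integral_mono)
      show "integrable lborel (\<lambda>\<tau>. norm (exp_ker \<nu> (z/2) (z/2) \<tau>))"
        by (intro integrable_norm exp_ker_integrable) (use x z in auto)
      show "integrable lborel (\<lambda>\<tau>. exp (x - Re z) * ?g \<tau>)" using g by simp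
      fix \<tau> :: real
      have "exp \<tau> + exp (- \<tau>) \<ge> 2"
        using exp_ge_add_one_self[of \<tau>] exp_ge_add_one_self[of "-\<tau>"] by linarith
      then have "(Re z - x) * 2 \<le> (Re z - x) * (exp \<tau> + exp (- \<tau>))"
        using z by (intro mult_left_mono) auto
      then show "norm (exp_ker \<nu> (z/2) (z/2) \<tau>) \<le> exp (x - Re z) * ?g \<tau>"
        unfolding norm_exp_ker exp_add[symmetric] by (simp add: algebra_simps)
    qed
    also have "\<dots> = C * exp (- Re z)" using g by (simp add: C_def exp_diff exp_minus field_simps)
    finally have "norm (exp_int \<nu> (z/2) (z/2)) \<le> C * exp (- Re z)" .
    moreover have "norm (macdonald \<nu> z) \<le> norm (exp_int \<nu> (z/2) (z/2))"
      by (simp add: macdonald_def norm_divide)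
    ultimately show ?thesis by linarith
  qed
  moreover have "C \<ge> 0" unfolding C_def by (intro mult_nonneg_nonneg integral_nonneg_AE) auto
  ultimately show thesis using that by blast
qed

text \<open>
  After translation by \<open>- ln (z / 2)\<close> the integrand converges to that of Euler's integral as \<open>z\<close> tends
  to 0.
\<close>

lemma macdonald_scaled_limit:
  assumes "Re \<mu> > 0" "X \<longlonglongrightarrow> 0" "\<And>n. X n > (0::real)"
  shows "(\<lambda>n. (of_real (X n) / 2) powr \<mu> * macdonald \<mu> (of_real (X n))) \<longlonglongrightarrow> Gamma \<mu> / 2"
proof -
  have "(of_real (X n) / 2) powr \<mu> * macdonald \<mu> (of_real (X n)) = exp_int \<mu> 1 (of_real ((X n)\<^sup>2 / 4)) / 2" for n
  proof -
    define x where "x = X n / 2"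
    have x: "x > 0" using assms(3)[of n] by (simp add: x_def)
    have "exp_int \<mu> (of_real x) (of_real x) = exp (\<mu> * of_real (- ln x)) *
        exp_int \<mu> (of_real x * of_real (exp (- ln x))) (of_real x * of_real (exp (- (- ln x))))"
      by (rule exp_int_translate)
    also have "of_real x * of_real (exp (- ln x)) = (1::complex)"
      using x by (simp add: exp_minus flip: of_real_mult)
    also have "of_real x * of_real (exp (- (- ln x))) = (of_real (x\<^sup>2) :: complex)"
      using x by (simp add: power2_eq_square)
    also have "exp (\<mu> * of_real (- ln x)) = inverse (of_real x powr \<mu>)"
      using x by (simp add: powr_def Ln_of_real exp_minus)
    finally have "of_real x powr \<mu> * exp_int \<mu> (of_real x) (of_real x) = exp_int \<mu> 1 (of_real (x\<^sup>2))"
      using x by (simp add: field_simps)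
    then show ?thesis by (simp add: macdonald_def x_def power_divide field_simps)
  qed
  moreover have "(\<lambda>n. exp_int \<mu> 1 (of_real ((X n)\<^sup>2 / 4)) / 2) \<longlonglongrightarrow> Gamma \<mu> / 2"
  proof (intro tendsto_divide tendsto_const exp_int_tendsto_Gamma assms)
    have "(\<lambda>n. (X n)\<^sup>2 / 4) \<longlonglongrightarrow> 0\<^sup>2 / 4" by (intro tendsto_intros assms) auto
    then show "(\<lambda>n. (X n)\<^sup>2 / 4) \<longlonglongrightarrow> 0" by simp
  qed auto
  ultimately show ?thesis by (simp only:)
qed

section \<open>Macdonald's integral is the modified Bessel function of the second kind\<close>

lemma bessel_I_clifford: "bessel_I \<nu> z = (z / 2) powr \<nu> * clifford \<nu> (z\<^sup>2 / 4)"
  by (simp add: bessel_I_def clifford_def power_mult power_divide)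

lemma half_powr:
  fixes z :: complex
  assumes "z \<noteq> 0"
  shows "(z / 2) powr \<nu> = (z / 2) powr (\<nu> - 1) * (z / 2)"
    and "(z / 2) powr (\<nu> + 1) = (z / 2) powr (\<nu> - 1) * (z / 2) * (z / 2)"
proof -
  show *: "(z / 2) powr \<nu> = (z / 2) powr (\<nu> - 1) * (z / 2)" for \<nu>
    using assms powr_add[of "z/2" "\<nu> - 1" 1] by simp
  show "(z / 2) powr (\<nu> + 1) = (z / 2) powr (\<nu> - 1) * (z / 2) * (z / 2)"
    using *[of "\<nu> + 1"] *[of \<nu>] by simp
qed

lemma bessel_I_recurrence:
  assumes "z \<noteq> 0"
  shows "bessel_I (\<nu> - 1) z = bessel_I (\<nu> + 1) z + 2 * \<nu> / z * bessel_I \<nu> z"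
proof -
  note p = half_powr[OF assms, of \<nu>]
  have r: "clifford (\<nu> - 1) (z\<^sup>2/4) = \<nu> * clifford \<nu> (z\<^sup>2/4) + z\<^sup>2/4 * clifford (\<nu> + 1) (z\<^sup>2/4)"
    using clifford_recurrence[of "\<nu> - 1" "z\<^sup>2/4"] by (simp add: add.commute)
  show ?thesis unfolding bessel_I_clifford r p
    using assms by (simp add: field_simps power2_eq_square)
qed

lemma bessel_I_has_field_derivative:
  assumes z: "Re z > 0"
  shows "(bessel_I \<nu> has_field_derivative bessel_I (\<nu> + 1) z + \<nu> / z * bessel_I \<nu> z) (at z)"
    and "(bessel_I \<nu> has_field_derivative bessel_I (\<nu> - 1) z - \<nu> / z * bessel_I \<nu> z) (at z)"
proof -
  have nz: "z \<noteq> 0" using z by auto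
  have "z / 2 \<notin> \<real>\<^sub>\<le>\<^sub>0" using z by (auto simp: complex_nonpos_Reals_iff)
  then have "((\<lambda>z. (z / 2) powr \<nu> * clifford \<nu> (z\<^sup>2 / 4)) has_field_derivative
     (\<nu> * (z / 2) powr (\<nu> - 1) / 2) * clifford \<nu> (z\<^sup>2 / 4) + (z / 2) powr \<nu> * (clifford (\<nu> + 1) (z\<^sup>2 / 4) * (z / 2))) (at z)"
    by - (rule derivative_eq_intros refl | simp)+
  also have "(\<nu> * (z / 2) powr (\<nu> - 1) / 2) * clifford \<nu> (z\<^sup>2 / 4) + (z / 2) powr \<nu> * (clifford (\<nu> + 1) (z\<^sup>2 / 4) * (z / 2))
      = bessel_I (\<nu> + 1) z + \<nu> / z * bessel_I \<nu> z"
    unfolding bessel_I_clifford half_powr[OF nz, of \<nu>] using nz by (simp add: field_simps)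
  finally show 1: "(bessel_I \<nu> has_field_derivative bessel_I (\<nu> + 1) z + \<nu> / z * bessel_I \<nu> z) (at z)"
    by (simp add: bessel_I_clifford[abs_def])
  have "bessel_I (\<nu> + 1) z + \<nu> / z * bessel_I \<nu> z = bessel_I (\<nu> - 1) z - \<nu> / z * bessel_I \<nu> z"
    using bessel_I_recurrence[OF nz, of \<nu>] nz by (simp add: field_simps)
  with 1 show "(bessel_I \<nu> has_field_derivative bessel_I (\<nu> - 1) z - \<nu> / z * bessel_I \<nu> z) (at z)"
    by (simp only:)
qed

text \<open>
  Bessel's equation of order \<open>\<nu>\<close> as a first-order system. The pairs \<open>(I\<^sub>\<nu>, I\<^sub>\<nu>\<^sub>+\<^sub>1)\<close>,
  \<open>(I\<^sub>-\<^sub>\<nu>, I\<^sub>-\<^sub>\<nu>\<^sub>-\<^sub>1)\<close> and \<open>(K\<^sub>\<nu>, - K\<^sub>\<nu>\<^sub>+\<^sub>1)\<close> all solve it, and no second derivatives occur.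
\<close>

definition bessel_system :: "complex \<Rightarrow> (complex \<Rightarrow> complex) \<Rightarrow> (complex \<Rightarrow> complex) \<Rightarrow> bool" where
  "bessel_system \<nu> f g \<longleftrightarrow> (\<forall>z. Re z > 0 \<longrightarrow>
     (f has_field_derivative g z + \<nu> / z * f z) (at z) \<and>
     (g has_field_derivative f z - (\<nu> + 1) / z * g z) (at z))"

lemma bessel_system_I: "bessel_system \<nu> (bessel_I \<nu>) (bessel_I (\<nu> + 1))"
  unfolding bessel_system_def
  using bessel_I_has_field_derivative(1)[of _ \<nu>] bessel_I_has_field_derivative(2)[of _ "\<nu> + 1"] by simp

lemma bessel_system_I_minus: "bessel_system \<nu> (bessel_I (- \<nu>)) (bessel_I (- \<nu> - 1))"
  unfolding bessel_system_def
proof (intro allI impI conjI)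
  fix z :: complex assume z: "Re z > 0"
  show "(bessel_I (- \<nu>) has_field_derivative bessel_I (- \<nu> - 1) z + \<nu> / z * bessel_I (- \<nu>) z) (at z)"
    using bessel_I_has_field_derivative(2)[OF z, of "- \<nu>"] by simp
  have "- (\<nu> + 1) / z = (- \<nu> - 1) / z" by simp
  then show "(bessel_I (- \<nu> - 1) has_field_derivative bessel_I (- \<nu>) z - (\<nu> + 1) / z * bessel_I (- \<nu> - 1) z) (at z)"
    using bessel_I_has_field_derivative(1)[OF z, of "- \<nu> - 1"]
    by (simp add: add_divide_distrib diff_divide_distrib algebra_simps)
qed

lemma bessel_system_macdonald: "bessel_system \<nu> (macdonald \<nu>) (\<lambda>z. - macdonald (\<nu> + 1) z)"
  unfolding bessel_system_def
proof (intro allI impI conjI)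
  fix z :: complex assume z: "Re z > 0"
  then have nz: "z \<noteq> 0" by auto
  show "(macdonald \<nu> has_field_derivative - macdonald (\<nu> + 1) z + \<nu> / z * macdonald \<nu> z) (at z)"
    using macdonald_has_field_derivative[OF z, of \<nu>] by simp
  have "- ((\<nu> + 1) / z * macdonald (\<nu> + 1) z - macdonald (\<nu> + 1 + 1) z) = macdonald \<nu> z - (\<nu> + 1) / z * - macdonald (\<nu> + 1) z"
    
  proof -
    have "macdonald (\<nu> + 1 + 1) z = macdonald \<nu> z + 2 * (\<nu> + 1) / z * macdonald (\<nu> + 1) z"
      using macdonald_recurrence[OF z, of "\<nu> + 1"] nz by (simp add: field_simps)
    then show ?thesis by (simp add: algebra_simps add_divide_distrib)
  qed
  then show "((\<lambda>z. - macdonald (\<nu> + 1) z) has_field_derivative macdonald \<nu> z - (\<nu> + 1) / z * - macdonald (\<nu> + 1) z) (at z)"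
    using DERIV_minus[OF macdonald_has_field_derivative[OF z, of "\<nu> + 1"]] by (simp only:)
qed

lemma bessel_system_combine:
  assumes "bessel_system \<nu> f1 f2" "bessel_system \<nu> g1 g2"
  shows "bessel_system \<nu> (\<lambda>z. f1 z + c * g1 z) (\<lambda>z. f2 z + c * g2 z)"
  unfolding bessel_system_def
proof (intro allI impI conjI)
  fix z :: complex assume z: "Re z > 0"
  show "((\<lambda>z. f1 z + c * g1 z) has_field_derivative f2 z + c * g2 z + \<nu> / z * (f1 z + c * g1 z)) (at z)"
    by (rule derivative_eq_intros refl assms[unfolded bessel_system_def, rule_format, OF z, THEN conjunct1])+
       (simp add: algebra_simps)
  show "((\<lambda>z. f2 z + c * g2 z) has_field_derivative f1 z + c * g1 z - (\<nu> + 1) / z * (f2 z + c * g2 z)) (at z)"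
    by (rule derivative_eq_intros refl assms[unfolded bessel_system_def, rule_format, OF z, THEN conjunct2])+
       (simp add: algebra_simps)
qed

text \<open>
  The behaviour of a solution at the origin in the scaling that is natural for \<open>-1 < Re \<nu> < 0\<close>; a solution
  is determined by \<open>l\<close> and \<open>m\<close>. The limits are taken along \<open>z = 1 / (n + 1)\<close>, which suffices to evaluate
  a constant Wronskian.
\<close>

definition at_origin :: "complex \<Rightarrow> (complex \<Rightarrow> complex) \<Rightarrow> (complex \<Rightarrow> complex) \<Rightarrow> complex \<Rightarrow> complex \<Rightarrow> bool" where
  "at_origin \<nu> f g l m \<longleftrightarrow>
     (\<lambda>n. (of_real (1 / real (Suc n)) / 2) powr (- \<nu>) * f (of_real (1 / real (Suc n)))) \<longlonglongrightarrow> l \<and>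
     (\<lambda>n. (of_real (1 / real (Suc n)) / 2) powr (\<nu> + 1) * g (of_real (1 / real (Suc n)))) \<longlonglongrightarrow> m"

lemma at_origin_combine:
  assumes "at_origin \<nu> f1 f2 l1 l2" "at_origin \<nu> g1 g2 m1 m2"
  shows "at_origin \<nu> (\<lambda>z. f1 z + c * g1 z) (\<lambda>z. f2 z + c * g2 z) (l1 + c * m1) (l2 + c * m2)"
proof -
  have "(\<lambda>n. (of_real (1 / real (Suc n)) / 2) powr a * f (of_real (1 / real (Suc n)))
        + c * ((of_real (1 / real (Suc n)) / 2) powr a * g (of_real (1 / real (Suc n))))) \<longlonglongrightarrow> l + c * m"
    if "(\<lambda>n. (of_real (1 / real (Suc n)) / 2) powr a * f (of_real (1 / real (Suc n)))) \<longlonglongrightarrow> l"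
       "(\<lambda>n. (of_real (1 / real (Suc n)) / 2) powr a * g (of_real (1 / real (Suc n)))) \<longlonglongrightarrow> m"
    for f g :: "complex \<Rightarrow> complex" and a l m
    by (intro tendsto_add tendsto_mult that tendsto_const)
  then show ?thesis using assms unfolding at_origin_def
    by (simp add: ring_distribs mult.left_commute)
qed

text \<open>
  The left-hand side has derivative 0 on the half-plane, and the two scaling exponents at the origin add up to
  1, so its value can be read off from the limits.
\<close>

lemma wronskian_value:
  assumes f: "bessel_system \<nu> f1 f2" and g: "bessel_system \<nu> g1 g2"
    and lf: "at_origin \<nu> f1 f2 l1 l2" and lg: "at_origin \<nu> g1 g2 m1 m2"
    and z: "Re z > 0"
  shows "z * (f1 z * g2 z - f2 z * g1 z) = 2 * (l1 * m2 - l2 * m1)"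
proof -
  define U where "U z = z * (f1 z * g2 z - f2 z * g1 z)" for z
  let ?H = "{z. Re z > 0}"
  have "\<exists>c. \<forall>z\<in>?H. U z = c"
  proof (rule has_field_derivative_zero_constant)
    show "convex ?H" by (rule convex_halfspace_Re_gt)
    fix z assume "z \<in> ?H"
    then have z: "Re z > 0" "z \<noteq> 0" by auto
    note D = f[unfolded bessel_system_def, rule_format, OF z(1)] g[unfolded bessel_system_def, rule_format, OF z(1)]
    have "(U has_field_derivative 0) (at z)"
      unfolding U_def by (rule derivative_eq_intros refl D[THEN conjunct1] D[THEN conjunct2])+
        (use z in \<open>simp add: field_simps\<close>)
    then show "(U has_field_derivative 0) (at z within ?H)" by (rule has_field_derivative_at_within)
  qed
  then obtain c where c: "\<And>z. Re z > 0 \<Longrightarrow> U z = c" by auto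
  let ?x = "\<lambda>n. of_real (1 / real (Suc n)) :: complex"
  let ?a = "\<lambda>f n. (?x n / 2) powr (- \<nu>) * f (?x n)" and ?b = "\<lambda>f n. (?x n / 2) powr (\<nu> + 1) * f (?x n)"
  have "(\<lambda>n. 2 * (?a f1 n * ?b g2 n - ?b f2 n * ?a g1 n)) \<longlonglongrightarrow> 2 * (l1 * m2 - l2 * m1)"
    using lf lg unfolding at_origin_def by (intro tendsto_intros) auto
  moreover have "2 * (?a f1 n * ?b g2 n - ?b f2 n * ?a g1 n) = c" for n
  proof -
    have "?x n / 2 \<noteq> 0" by (simp del: of_nat_Suc)
    then have p: "(?x n / 2) powr (- \<nu>) * (?x n / 2) powr (\<nu> + 1) = ?x n / 2"
      by (subst powr_add[symmetric]) simp
    have "2 * (?a f1 n * ?b g2 n - ?b f2 n * ?a g1 n)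
       = 2 * ((?x n / 2) powr (- \<nu>) * (?x n / 2) powr (\<nu> + 1)) * (f1 (?x n) * g2 (?x n) - f2 (?x n) * g1 (?x n))"
      by (simp add: algebra_simps)
    also have "\<dots> = U (?x n)"
    proof -
      have "2 * (X / 2) * W = X * W" for X W :: complex by simp
      then show ?thesis unfolding p U_def .
    qed
    also have "\<dots> = c" by (rule c) (simp del: of_nat_Suc)
    finally show ?thesis .
  qed
  ultimately have "(\<lambda>n. c) \<longlonglongrightarrow> 2 * (l1 * m2 - l2 * m1)" by (simp only:)
  then have "c = 2 * (l1 * m2 - l2 * m1)" by (simp add: LIMSEQ_const_iff)
  with c[OF z] show ?thesis by (simp add: U_def)
qed

lemma clifford_origin:
  "(\<lambda>n. clifford \<nu> ((of_real (1 / real (Suc n)))\<^sup>2 / 4)) \<longlonglongrightarrow> rGamma (\<nu> + 1)"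
proof -
  have "continuous_on UNIV (\<lambda>x::real. clifford \<nu> ((of_real x)\<^sup>2 / 4))" by (intro continuous_intros) auto
  then have "isCont (\<lambda>x::real. clifford \<nu> ((of_real x)\<^sup>2 / 4)) 0" by (simp add: continuous_on_eq_continuous_at)
  from isCont_tendsto_compose[OF this lim_1_over_n[THEN LIMSEQ_Suc]] show ?thesis by (simp add: clifford_0)
qed

lemma powr_origin:
  assumes "Re a > 0"
  shows "(\<lambda>n. (of_real (1 / real (Suc n)) / 2 :: complex) powr a) \<longlonglongrightarrow> 0"
proof -
  have "(\<lambda>n. (1 / real (Suc n) / 2) powr Re a) \<longlonglongrightarrow> 0"
    using assms by real_asymp
  then show ?thesis
  proof (rule Lim_null_comparison[rotated], intro always_eventually allI)
    fix n
    have "(of_real (1 / real (Suc n)) / 2 :: complex) = of_real (1 / real (Suc n) / 2)"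
      by (simp only: of_real_divide of_real_numeral)
    moreover have "norm (of_real (1 / real (Suc n) / 2) powr a :: complex) = (1 / real (Suc n) / 2) powr Re a"
      by (subst norm_powr_real_powr) (simp_all del: of_nat_Suc of_real_divide)
    ultimately show "norm ((of_real (1 / real (Suc n)) / 2 :: complex) powr a) \<le> (1 / real (Suc n) / 2) powr Re a"
      by (simp only: order_refl)
  qed
qed

lemma at_origin_I:
  assumes "- 1 < Re \<nu>" "Re \<nu> < 0"
  shows "at_origin \<nu> (bessel_I \<nu>) (bessel_I (\<nu> + 1)) (rGamma (\<nu> + 1)) 0"
    and "at_origin \<nu> (bessel_I (- \<nu>)) (bessel_I (- \<nu> - 1)) 0 (rGamma (- \<nu>))"
proof -
  let ?x = "\<lambda>n. of_real (1 / real (Suc n)) :: complex"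
  have prod: "(?x n / 2) powr a * bessel_I b (?x n) = (?x n / 2) powr (a + b) * clifford b ((?x n)\<^sup>2 / 4)" for a b n
    by (simp add: bessel_I_clifford powr_add)
  have z: "(\<lambda>n. (?x n / 2) powr a * clifford b ((?x n)\<^sup>2 / 4)) \<longlonglongrightarrow> 0" if "Re a > 0" for a b
    using tendsto_mult[OF powr_origin[OF that] clifford_origin[of b]] by simp
  have nz: "?x n / 2 \<noteq> 0" for n by (simp del: of_nat_Suc)
  have c: "(\<lambda>n. (?x n / 2) powr 0 * clifford b ((?x n)\<^sup>2 / 4)) \<longlonglongrightarrow> rGamma (b + 1)" for b
    using clifford_origin[of b] nz by (simp del: of_nat_Suc of_real_divide)
  show "at_origin \<nu> (bessel_I \<nu>) (bessel_I (\<nu> + 1)) (rGamma (\<nu> + 1)) 0"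
    unfolding at_origin_def prod using c[of \<nu>] z[of "\<nu> + 1 + (\<nu> + 1)" "\<nu> + 1"] assms by (simp del: of_nat_Suc of_real_divide)
  show "at_origin \<nu> (bessel_I (- \<nu>)) (bessel_I (- \<nu> - 1)) 0 (rGamma (- \<nu>))"
    unfolding at_origin_def prod using c[of "- \<nu> - 1"] z[of "- \<nu> + - \<nu>" "- \<nu>"] assms by (simp del: of_nat_Suc of_real_divide)
qed

lemma at_origin_macdonald:
  assumes "- 1 < Re \<nu>" "Re \<nu> < 0"
  shows "at_origin \<nu> (macdonald \<nu>) (\<lambda>z. - macdonald (\<nu> + 1) z) (Gamma (- \<nu>) / 2) (- (Gamma (\<nu> + 1) / 2))"
proof -
  have X: "(\<lambda>n. 1 / real (Suc n)) \<longlonglongrightarrow> 0" by (rule lim_1_over_n[THEN LIMSEQ_Suc])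
  show ?thesis unfolding at_origin_def mult_minus_right
    using macdonald_scaled_limit[OF _ X, of "- \<nu>"] tendsto_minus[OF macdonald_scaled_limit[OF _ X, of "\<nu> + 1"]] assms
    unfolding macdonald_minus by simp
qed

text \<open>
  The difference \<open>?D1\<close> of the two sides, with companion \<open>?D2\<close>, solves the system and vanishes at the origin:
  the Gamma factors cancel by the reflection formula. Its Wronskians with the independent solutions
  \<open>I\<^sub>\<nu>\<close> and \<open>I\<^sub>-\<^sub>\<nu>\<close> are therefore 0, which forces it to be 0.
\<close>

lemma macdonald_eq_quot_strip:
  assumes \<nu>: "- 1 < Re \<nu>" "Re \<nu> < 0" and z: "Re z > 0"
  shows "macdonald \<nu> z = bessel_K_quot \<nu> z"
proof -
  define c where "c = of_real pi / 2 / sin (\<nu> * of_real pi)"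
  let ?D1 = "\<lambda>z. (macdonald \<nu> z + (- c) * bessel_I (- \<nu>) z) + c * bessel_I \<nu> z"
  let ?D2 = "\<lambda>z. (- macdonald (\<nu> + 1) z + (- c) * bessel_I (- \<nu> - 1) z) + c * bessel_I (\<nu> + 1) z"
  have np: "\<nu> + 1 \<notin> \<int>\<^sub>\<le>\<^sub>0" "- \<nu> \<notin> \<int>\<^sub>\<le>\<^sub>0" 
  proof -
    have "x \<notin> \<int>\<^sub>\<le>\<^sub>0" if "Re x > 0" for x :: complex using that by (auto elim!: nonpos_Ints_cases')
    then show "\<nu> + 1 \<notin> \<int>\<^sub>\<le>\<^sub>0" "- \<nu> \<notin> \<int>\<^sub>\<le>\<^sub>0" using \<nu> by simp_all
  qed
  have "Gamma (- \<nu>) * Gamma (1 - (- \<nu>)) = of_real pi / sin (of_real pi * (- \<nu>))"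
    by (rule Gamma_reflection_complex)
  then have G: "Gamma (- \<nu>) * Gamma (\<nu> + 1) = - 2 * c"
    by (simp add: c_def add.commute mult.commute)
  then have cG: "c = - (Gamma (- \<nu>) * Gamma (\<nu> + 1)) / 2" by simp
  have rG: "rGamma (\<nu> + 1) * Gamma (\<nu> + 1) = 1" "rGamma (- \<nu>) * Gamma (- \<nu>) = 1"
    using np by (simp_all add: rGamma_inverse_Gamma Gamma_eq_zero_iff)
  have l1: "(Gamma (- \<nu>) / 2 + (- c) * 0) + c * rGamma (\<nu> + 1) = 0"
  proof -
    have "c * rGamma (\<nu> + 1) = - (Gamma (- \<nu>) * (rGamma (\<nu> + 1) * Gamma (\<nu> + 1))) / 2"
      by (subst cG) (simp add: mult_ac)
    then show ?thesis unfolding rG by simp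
  qed
  have l2: "(- (Gamma (\<nu> + 1) / 2) + (- c) * rGamma (- \<nu>)) + c * 0 = 0"
  proof -
    have "c * rGamma (- \<nu>) = - (Gamma (\<nu> + 1) * (rGamma (- \<nu>) * Gamma (- \<nu>))) / 2"
      by (subst cG) (simp add: mult_ac)
    then show ?thesis unfolding rG by simp
  qed
  have DS: "bessel_system \<nu> ?D1 ?D2"
    by (intro bessel_system_combine bessel_system_macdonald bessel_system_I bessel_system_I_minus)
  have DO: "at_origin \<nu> ?D1 ?D2 0 0"
    using at_origin_combine[OF at_origin_combine[OF at_origin_macdonald[OF \<nu>] at_origin_I(2)[OF \<nu>], of "- c"] at_origin_I(1)[OF \<nu>], of c]
    unfolding l1 l2 .
  have nz: "z \<noteq> 0" using z by auto
  have 1: "?D1 z * bessel_I (\<nu> + 1) z = ?D2 z * bessel_I \<nu> z"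
    using wronskian_value[OF DS bessel_system_I DO at_origin_I(1)[OF \<nu>] z] nz by simp
  have 2: "?D1 z * bessel_I (- \<nu> - 1) z = ?D2 z * bessel_I (- \<nu>) z"
    using wronskian_value[OF DS bessel_system_I_minus DO at_origin_I(2)[OF \<nu>] z] nz by simp
  have "z * (bessel_I \<nu> z * bessel_I (- \<nu> - 1) z - bessel_I (\<nu> + 1) z * bessel_I (- \<nu>) z)
     = 2 * (rGamma (\<nu> + 1) * rGamma (- \<nu>) - 0 * 0)"
    by (rule wronskian_value[OF bessel_system_I bessel_system_I_minus at_origin_I[OF \<nu>] z])
  then have 3: "bessel_I \<nu> z * bessel_I (- \<nu> - 1) z - bessel_I (\<nu> + 1) z * bessel_I (- \<nu>) z \<noteq> 0"
    using rG by auto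
  have "?D1 z * (bessel_I \<nu> z * bessel_I (- \<nu> - 1) z - bessel_I (\<nu> + 1) z * bessel_I (- \<nu>) z)
     = bessel_I \<nu> z * (?D1 z * bessel_I (- \<nu> - 1) z) - (?D1 z * bessel_I (\<nu> + 1) z) * bessel_I (- \<nu>) z"
    by (simp only: right_diff_distrib mult_ac)
  also have "\<dots> = 0" unfolding 1 2 by (simp only: mult_ac diff_self)
  finally have "?D1 z = 0" using 3 by (simp only: mult_eq_0_iff) auto
  then have "macdonald \<nu> z = c * (bessel_I (- \<nu>) z - bessel_I \<nu> z)" by (simp add: algebra_simps)
  then show ?thesis by (simp add: bessel_K_quot_def c_def)
qed

lemma bessel_I_holomorphic_order:
  assumes "z \<noteq> 0"
  shows "(\<lambda>\<nu>. bessel_I \<nu> z) holomorphic_on A"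
proof -
  have "(\<lambda>\<nu>. clifford \<nu> (z\<^sup>2 / 4)) holomorphic_on A"
    using clifford_holomorphic_order holomorphic_on_subset by blast
  then show ?thesis unfolding bessel_I_clifford
    by (intro holomorphic_intros) (use assms in auto)
qed

lemma sin_pi_eq_0_iff: "sin (\<mu> * of_real pi :: complex) = 0 \<longleftrightarrow> \<mu> \<in> \<int>"
proof
  assume "sin (\<mu> * of_real pi) = 0"
  then obtain n :: int where "\<mu> * of_real pi = of_real (n * pi)" by (auto simp: sin_eq_0)
  then have "\<mu> = of_int n" by simp
  then show "\<mu> \<in> \<int>" by simp
next
  assume "\<mu> \<in> \<int>"
  then show "sin (\<mu> * of_real pi) = 0" by (auto elim!: Ints_cases simp: sin_eq_0)
qed

lemma macdonald_eq_quot: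
  assumes \<nu>: "\<nu> \<notin> \<int>" and z: "Re z > 0"
  shows "bessel_K_quot \<nu> z = macdonald \<nu> z"
proof (rule analytic_continuation_open[where s = "{\<nu>. - 1 < Re \<nu> \<and> Re \<nu> < 0}" and s' = "UNIV - \<int>"
          and f = "\<lambda>\<nu>. bessel_K_quot \<nu> z" and g = "\<lambda>\<nu>. macdonald \<nu> z"])
  have nz: "z \<noteq> 0" using z by auto
  show "open {\<nu>. - 1 < Re \<nu> \<and> Re \<nu> < 0}"
    by (intro open_Collect_conj open_Collect_less continuous_intros)
  show "open (UNIV - \<int> :: complex set)" by (intro open_Diff open_UNIV closed_Ints)
  show "{\<nu>. - 1 < Re \<nu> \<and> Re \<nu> < 0} \<noteq> {}" by (auto intro!: exI[of _ "- 1 / 2"])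
  show "connected (UNIV - \<int> :: complex set)"
    by (intro connected_open_diff_countable) (auto simp: countable_int)
  show "{\<nu>. - 1 < Re \<nu> \<and> Re \<nu> < 0} \<subseteq> UNIV - \<int>"
    by (auto elim!: Ints_cases)
  show "(\<lambda>\<nu>. bessel_K_quot \<nu> z) holomorphic_on UNIV - \<int>"
  proof -
    have "(\<lambda>\<nu>. bessel_I (- \<nu>) z) holomorphic_on (UNIV - \<int>)"
      by (rule holomorphic_on_compose_gen[of uminus "UNIV - \<int>" "\<lambda>\<nu>. bessel_I \<nu> z" UNIV, unfolded o_def])
         (auto intro: holomorphic_on_minus bessel_I_holomorphic_order[OF nz] holomorphic_on_ident)
    then show ?thesis unfolding bessel_K_quot_def
      by (intro holomorphic_intros bessel_I_holomorphic_order nz) (auto simp: sin_pi_eq_0_iff)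
  qed
  show "(\<lambda>\<nu>. macdonald \<nu> z) holomorphic_on UNIV - \<int>"
    unfolding macdonald_def
    by (intro holomorphic_intros holomorphic_on_subset[OF exp_int_holomorphic_order]) (use z in auto)
  show "bessel_K_quot \<mu> z = macdonald \<mu> z" if "\<mu> \<in> {\<nu>. - 1 < Re \<nu> \<and> Re \<nu> < 0}" for \<mu>
    using macdonald_eq_quot_strip[OF _ _ z, of \<mu>] that by auto
qed (use \<nu> in auto)

text \<open>
  Macdonald's integral is entire in the order, so the limit that defines \<open>bessel_K\<close> at an integer is its value
  there.
\<close>

theorem bessel_K_eq_macdonald:
  assumes z: "Re z > 0"
  shows "bessel_K \<nu> z = macdonald \<nu> z"
proof (cases "\<nu> \<in> \<int>")
  case False
  then show ?thesis using macdonald_eq_quot[OF _ z] by (simp add: bessel_K_def)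
next
  case True
  have "(\<lambda>\<mu>. macdonald \<mu> z) holomorphic_on UNIV"
    unfolding macdonald_def by (intro holomorphic_intros exp_int_holomorphic_order) (use z in auto)
  then have "continuous_on UNIV (\<lambda>\<mu>. macdonald \<mu> z)" by (rule holomorphic_on_imp_continuous_on)
  then have "((\<lambda>\<mu>. macdonald \<mu> z) \<longlongrightarrow> macdonald \<nu> z) (at \<nu>)"
    by (simp add: continuous_on_def)
  moreover have "\<forall>\<^sub>F \<mu> in at \<nu>. macdonald \<mu> z = bessel_K_quot \<mu> z"
    unfolding eventually_at
  proof (intro exI[of _ 1] conjI ballI impI)
    fix \<mu> assume \<mu>: "\<mu> \<noteq> \<nu> \<and> dist \<mu> \<nu> < 1"
    have "\<mu> \<notin> \<int>"
    proof
      assume "\<mu> \<in> \<int>"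
      then obtain m n :: int where "\<mu> = of_int m" "\<nu> = of_int n" using True by (auto elim!: Ints_cases)
      then have "dist \<mu> \<nu> = real_of_int \<bar>m - n\<bar>"
        by (simp add: dist_norm) (metis norm_of_int of_int_diff)
      then show False using \<mu> \<open>\<mu> = of_int m\<close> \<open>\<nu> = of_int n\<close> by auto
    qed
    then show "macdonald \<mu> z = bessel_K_quot \<mu> z" using macdonald_eq_quot[OF _ z] by simp
  qed simp
  ultimately have "((\<lambda>\<mu>. bessel_K_quot \<mu> z) \<longlongrightarrow> macdonald \<nu> z) (at \<nu>)"
    by (rule Lim_transform_eventually)
  then have "Lim (at \<nu>) (\<lambda>\<mu>. bessel_K_quot \<mu> z) = macdonald \<nu> z"
    by (intro tendsto_Lim) auto
  then show ?thesis using True by (simp add: bessel_K_def)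
qed

section \<open>The inversion formula of the theta function\<close>

definition circle_char :: "int \<Rightarrow> real \<Rightarrow> complex" where
  "circle_char m x = cis (2 * pi * of_int m * x)"

lemma circle_char_add: "circle_char (m + n) x = circle_char m x * circle_char n x"
  by (simp add: circle_char_def cis_mult algebra_simps)

lemma circle_char_0 [simp]: "circle_char 0 x = 1" by (simp add: circle_char_def)

lemma norm_circle_char [simp]: "norm (circle_char m x) = 1" by (simp add: circle_char_def)

lemma circle_char_continuous [continuous_intros]:
  assumes "continuous_on A f"
  shows "continuous_on A (\<lambda>x. circle_char m (f x))"
  unfolding circle_char_def by (intro continuous_intros assms)

lemma integral_circle_char: "integral {0..1} (circle_char m) = (if m = 0 then 1 else 0)"
proof (cases "m = 0")
  case True
  then have "circle_char m = (\<lambda>x. 1)" by auto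
  then show ?thesis using True by simp
next
  case False
  define c :: complex where "c = \<i> * of_real (2 * pi * of_int m)"
  have c: "c \<noteq> 0" using False by (simp add: c_def)
  have ece: "circle_char m x = exp (c * of_real x)" for x
    by (simp add: circle_char_def c_def cis_conv_exp algebra_simps)
  have "((\<lambda>x. exp (c * of_real x)) has_integral exp (c * of_real 1) / c - exp (c * of_real 0) / c) {0..1}"
  proof (rule fundamental_theorem_of_calculus)
    fix x :: real
    have "((\<lambda>z. exp (c * z) / c) has_field_derivative exp (c * of_real x)) (at (of_real x))"
      using c by (auto intro!: derivative_eq_intros)
    then have "((\<lambda>x. exp (c * of_real x) / c) has_vector_derivative exp (c * of_real x)) (at x)"
      by (rule has_vector_derivative_real_field)
    then show "((\<lambda>x. exp (c * of_real x) / c) has_vector_derivative exp (c * of_real x)) (at x within {0..1})"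
      by (rule has_vector_derivative_at_within)
  qed simp
  moreover have "exp (c * of_real 1) = 1"
    unfolding ece[symmetric] by (simp add: circle_char_def)
  ultimately have "(circle_char m has_integral 0) {0..1}"
    unfolding ece[abs_def] by simp
  then show ?thesis using False by (simp add: integral_unique)
qed

text \<open>
  The functions \<open>h\<close> for which \<open>D * h\<close> has only zero Fourier coefficients are stable under multiplication by
  \<open>g (circle_char 1 x)\<close> for polynomials \<open>g\<close>. Quantifying over \<open>h\<close> is what makes the induction pass through
  products.
\<close>

lemma orthogonal_to_polynomials:
  fixes D :: "real \<Rightarrow> real"
  assumes D: "continuous_on {0..1} D"
    and g: "real_polynomial_function (g :: complex \<Rightarrow> real)"
    and h: "continuous_on {0..1} h" "\<And>m. integral {0..1} (\<lambda>x. of_real (D x) * h x * circle_char m x) = 0"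
  shows "integral {0..1} (\<lambda>x. of_real (D x) * (h x * of_real (g (circle_char 1 x))) * circle_char m x) = 0"
  using g h
proof (induction g arbitrary: h m rule: real_polynomial_function.induct)
  case (linear f)
  interpret f: bounded_linear f by fact
  define A B :: complex where "A = (of_real (f 1) - \<i> * of_real (f \<i>)) / 2" and "B = (of_real (f 1) + \<i> * of_real (f \<i>)) / 2"
  have fe: "of_real (f (circle_char 1 x)) = A * circle_char 1 x + B * circle_char (- 1) x" for x
  proof -
    have "circle_char 1 x = Re (circle_char 1 x) *\<^sub>R 1 + Im (circle_char 1 x) *\<^sub>R \<i>"
      by (simp add: complex_eq_iff)
    then have "f (circle_char 1 x) = Re (circle_char 1 x) * f 1 + Im (circle_char 1 x) * f \<i>"
      by (metis f.add f.scaleR real_scaleR_def)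
    then show ?thesis by (simp add: A_def B_def circle_char_def complex_eq_iff field_simps)
  qed
  have i: "(\<lambda>x. of_real (D x) * h x * circle_char n x) integrable_on {0..1}" for n
    by (intro integrable_continuous_real continuous_intros D linear)
  have e: "(\<lambda>x. of_real (D x) * (h x * of_real (f (circle_char 1 x))) * circle_char m x)
     = (\<lambda>x. A * (of_real (D x) * h x * circle_char (1 + m) x) + B * (of_real (D x) * h x * circle_char (- 1 + m) x))"
    unfolding fe circle_char_add by (intro ext) (simp add: algebra_simps)
  have "integral {0..1} (\<lambda>x. of_real (D x) * (h x * of_real (f (circle_char 1 x))) * circle_char m x) = A * integral {0..1} (\<lambda>x. of_real (D x) * h x * circle_char (1 + m) x)
     + B * integral {0..1} (\<lambda>x. of_real (D x) * h x * circle_char (- 1 + m) x)"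
    unfolding e using i by (subst Henstock_Kurzweil_Integration.integral_add) (auto intro!: integrable_on_mult_right)
  then show ?case using linear by simp
next
  case (const c)
  have "(\<lambda>x. of_real (D x) * (h x * of_real c) * circle_char m x) = (\<lambda>x. of_real c * (of_real (D x) * h x * circle_char m x))"
    by (intro ext) (simp add: algebra_simps)
  then show ?case using const by simp
next
  case (add g1 g2)
  have c: "continuous_on {0..1} (\<lambda>x. of_real (g (circle_char 1 x)) :: complex)" if "real_polynomial_function g" for g
  proof -
    have "continuous_on UNIV g"
      using that continuous_on_polymonial_function real_polynomial_function_eq by blast
    then show ?thesis
      by (rule continuous_on_of_real[OF continuous_on_compose2]) (auto intro!: continuous_intros)
  qed
  have i: "(\<lambda>x. of_real (D x) * (h x * of_real (g (circle_char 1 x))) * circle_char m x) integrable_on {0..1}"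
    if "real_polynomial_function g" for g
    by (intro integrable_continuous_real continuous_intros D add c that)
  have "(\<lambda>x. of_real (D x) * (h x * of_real (g1 (circle_char 1 x) + g2 (circle_char 1 x))) * circle_char m x)
     = (\<lambda>x. of_real (D x) * (h x * of_real (g1 (circle_char 1 x))) * circle_char m x + of_real (D x) * (h x * of_real (g2 (circle_char 1 x))) * circle_char m x)"
    by (intro ext) (simp add: algebra_simps)
  then show ?case
    using add i by (simp add: Henstock_Kurzweil_Integration.integral_add)
next
  case (mult g1 g2)
  have c: "continuous_on {0..1} (\<lambda>x. of_real (g1 (circle_char 1 x)) :: complex)"
  proof -
    have "continuous_on UNIV g1"
      using mult continuous_on_polymonial_function real_polynomial_function_eq by blast
    then show ?thesis
      by (rule continuous_on_of_real[OF continuous_on_compose2]) (auto intro!: continuous_intros)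
  qed
  have "integral {0..1} (\<lambda>x. of_real (D x) * ((h x * of_real (g1 (circle_char 1 x))) * of_real (g2 (circle_char 1 x))) * circle_char m x) = 0"
    by (rule mult.IH(2)) (intro continuous_intros mult c, rule mult.IH(1), (rule mult)+)
  then show ?case by (simp add: mult.assoc)
qed

lemma periodic_of_int:
  fixes D :: "real \<Rightarrow> 'a"
  assumes "\<And>x. D (x + 1) = D x"
  shows "D (x + of_int n) = D x"
proof (induction n arbitrary: x rule: int_induct[of _ 0])
  case (step1 i)
  then show ?case using assms[of "x + of_int i"] by (simp add: add.assoc)
next
  case (step2 i)
  then show ?case using assms[of "x + of_int (i - 1)"] by (simp add: add.assoc algebra_simps)
qed simp

text \<open>
  By Stone-Weierstrass on the unit circle, \<open>D\<close> is a uniform limit of polynomials in \<open>circle_char 1\<close>, to which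
  it is orthogonal; hence \<open>D\<close> is orthogonal to itself.
\<close>

lemma fourier_coefficients_zero_imp_zero:
  fixes D :: "real \<Rightarrow> real"
  assumes cont: "continuous_on UNIV D"
    and per: "\<And>x. D (x + 1) = D x"
    and orth: "\<And>m. integral {0..1} (\<lambda>x. of_real (D x) * circle_char m x) = 0"
  shows "D x = 0"
proof -
  \<comment> \<open>\<open>D\<close> as a function on the circle. Near \<open>- 1\<close>, where \<open>Arg\<close> jumps, it is continuous because it can
  also be computed from \<open>Arg (- z)\<close>.\<close>
  define \<phi> where "\<phi> z = D (Arg z / (2 * pi))" for z
  have \<phi>: "\<phi> z = D y" if "z = circle_char 1 y" for z y
  proof -
    have "z \<noteq> 0" using that norm_circle_char[of 1 y] by fastforce
    moreover have "norm z = 1" using that by simp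
    ultimately have "exp (\<i> * of_real (Arg z)) = exp (\<i> * of_real (2 * pi * y))"
      using Arg_eq[of z] that by (simp add: circle_char_def cis_conv_exp)
    then obtain n :: int where "\<i> * of_real (Arg z) = \<i> * of_real (2 * pi * y) + (of_int (2 * n) * pi) * \<i>"
      by (auto simp: exp_eq)
    then have "\<i> * of_real (Arg z) = \<i> * of_real (2 * pi * y + 2 * pi * of_int n)"
      by (simp add: algebra_simps)
    then have "Arg z = 2 * pi * y + 2 * pi * of_int n"
      by (simp only: mult_cancel_left of_real_eq_iff) simp
    then have "Arg z / (2 * pi) = y + of_int n" by (simp add: field_simps)
    then show ?thesis using periodic_of_int[of D y n] per by (simp add: \<phi>_def)
  qed
  have iD: "isCont D y" for y using cont by (simp add: continuous_on_eq_continuous_at)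
  have \<phi>': "\<phi> z = D (Arg (- z) / (2 * pi) + 1 / 2)" if "norm z = 1" for z
  proof (rule \<phi>)
    have "z \<noteq> 0" using that by auto
    then have "- z = exp (\<i> * Arg (- z))" using Arg_eq[of "- z"] that by simp
    moreover have "circle_char 1 (Arg (- z) / (2 * pi) + 1 / 2) = - exp (\<i> * Arg (- z))"
      by (simp add: circle_char_def ring_distribs flip: cis_conv_exp cis_mult)
    ultimately show "z = circle_char 1 (Arg (- z) / (2 * pi) + 1 / 2)" by (metis minus_minus)
  qed
  have c\<phi>: "continuous_on (sphere 0 1) \<phi>"
    unfolding continuous_on_eq_continuous_within
  proof
    fix z :: complex assume z: "z \<in> sphere 0 1"
    show "continuous (at z within sphere 0 1) \<phi>"
    proof (cases "z \<in> \<real>\<^sub>\<le>\<^sub>0")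
      case False
      then have "isCont Arg z" using continuous_at_Arg by blast
      then have "isCont (\<lambda>z. D (Arg z / (2 * pi))) z"
        by (intro isCont_o2[OF _ iD] continuous_intros) auto
      then show ?thesis unfolding \<phi>_def[abs_def] by (rule continuous_at_imp_continuous_at_within)
    next
      case True
      moreover have "z \<noteq> 0" using z by auto
      ultimately have "- z \<notin> \<real>\<^sub>\<le>\<^sub>0" by (auto simp: complex_nonpos_Reals_iff complex_eq_iff)
      then have "isCont Arg (- z)" using continuous_at_Arg by blast
      then have "isCont (\<lambda>z. Arg (- z)) z" by (intro isCont_o2[of z uminus Arg]) auto
      then have "isCont (\<lambda>z. D (Arg (- z) / (2 * pi) + 1 / 2)) z"
        by (intro isCont_o2[OF _ iD] continuous_intros) auto
      then have "continuous (at z within sphere 0 1) (\<lambda>z. D (Arg (- z) / (2 * pi) + 1 / 2))"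
        by (rule continuous_at_imp_continuous_at_within)
      then show ?thesis
        by (rule continuous_transform_within[of _ _ _ 1]) (use z \<phi>' in auto)
    qed
  qed
  have cD: "continuous_on {0..1} D" using cont continuous_on_subset by blast
  have D2: "integral {0..1} (\<lambda>x. D x * D x) \<le> e * integral {0..1} (\<lambda>x. \<bar>D x\<bar>)" if "e > 0" for e
  proof -
    obtain g where g: "real_polynomial_function g" "\<And>z. z \<in> sphere 0 1 \<Longrightarrow> \<bar>\<phi> z - g z\<bar> < e"
      using Stone_Weierstrass_real_polynomial_function[OF compact_sphere c\<phi> \<open>e > 0\<close>] by blast
    have cg: "continuous_on {0..1} (\<lambda>x. g (circle_char 1 x))"
    proof -
      have "continuous_on UNIV g"
        using g(1) continuous_on_polymonial_function real_polynomial_function_eq by blast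
      then show ?thesis
        by (rule continuous_on_compose2) (auto intro!: continuous_intros)
    qed
    have "integral {0..1} (\<lambda>x. of_real (D x) * (1 * of_real (g (circle_char 1 x))) * circle_char 0 x :: complex) = 0"
      by (rule orthogonal_to_polynomials[OF cD g(1)]) (use orth in auto)
    then have "integral {0..1} (\<lambda>x. complex_of_real (D x * g (circle_char 1 x))) = 0" by simp
    then have og: "integral {0..1} (\<lambda>x. D x * g (circle_char 1 x)) = 0"
      using integral_linear[of "\<lambda>x. D x * g (circle_char 1 x)" "{0..1}" complex_of_real] 
        integrable_continuous_real[OF continuous_on_mult[OF cD cg]]
      by (simp add: o_def bounded_linear_of_real)
    have "integral {0..1} (\<lambda>x. D x * D x) = integral {0..1} (\<lambda>x. D x * D x - D x * g (circle_char 1 x))"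
      using og by (subst Henstock_Kurzweil_Integration.integral_diff)
        (auto intro!: integrable_continuous_real continuous_intros cD cg)
    also have "\<dots> \<le> integral {0..1} (\<lambda>x. e * \<bar>D x\<bar>)"
    proof (rule integral_le)
      fix x :: real assume "x \<in> {0..1}"
      have "\<bar>\<phi> (circle_char 1 x) - g (circle_char 1 x)\<bar> < e" by (rule g) simp
      then have "\<bar>D x - g (circle_char 1 x)\<bar> \<le> e" using \<phi>[OF refl, of x] by simp
      then have "\<bar>D x\<bar> * \<bar>D x - g (circle_char 1 x)\<bar> \<le> \<bar>D x\<bar> * e" by (intro mult_left_mono) auto
      then have "\<bar>D x * D x - D x * g (circle_char 1 x)\<bar> \<le> e * \<bar>D x\<bar>"
        by (simp add: right_diff_distrib mult.commute flip: abs_mult)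
      then show "D x * D x - D x * g (circle_char 1 x) \<le> e * \<bar>D x\<bar>" by linarith
    qed (auto intro!: integrable_continuous_real continuous_intros cD cg)
    finally show ?thesis by simp
  qed
  have "integral {0..1} (\<lambda>x. D x * D x) \<le> 0"
  proof (rule field_le_epsilon)
    fix e :: real assume "e > 0"
    define M where "M = integral {0..1} (\<lambda>x. \<bar>D x\<bar>)"
    have M: "M \<ge> 0" unfolding M_def
      by (intro integral_nonneg integrable_continuous_real continuous_intros cD) auto
    have "integral {0..1} (\<lambda>x. D x * D x) \<le> e / (M + 1) * M"
      unfolding M_def[symmetric] using D2[of "e / (M + 1)"] M \<open>e > 0\<close> by (simp add: M_def[symmetric])
    also have "\<dots> \<le> e" using M \<open>e > 0\<close> by (simp add: field_simps)
    finally show "integral {0..1} (\<lambda>x. D x * D x) \<le> 0 + e" by simp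
  qed
  moreover have "integral {0..1} (\<lambda>x. D x * D x) \<ge> 0"
    by (intro integral_nonneg integrable_continuous_real continuous_intros cD) auto
  ultimately have "((\<lambda>x. D x * D x) has_integral 0) (cbox 0 1)"
    using integrable_continuous_real[OF continuous_on_mult[OF cD cD]]
    by (metis antisym cbox_interval integrable_integral)
  then have z: "D y * D y = 0" if "y \<in> {0..1}" for y
    using has_integral_0_cbox_imp_0[of 0 1 "\<lambda>x. D x * D x" y] that cD
    by (auto intro!: continuous_intros)
  have "D x = D (frac x + of_int \<lfloor>x\<rfloor>)" by (simp add: frac_def)
  also have "\<dots> = D (frac x)" by (rule periodic_of_int) (rule per)
  also have "\<dots> = 0" using z[of "frac x"] by (simp add: frac_ge_0 less_imp_le frac_lt_1)
  finally show ?thesis .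
qed

text \<open>
  The characteristic function of the standard normal distribution, rescaled by \<open>sqrt (2 * t)\<close>.
\<close>

lemma gaussian_fourier:
  assumes t: "t > 0"
  shows "integrable lborel (\<lambda>x. of_real (exp (- t * x\<^sup>2)) * circle_char m x)" (is ?int)
    and "(\<integral>x. of_real (exp (- t * x\<^sup>2)) * circle_char m x \<partial>lborel) = of_real (sqrt (pi / t) * exp (- pi\<^sup>2 / t * (of_int m)\<^sup>2))" (is ?val)
proof -
  define s where "s = sqrt (2 * t)"
  define \<xi> where "\<xi> = 2 * pi * of_int m / s"
  have s: "s > 0" "s\<^sup>2 = 2 * t" using t by (auto simp: s_def)
  let ?F = "\<lambda>x. of_real (std_normal_density x) * cis (\<xi> * x)"
  have iF: "integrable lborel ?F"
  proof (rule integrable_norm_cancel)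
    have "integrable lborel std_normal_density" by simp
    moreover have "norm (?F x) = std_normal_density x" for x
      by (simp add: norm_mult normal_density_nonneg)
    ultimately show "integrable lborel (\<lambda>x. norm (?F x))" by simp
    show "?F \<in> borel_measurable lborel"
      by (simp add: std_normal_density_def) (auto intro!: borel_measurable_continuous_onI continuous_intros)
  qed
  have vF: "(\<integral>x. ?F x \<partial>lborel) = of_real (exp (- (\<xi>\<^sup>2) / 2))"
  proof -
    have "of_real (exp (- (\<xi>\<^sup>2) / 2)) = char std_normal_distribution \<xi>"
      by (simp only: char_std_normal_distribution)
    also have "\<dots> = (\<integral>x. std_normal_density x *\<^sub>R iexp (\<xi> * x) \<partial>lborel)"
      unfolding char_def by (subst integral_density) (auto simp: normal_density_nonneg)
    also have "\<dots> = (\<integral>x. ?F x \<partial>lborel)"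
      by (simp add: cis_conv_exp scaleR_conv_of_real)
    finally show ?thesis by simp
  qed
  have e: "?F (0 + s * x) = of_real (1 / sqrt (2 * pi)) * (of_real (exp (- t * x\<^sup>2)) * circle_char m x)" for x
    using s by (simp add: std_normal_density_def power_mult_distrib circle_char_def \<xi>_def mult_ac)
  have "integrable lborel (\<lambda>x. ?F (0 + s * x))"
    by (rule lborel_integrable_real_affine[OF iF]) (use s in auto)
  then have "integrable lborel (\<lambda>x. of_real (sqrt (2 * pi)) * (?F (0 + s * x)))"
    by (rule integrable_mult_right)
  moreover have "of_real (sqrt (2 * pi)) * (of_real (1 / sqrt (2 * pi)) * w) = w" for w :: complex by simp
  ultimately show ?int unfolding e by (simp only:)
  have "of_real (exp (- (\<xi>\<^sup>2) / 2)) = \<bar>s\<bar> *\<^sub>R (\<integral>x. ?F (0 + s * x) \<partial>lborel)"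
    unfolding vF[symmetric] by (rule lborel_integral_real_affine) (use s in auto)
  also have "\<dots> = of_real (s / sqrt (2 * pi)) * (\<integral>x. of_real (exp (- t * x\<^sup>2)) * circle_char m x \<partial>lborel)"
    unfolding e using s by (simp add: scaleR_conv_of_real)
  finally have "(\<integral>x. of_real (exp (- t * x\<^sup>2)) * circle_char m x \<partial>lborel) = of_real (sqrt (2 * pi) / s * exp (- (\<xi>\<^sup>2) / 2))"
    using s by (simp add: field_simps)
  also have "sqrt (2 * pi) / s = sqrt (pi / t)"
    using t by (simp add: s_def real_sqrt_divide[symmetric] real_sqrt_mult)
  also have "- (\<xi>\<^sup>2) / 2 = - pi\<^sup>2 / t * (of_int m)\<^sup>2"
    using s t by (simp add: \<xi>_def power_divide power_mult_distrib field_simps)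
  finally show ?val .
qed

definition theta :: "real \<Rightarrow> real" where
  "theta t = (\<Sum>k. if k = 0 then 1 else 2 * exp (- t * (real k)\<^sup>2))"

lemma exp_square_le: assumes "t > 0" shows "exp (- t * (real k)\<^sup>2) \<le> exp (- t) ^ k"
proof -
  have "real k \<le> (real k)\<^sup>2" by (metis of_nat_le_iff of_nat_power le_square power2_eq_square)
  then have "- t * (real k)\<^sup>2 \<le> real k * (- t)" using assms by (simp add: mult.commute)
  then show ?thesis by (simp flip: exp_of_nat_mult)
qed

lemma summable_exp_power: assumes "t > 0" shows "summable (\<lambda>k. exp (- t :: real) ^ k)"
  by (rule summable_geometric) (use assms in auto)

lemma theta_summable:
  assumes "t > 0" shows "summable (\<lambda>k. if k = 0 then 1 else 2 * exp (- t * (real k)\<^sup>2))"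
proof (rule summable_comparison_test'[where N = 0])
  show "summable (\<lambda>k. 2 * exp (- t :: real) ^ k)"
    by (intro summable_mult summable_exp_power assms)
  show "norm (if n = 0 then 1 else 2 * exp (- t * (real n)\<^sup>2)) \<le> 2 * exp (- t) ^ n" for n
    using exp_square_le[OF assms, of n] by auto
qed

text \<open>
  The two sides are the values at 0 of two continuous functions of period 1: the periodised Gaussian \<open>F\<close> and a
  cosine series \<open>G\<close>. Unfolding the sum over the integers shows that the Fourier coefficients of \<open>F\<close> are
  values of the Fourier transform of the Gaussian, and these are the coefficients of \<open>G\<close>.
\<close>

theorem theta_inversion:
  assumes t: "t > 0"
  shows "theta t = sqrt (pi / t) * theta (pi\<^sup>2 / t)"
proof -
  define h where "h x = exp (- t * x\<^sup>2)" for x :: real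
  define u where "u k x = (if k = 0 then h x else h (x + real k) + h (x - real k))" for k :: nat and x
  define F where "F x = (\<Sum>k. u k x)" for x
  define c where "c = sqrt (pi / t)"
  define q where "q k = exp (- pi\<^sup>2 / t * (real k)\<^sup>2)" for k :: nat
  define v where "v k x = c * (if k = 0 then 1 else 2 * q k * cos (2 * pi * real k * x))" for k :: nat and x
  define G where "G x = (\<Sum>k. v k x)" for x
  have hsum: "h (x + y) \<le> exp (t * R\<^sup>2) * exp (- (t / 2) * y\<^sup>2)" if "\<bar>x\<bar> \<le> R" for x y R
  proof -
    have "y\<^sup>2 / 2 - x\<^sup>2 \<le> (x + y)\<^sup>2"
      using zero_le_power2[of "2 * x + y"] by (simp add: power2_eq_square algebra_simps)
    moreover have "x\<^sup>2 \<le> R\<^sup>2" using power_mono[OF that, of 2] by simp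
    ultimately have "y\<^sup>2 / 2 - R\<^sup>2 \<le> (x + y)\<^sup>2" by linarith
    then have "t * (y\<^sup>2 / 2 - R\<^sup>2) \<le> t * (x + y)\<^sup>2" using t by (intro mult_left_mono) auto
    then show ?thesis by (simp add: h_def algebra_simps flip: exp_add)
  qed
  have u_bound: "norm (u k x) \<le> 2 * exp (t * R\<^sup>2) * exp (- (t / 2)) ^ k" if "\<bar>x\<bar> \<le> R" for k x R
  proof -
    have "exp (- (t / 2) * (real k)\<^sup>2) \<le> exp (- (t / 2)) ^ k"
      by (rule exp_square_le) (use t in simp)
    then have a: "exp (t * R\<^sup>2) * exp (- (t / 2) * (real k)\<^sup>2) \<le> exp (t * R\<^sup>2) * exp (- (t / 2)) ^ k"
      by (intro mult_left_mono) auto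
    have b: "h (x + real k) \<le> exp (t * R\<^sup>2) * exp (- (t / 2) * (real k)\<^sup>2)"
      "h (x - real k) \<le> exp (t * R\<^sup>2) * exp (- (t / 2) * (real k)\<^sup>2)"
      using hsum[OF that, of "real k"] hsum[OF that, of "- real k"] by auto
    have "h y \<ge> 0" for y by (simp add: h_def)
    then have "norm (u k x) \<le> h (x + real k) + h (x - real k)" by (simp add: u_def)
    with a b show ?thesis by linarith
  qed
  \<comment> \<open>By \<open>(x + y)\<^sup>2 \<ge> y\<^sup>2 / 2 - x\<^sup>2\<close> the shifted Gaussians are uniformly small for \<open>x\<close> in a bounded interval.\<close>
  have ulim: "uniform_limit {- R..R} (\<lambda>n x. \<Sum>k<n. u k x) F sequentially" for R
    unfolding F_def
    by (rule Weierstrass_m_test[where M = "\<lambda>k. 2 * exp (t * R\<^sup>2) * exp (- (t / 2)) ^ k"])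
       (use u_bound[of _ R] t in \<open>auto intro!: summable_mult summable_exp_power[of "t / 2", simplified]\<close>)
  have q0: "q k \<ge> 0" for k by (simp add: q_def)
  have qsum: "summable q"
  proof (rule summable_comparison_test'[where N = 0])
    show "summable (\<lambda>k. exp (- (pi\<^sup>2 / t)) ^ k)" by (intro summable_exp_power) (use t in auto)
    show "norm (q n) \<le> exp (- (pi\<^sup>2 / t)) ^ n" for n
      using exp_square_le[of "pi\<^sup>2 / t" n] t by (simp add: q_def)
  qed
  have c0: "c \<ge> 0" using t by (simp add: c_def)
  have v_bound: "norm (v k x) \<le> c * (if k = 0 then 1 else 2 * q k)" for k x
  proof -
    have "\<bar>cos (2 * pi * real k * x)\<bar> * q k \<le> 1 * q k" by (intro mult_right_mono q0) auto
    then show ?thesis using q0[of k] c0 by (auto simp: v_def abs_mult mult.commute intro!: mult_left_mono)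
  qed
  have "summable (\<lambda>k. 2 * q k)" by (intro summable_mult qsum)
  then have "summable (\<lambda>k. if k = 0 then 1 else 2 * q k)"
    by (subst (asm) summable_Suc_iff[symmetric], subst summable_Suc_iff[symmetric]) simp
  then have vsum: "summable (\<lambda>k. c * (if k = 0 then 1 else 2 * q k))" by (rule summable_mult)
  have vlim: "uniform_limit A (\<lambda>n x. \<Sum>k<n. v k x) G sequentially" for A
    unfolding G_def by (rule Weierstrass_m_test[OF v_bound vsum])
  have cu: "continuous_on A (u k)" for A k
    unfolding u_def h_def by (cases "k = 0") (auto intro!: continuous_intros)
  have cv: "continuous_on A (v k)" for A k
    unfolding v_def by (cases "k = 0") (auto intro!: continuous_intros)
  have cF: "continuous_on UNIV F"
  proof -
    have "continuous_on {- R..R} F" for R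
      by (rule uniform_limit_theorem[OF _ ulim]) (auto intro!: always_eventually continuous_intros cu)
    then have "isCont F x" for x
    proof (rule continuous_on_interior[of "{- (\<bar>x\<bar> + 1)..\<bar>x\<bar> + 1}"])
      show "x \<in> interior {- (\<bar>x\<bar> + 1)..\<bar>x\<bar> + 1}" unfolding interior_atLeastAtMost_real by auto
    qed
    then show ?thesis by (simp add: continuous_on_eq_continuous_at)
  qed
  have cG: "continuous_on UNIV G"
    by (rule uniform_limit_theorem[OF _ vlim]) (auto intro!: always_eventually continuous_intros cv)
  have Flim: "(\<lambda>n. \<Sum>k<n. u k x) \<longlonglongrightarrow> F x" for x
    by (rule tendsto_uniform_limitI[OF ulim[of "\<bar>x\<bar>"]]) auto
  have perF: "F (x + 1) = F x" for x
  proof -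
    have tel: "(\<Sum>k<Suc n. u k (x + 1)) - (\<Sum>k<Suc n. u k x) = h (x + real (Suc n)) - h (x - real n)" for n
      by (induction n) (simp_all add: u_def algebra_simps)
    have "(\<lambda>n. h (x + real (Suc n)) - h (x - real n)) \<longlonglongrightarrow> 0"
    proof -
      have "(\<lambda>n. h (x + real (Suc n))) \<longlonglongrightarrow> 0" "(\<lambda>n. h (x - real n)) \<longlonglongrightarrow> 0"
        unfolding h_def using t by real_asymp+
      from tendsto_diff[OF this] show ?thesis by simp
    qed
    moreover have "(\<lambda>n. (\<Sum>k<Suc n. u k (x + 1)) - (\<Sum>k<Suc n. u k x)) \<longlonglongrightarrow> F (x + 1) - F x"
      by (intro tendsto_diff LIMSEQ_Suc Flim)
    ultimately have "F (x + 1) - F x = 0" unfolding tel using LIMSEQ_unique by blast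
    then show ?thesis by simp
  qed
  have perG: "G (x + 1) = G x" for x
  proof -
    have "cos (2 * pi * real k * (x + 1)) = cos (2 * pi * real k * x)" for k
    proof -
      have "2 * pi * real k * (x + 1) = 2 * pi * real k * x + 2 * pi * real k" by (simp add: algebra_simps)
      moreover have "2 * pi * real k = 2 * real k * pi" by simp
      ultimately show ?thesis using cos_2npi[of k] sin_2npi[of k] by (simp only: cos_add)
    qed
    then show ?thesis unfolding G_def v_def by (simp only:)
  qed
  have lim_int: "(\<lambda>n. \<Sum>k<n. integral {0..1} (\<lambda>x. of_real (w k x) * circle_char m x))
       \<longlonglongrightarrow> integral {0..1} (\<lambda>x. of_real (W x) * circle_char m x)"
    if ul: "uniform_limit {- 1..1} (\<lambda>n x. \<Sum>k<n. w k x) W sequentially"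
      and cw: "\<And>k. continuous_on {0..1} (w k)" for w :: "nat \<Rightarrow> real \<Rightarrow> real" and W m
  proof -
    have "uniform_limit {0..1} (\<lambda>n x. of_real (\<Sum>k<n. w k x) * circle_char m x) (\<lambda>x. of_real (W x) * circle_char m x) sequentially"
    proof (rule uniform_limitI)
      fix e :: real assume "e > 0"
      have "\<forall>\<^sub>F n in sequentially. \<forall>x\<in>{-1..1}. dist (\<Sum>k<n. w k x) (W x) < e"
        using uniform_limitD[OF ul \<open>e > 0\<close>] .
      then show "\<forall>\<^sub>F n in sequentially. \<forall>x\<in>{0..1}. dist (of_real (\<Sum>k<n. w k x) * circle_char m x) (of_real (W x) * circle_char m x) < e"
      proof eventually_elim
        case (elim n)
        show ?case
        proof
          fix x :: real assume "x \<in> {0..1}"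
          then have "dist (\<Sum>k<n. w k x) (W x) < e" using elim by auto
          moreover have "dist (of_real (\<Sum>k<n. w k x) * circle_char m x) (of_real (W x) * circle_char m x) = dist (\<Sum>k<n. w k x) (W x)"
            unfolding dist_norm left_diff_distrib[symmetric] of_real_diff[symmetric] norm_mult by (simp only: norm_of_real norm_circle_char real_norm_def mult_1_right)
          ultimately show "dist (of_real (\<Sum>k<n. w k x) * circle_char m x) (of_real (W x) * circle_char m x) < e" by simp
        qed
      qed
    qed
    then obtain I J where IJ: "\<And>n. ((\<lambda>x. of_real (\<Sum>k<n. w k x) * circle_char m x) has_integral I n) {0..1}"
        "((\<lambda>x. of_real (W x) * circle_char m x) has_integral J) {0..1}" "I \<longlonglongrightarrow> J"
      by (rule uniform_limit_integral) (auto intro!: continuous_intros cw)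
    have "I n = (\<Sum>k<n. integral {0..1} (\<lambda>x. of_real (w k x) * circle_char m x))" for n
    proof -
      have "((\<lambda>x. \<Sum>k<n. of_real (w k x) * circle_char m x) has_integral (\<Sum>k<n. integral {0..1} (\<lambda>x. of_real (w k x) * circle_char m x))) {0..1}"
        by (intro has_integral_sum integrable_integral integrable_continuous_real continuous_intros cw) auto
      then show ?thesis using IJ(1)[of n] has_integral_unique by (simp add: sum_distrib_right) blast
    qed
    then have "I = (\<lambda>n. \<Sum>k<n. integral {0..1} (\<lambda>x. of_real (w k x) * circle_char m x))" by blast
    with IJ(3) show ?thesis unfolding integral_unique[OF IJ(2)] by (simp only:)
  qed
  have coefG: "integral {0..1} (\<lambda>x. of_real (G x) * circle_char m x) = of_real (c * q (nat \<bar>m\<bar>))" for m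
  proof -
    have vi: "integral {0..1} (\<lambda>x. of_real (v k x) * circle_char m x) = (if k = nat \<bar>m\<bar> then of_real (c * q (nat \<bar>m\<bar>)) else 0)" for k
    proof (cases "k = 0")
      case True
      then have "integral {0..1} (\<lambda>x. of_real (v k x) * circle_char m x) = of_real c * integral {0..1} (circle_char m)"
        by (simp add: v_def)
      then show ?thesis using True unfolding integral_circle_char by (auto simp: q_def)
    next
      case False
      have "of_real (v k x) * circle_char m x = of_real (c * q k) * (circle_char (int k + m) x + circle_char (- int k + m) x)" for x
      proof -
        have "2 * of_real (cos (2 * pi * real k * x)) = circle_char (int k) x + circle_char (- int k) x"
          by (simp add: circle_char_def complex_eq_iff)
        then have "of_real (v k x) = of_real (c * q k) * (circle_char (int k) x + circle_char (- int k) x)"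
          using False by (simp add: v_def algebra_simps)
        then show ?thesis unfolding circle_char_add by (simp add: algebra_simps)
      qed
      then have "integral {0..1} (\<lambda>x. of_real (v k x) * circle_char m x)
          = of_real (c * q k) * (integral {0..1} (circle_char (int k + m)) + integral {0..1} (circle_char (- int k + m)))"
        by (simp add: Henstock_Kurzweil_Integration.integral_add integrable_continuous_real circle_char_continuous)
      then show ?thesis using False unfolding integral_circle_char by auto
    qed
    have "(\<lambda>n. \<Sum>k<n. integral {0..1} (\<lambda>x. of_real (v k x) * circle_char m x)) \<longlonglongrightarrow> integral {0..1} (\<lambda>x. of_real (G x) * circle_char m x)"
      by (rule lim_int[OF vlim cv])
    moreover have "(\<lambda>k. if k = nat \<bar>m\<bar> then of_real (c * q (nat \<bar>m\<bar>)) else 0 :: complex) sums of_real (c * q (nat \<bar>m\<bar>))"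
      by (rule sums_single)
    ultimately show ?thesis unfolding vi sums_def using LIMSEQ_unique by blast
  qed
  have coefF: "integral {0..1} (\<lambda>x. of_real (F x) * circle_char m x) = of_real (c * q (nat \<bar>m\<bar>))" for m
  proof -
    let ?f = "\<lambda>x. of_real (h x) * circle_char m x"
    have cf: "continuous_on A ?f" for A unfolding h_def by (intro continuous_intros)
    have fi: "?f integrable_on {a..b}" for a b by (intro integrable_continuous_real cf)
    have per: "circle_char m (x + of_int j) = circle_char m x" for x j
    proof -
      have "circle_char m (x + of_int j) = circle_char m x * cis (2 * pi * of_int (m * j))"
        by (simp add: circle_char_def cis_mult algebra_simps)
      then show ?thesis by (metis Ints_of_int cis_multiple_2pi mult.right_neutral)
    qed
    have shift: "integral {0..1} (\<lambda>x. of_real (h (x + of_int j)) * circle_char m x) = integral {of_int j..1 + of_int j} ?f" for j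
    proof -
      have "(\<lambda>x. of_real (h (x + of_int j)) * circle_char m x) = ?f \<circ> ((+) (of_int j))"
        using per by (auto simp: o_def add.commute)
      then show ?thesis using integral_shift_Icc_real[of 0 1 ?f "of_int j"] by simp
    qed
    have part: "(\<Sum>k<Suc n. integral {0..1} (\<lambda>x. of_real (u k x) * circle_char m x)) = integral {- real n..1 + real n} ?f" for n
    proof (induction n)
      case 0
      then show ?case by (simp add: u_def)
    next
      case (Suc n)
      let ?j = "int (Suc n)"
      have "integral {0..1} (\<lambda>x. of_real (u (Suc n) x) * circle_char m x)
          = integral {0..1} (\<lambda>x. of_real (h (x + of_int ?j)) * circle_char m x) + integral {0..1} (\<lambda>x. of_real (h (x + of_int (- ?j))) * circle_char m x)"
      proof -
        have "of_real (u (Suc n) x) * circle_char m x = of_real (h (x + of_int ?j)) * circle_char m x + of_real (h (x + of_int (- ?j))) * circle_char m x" for x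
          by (simp add: u_def ring_distribs del: of_nat_Suc)
        moreover have "(\<lambda>x. of_real (h (x + of_int j)) * circle_char m x) integrable_on {0..1}" for j
          unfolding h_def by (intro integrable_continuous_real continuous_intros)
        ultimately show ?thesis by (simp only: Henstock_Kurzweil_Integration.integral_add)
      qed
      also have "\<dots> = integral {1 + real n..1 + real (Suc n)} ?f + integral {- real (Suc n)..- real n} ?f"
        unfolding shift by (simp add: add.commute)
      finally have "(\<Sum>k<Suc (Suc n). integral {0..1} (\<lambda>x. of_real (u k x) * circle_char m x))
         = integral {- real (Suc n)..- real n} ?f + integral {- real n..1 + real n} ?f + integral {1 + real n..1 + real (Suc n)} ?f"
        using Suc by simp
      also have "integral {- real (Suc n)..- real n} ?f + integral {- real n..1 + real n} ?f = integral {- real (Suc n)..1 + real n} ?f"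
        by (rule Henstock_Kurzweil_Integration.integral_combine[OF _ _ fi]) auto
      also have "integral {- real (Suc n)..1 + real n} ?f + integral {1 + real n..1 + real (Suc n)} ?f = integral {- real (Suc n)..1 + real (Suc n)} ?f"
        by (rule Henstock_Kurzweil_Integration.integral_combine[OF _ _ fi]) auto
      finally show ?case .
    qed
    note gf = gaussian_fourier[OF t, of m, folded h_def]
    have "(\<lambda>n. integral {- real n..1 + real n} ?f) \<longlonglongrightarrow> (\<integral>x. ?f x \<partial>lborel)"
    proof -
      have "(\<lambda>n. \<integral>x. indicator {- real n..1 + real n} x *\<^sub>R ?f x \<partial>lborel) \<longlonglongrightarrow> (\<integral>x. ?f x \<partial>lborel)"
      proof (rule integral_dominated_convergence[where w = "\<lambda>x. norm (?f x)"])
        show "AE x in lborel. (\<lambda>n. indicator {- real n..1 + real n} x *\<^sub>R ?f x) \<longlonglongrightarrow> ?f x"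
        proof (rule AE_I2, rule tendsto_eventually)
          fix x :: real
          obtain N :: nat where "\<bar>x\<bar> \<le> real N" using real_arch_simple by blast
          then have "x \<in> {- real n..1 + real n}" if "n \<ge> N" for n using that by auto
          then show "\<forall>\<^sub>F n in sequentially. indicator {- real n..1 + real n} x *\<^sub>R ?f x = ?f x"
            unfolding eventually_sequentially by (intro exI[of _ N]) auto
        qed
        show "integrable lborel (\<lambda>x. norm (?f x))" using gf(1) by (rule integrable_norm)
        show "AE x in lborel. norm (indicator {- real n..1 + real n} x *\<^sub>R ?f x) \<le> norm (?f x)" for n
          by (auto simp: indicator_def)
        show "?f \<in> borel_measurable lborel" using gf(1) by (rule borel_measurable_integrable)
        show "(\<lambda>x. indicator {- real n..1 + real n} x *\<^sub>R ?f x) \<in> borel_measurable lborel" for n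
          using gf(1) by measurable
      qed
      moreover have "(\<integral>x. indicator {a..b} x *\<^sub>R ?f x \<partial>lborel) = integral {a..b} ?f" for a b
      proof -
        have "set_integrable lborel {a..b} ?f"
          using borel_integrable_atLeastAtMost'[OF cf] by blast
        from set_borel_integral_eq_integral(2)[OF this] show ?thesis by (simp add: set_lebesgue_integral_def)
      qed
      ultimately show ?thesis by simp
    qed
    moreover have "(\<lambda>n. \<Sum>k<Suc n. integral {0..1} (\<lambda>x. of_real (u k x) * circle_char m x)) \<longlonglongrightarrow> integral {0..1} (\<lambda>x. of_real (F x) * circle_char m x)"
      by (intro LIMSEQ_Suc lim_int[OF ulim cu])
    ultimately have "integral {0..1} (\<lambda>x. of_real (F x) * circle_char m x) = (\<integral>x. ?f x \<partial>lborel)"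
      unfolding part using LIMSEQ_unique by blast
    also have "\<dots> = of_real (c * q (nat \<bar>m\<bar>))"
      unfolding gf(2) c_def q_def by simp
    finally show ?thesis .
  qed
  have "F 0 - G 0 = 0"
  proof (rule fourier_coefficients_zero_imp_zero[where D = "\<lambda>x. F x - G x"])
    show "continuous_on UNIV (\<lambda>x. F x - G x)" by (intro continuous_intros cF cG)
    show "F (x + 1) - G (x + 1) = F x - G x" for x by (simp add: perF perG)
    fix m
    have cF': "continuous_on {0..1} F" and cG': "continuous_on {0..1} G"
      using cF cG continuous_on_subset by blast+
    have "integral {0..1} (\<lambda>x. of_real (F x - G x) * circle_char m x)
       = integral {0..1} (\<lambda>x. of_real (F x) * circle_char m x) - integral {0..1} (\<lambda>x. of_real (G x) * circle_char m x)"
      by (subst Henstock_Kurzweil_Integration.integral_diff[symmetric])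
         (auto intro!: integrable_continuous_real continuous_intros cF' cG' simp: left_diff_distrib)
    then show "integral {0..1} (\<lambda>x. of_real (F x - G x) * circle_char m x) = 0"
      unfolding coefF coefG by simp
  qed
  moreover have "F 0 = theta t"
    unfolding F_def theta_def by (rule arg_cong[of _ _ suminf]) (auto simp: u_def h_def)
  moreover have "G 0 = c * theta (pi\<^sup>2 / t)"
  proof -
    have "summable (\<lambda>k. if k = 0 then 1 else 2 * exp (- (pi\<^sup>2 / t) * (real k)\<^sup>2))"
      using theta_summable[of "pi\<^sup>2 / t"] t by simp
    then have "c * theta (pi\<^sup>2 / t) = (\<Sum>k. c * (if k = 0 then 1 else 2 * exp (- (pi\<^sup>2 / t) * (real k)\<^sup>2)))"
      unfolding theta_def by (rule suminf_mult[symmetric])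
    then show ?thesis unfolding G_def v_def q_def by (simp add: if_distrib cong: if_cong)
  qed
  ultimately show ?thesis by (simp add: c_def)
qed

section \<open>Sums of two squares\<close>

lemma theta_has_sum_int:
  assumes t: "t > 0"
  shows "((\<lambda>a::int. exp (- t * (of_int a)\<^sup>2)) has_sum theta t) UNIV"
proof -
  let ?f = "\<lambda>a::int. exp (- t * (of_int a)\<^sup>2)"
  define S where "S = (\<Sum>n. exp (- t * (real (Suc n))\<^sup>2))"
  have "summable (\<lambda>n. exp (- t * (real n)\<^sup>2))"
    by (rule summable_comparison_test'[OF summable_exp_power[OF t], where N = 0])
       (use exp_square_le[OF t] in simp)
  then have s: "summable (\<lambda>n. exp (- t * (real (Suc n))\<^sup>2))"
    by (subst summable_Suc_iff)
  have S: "((\<lambda>n. exp (- t * (real (Suc n))\<^sup>2)) has_sum S) UNIV"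
    unfolding S_def by (rule sums_nonneg_imp_has_sum[OF summable_sums[OF s]]) simp
  have "((\<lambda>n. ?f (int (Suc n))) has_sum S) UNIV" using S by simp
  then have pos: "(?f has_sum S) (range (\<lambda>n. int (Suc n)))"
    by (subst has_sum_reindex) (auto simp: inj_on_def o_def)
  have "((\<lambda>n. ?f (- int (Suc n))) has_sum S) UNIV" using S by (simp add: power2_commute add.commute power2_eq_square algebra_simps)
  then have neg: "(?f has_sum S) (range (\<lambda>n. - int (Suc n)))"
    by (subst has_sum_reindex) (auto simp: inj_on_def o_def)
  have zero: "(?f has_sum 1) {0}" by (rule has_sum_finiteI) auto
  have u: "UNIV = ({0} \<union> range (\<lambda>n. int (Suc n))) \<union> range (\<lambda>n. - int (Suc n))"
  proof (intro equalityI subsetI)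
    fix a :: int
    consider "a = 0" | "a > 0" | "a < 0" by linarith
    then show "a \<in> ({0} \<union> range (\<lambda>n. int (Suc n))) \<union> range (\<lambda>n. - int (Suc n))"
    proof cases
      case 2
      then have "a = int (Suc (nat (a - 1)))" by simp
      then show ?thesis by blast
    next
      case 3
      then have "a = - int (Suc (nat (- a - 1)))" by simp
      then show ?thesis by blast
    qed auto
  qed auto
  have "(?f has_sum (1 + S) + S) UNIV"
    unfolding u by (intro has_sum_Un_disjoint zero pos neg) auto
  moreover have "theta t = 1 + 2 * S"
  proof -
    have "theta t = (\<Sum>k. if Suc k = 0 then 1 else 2 * exp (- t * (real (Suc k))\<^sup>2)) + 1"
      unfolding theta_def by (subst suminf_split_head[OF theta_summable[OF t]]) simp
    also have "\<dots> = 2 * S + 1" unfolding S_def by (subst suminf_mult[OF s, symmetric]) simp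
    finally show ?thesis by simp
  qed
  ultimately show ?thesis by (simp add: algebra_simps)
qed

lemma finite_r2_set: "finite {(a::int, b::int). a\<^sup>2 + b\<^sup>2 = int n}"
proof (rule finite_subset)
  show "{(a::int, b::int). a\<^sup>2 + b\<^sup>2 = int n} \<subseteq> {- int n..int n} \<times> {- int n..int n}"
  proof safe
    have le: "\<bar>a\<bar> \<le> a\<^sup>2" for a :: int
    proof (cases "a = 0")
      case False
      then have "\<bar>a\<bar> * 1 \<le> \<bar>a\<bar> * \<bar>a\<bar>" by (intro mult_left_mono) auto
      then show ?thesis by (simp add: power2_eq_square)
    qed simp
    fix a b :: int assume *: "a\<^sup>2 + b\<^sup>2 = int n"
    have "\<bar>a\<bar> \<le> int n" "\<bar>b\<bar> \<le> int n" 
      using le[of a] le[of b] zero_le_power2[of a] zero_le_power2[of b] * by linarith+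
    then show "a \<in> {- int n..int n}" "b \<in> {- int n..int n}" by auto
  qed
qed simp

definition theta2 :: "real \<Rightarrow> real" where
  "theta2 t = (theta t)\<^sup>2"

text \<open>
  The square of the theta function is a double sum over \<open>\<int>\<^sup>2\<close>, grouped here by the value of \<open>a\<^sup>2 + b\<^sup>2\<close>.
\<close>

lemma theta2_sums:
  assumes t: "t > 0"
  shows "(\<lambda>n. real (r2 n) * exp (- real n * t)) sums theta2 t"
proof -
  let ?f = "\<lambda>a::int. exp (- t * (of_int a)\<^sup>2)"
  let ?g = "\<lambda>(a::int, b::int). exp (- t * (of_int a)\<^sup>2) * exp (- t * (of_int b)\<^sup>2)"
  let ?N = "\<lambda>n. {(a::int, b::int). a\<^sup>2 + b\<^sup>2 = int n}"
  have f: "(?f has_sum theta t) UNIV" by (rule theta_has_sum_int[OF t])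
  have inner: "((\<lambda>b. ?g (a, b)) has_sum ?f a * theta t) UNIV" for a
    using has_sum_cmult_right[OF f] by simp
  have outer: "((\<lambda>a. ?f a * theta t) has_sum theta t * theta t) UNIV"
    by (rule has_sum_cmult_left[OF f])
  have "(\<lambda>p. norm (?g p)) summable_on UNIV \<times> UNIV"
  proof (subst Infinite_Sum.abs_summable_on_Sigma_iff, intro conjI ballI)
    show "(\<lambda>b. norm (?g (a, b))) summable_on UNIV" for a
      using inner[of a] by (auto simp: summable_on_def)
    have "infsum (\<lambda>b. norm (?g (a, b))) UNIV = ?f a * theta t" for a
      using inner[of a] by (simp add: infsumI)
    moreover have "(\<lambda>a. norm (?f a * theta t)) summable_on UNIV"
    proof -
      have "(\<lambda>a. ?f a * theta t) summable_on UNIV" using outer by (auto simp: summable_on_def)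
      then show ?thesis by (rule summable_on_iff_abs_summable_on_real[THEN iffD1])
    qed
    ultimately show "(\<lambda>a. norm (infsum (\<lambda>b. norm (?g (a, b))) UNIV)) summable_on UNIV" by simp
  qed
  then have "?g summable_on UNIV \<times> UNIV" by (rule Infinite_Sum.abs_summable_summable)
  then have "(?g has_sum theta t * theta t) (UNIV \<times> UNIV)"
    by (intro has_sum_SigmaI[OF inner outer]) auto
  then have G: "(?g has_sum theta2 t) UNIV" by (simp add: theta2_def power2_eq_square)
  have "(?g has_sum theta2 t) UNIV \<longleftrightarrow> ((\<lambda>(n, p). ?g p) has_sum theta2 t) (Sigma UNIV ?N)"
    by (rule has_sum_reindex_bij_witness[of _ snd "\<lambda>p. (nat ((fst p)\<^sup>2 + (snd p)\<^sup>2), p)"]) auto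
  with G have S: "((\<lambda>(n, p). ?g p) has_sum theta2 t) (Sigma UNIV ?N)" by simp
  have "((\<lambda>n. real (r2 n) * exp (- real n * t)) has_sum theta2 t) UNIV"
  proof (rule has_sum_SigmaD[OF S])
    fix n :: nat
    have "(\<Sum>p\<in>?N n. ?g p) = (\<Sum>p\<in>?N n. exp (- real n * t))"
    proof (rule sum.cong[OF refl])
      fix p assume "p \<in> ?N n"
      then obtain a b where p: "p = (a, b)" "a\<^sup>2 + b\<^sup>2 = int n" by auto
      then have "real n = of_int (a\<^sup>2 + b\<^sup>2)" by simp
      then have "real n = (of_int a)\<^sup>2 + (of_int b)\<^sup>2" by (simp only: of_int_add of_int_power)
      then show "?g p = exp (- real n * t)"
        unfolding p(1) by (simp only: prod.case mult_exp_exp) (simp add: algebra_simps)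
    qed
    then show "((\<lambda>p. case (n, p) of (n, p) \<Rightarrow> ?g p) has_sum real (r2 n) * exp (- real n * t)) (?N n)"
      by (intro has_sum_finiteI finite_r2_set) (simp add: r2_def)
  qed
  then show ?thesis by (rule has_sum_imp_sums)
qed

lemma r2_0: "r2 0 = 1"
proof -
  have "{(a::int, b::int). a\<^sup>2 + b\<^sup>2 = int 0} = {(0, 0)}" by (auto simp: sum_power2_eq_zero_iff)
  then show ?thesis by (simp add: r2_def)
qed

lemma theta2_inversion:
  assumes "t > 0"
  shows "theta2 t = pi / t * theta2 (pi\<^sup>2 / t)"
proof -
  have "theta2 t = (sqrt (pi / t))\<^sup>2 * (theta (pi\<^sup>2 / t))\<^sup>2"
    unfolding theta2_def by (subst theta_inversion[OF assms]) (simp add: power_mult_distrib)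
  then show ?thesis using assms by (simp add: theta2_def)
qed

lemma theta2_antimono: assumes "0 < s" "s \<le> t" shows "theta2 t \<le> theta2 s"
proof (rule sums_le[OF _ theta2_sums theta2_sums])
  show "real (r2 n) * exp (- real n * t) \<le> real (r2 n) * exp (- real n * s)" for n
    using assms by (intro mult_left_mono) (auto simp: mult_left_mono)
qed (use assms in auto)

lemma theta2_nonneg: "theta2 t \<ge> 0" by (simp add: theta2_def)

text \<open>
  Near 0 the growth \<open>O (1 / t)\<close> comes from the inversion formula and the monotonicity of \<open>theta2\<close>.
\<close>

lemma theta2_bound: assumes t: "t > 0" shows "theta2 t \<le> theta2 pi * (1 + pi / t)"
proof (cases "t \<ge> pi")
  case True
  then have "theta2 t \<le> theta2 pi * 1" using theta2_antimono[of pi t] by simp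
  also have "\<dots> \<le> theta2 pi * (1 + pi / t)" using t by (intro mult_left_mono theta2_nonneg) simp
  finally show ?thesis .
next
  case False
  then have "pi \<le> pi\<^sup>2 / t" using t by (simp add: field_simps power2_eq_square)
  then have "theta2 (pi\<^sup>2 / t) \<le> theta2 pi" by (intro theta2_antimono) auto
  then have "pi / t * theta2 (pi\<^sup>2 / t) \<le> pi / t * theta2 pi" using t by (intro mult_left_mono) auto
  also have "\<dots> \<le> theta2 pi * (1 + pi / t)" using theta2_nonneg[of pi] by (simp add: algebra_simps)
  finally show ?thesis using theta2_inversion[OF t] by simp
qed

lemma exp_real_Gamma:
  fixes m a :: real
  assumes "m > 0" "a > 0"
  shows "(\<integral>\<tau>. exp (m * \<tau> - a * exp \<tau>) \<partial>lborel) = Gamma m * a powr (- m)"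
proof -
  have i: "integrable lborel (exp_ker (of_real m) (of_real a) 0)"
    by (rule exp_ker_integrable) (use assms in auto)
  have e: "exp_ker (of_real m) (of_real a) 0 \<tau> = of_real (exp (m * \<tau> - a * exp \<tau>))" for \<tau>
    by (simp add: exp_ker_def exp_of_real[symmetric])
  have "of_real (\<integral>\<tau>. exp (m * \<tau> - a * exp \<tau>) \<partial>lborel) = exp_int (of_real m) (of_real a) 0"
    unfolding exp_int_def e by simp
  also have "\<dots> = Gamma (of_real m) * of_real a powr (- of_real m)"
    by (rule exp_int_Gamma) (use assms in auto)
  also have "\<dots> = of_real (Gamma m * a powr (- m))"
    using assms by (simp add: Gamma_complex_of_real powr_of_real flip: of_real_minus)
  finally show ?thesis by (simp only: of_real_eq_iff)
qed

text \<open>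
  Up to the factor \<open>Gamma (1 + e)\<close>, \<open>(n + 1) powr (- (1 + e))\<close> is the integral of
  \<open>t powr e * exp (- (n + 1) * t)\<close>, so the partial sums are bounded by the integral of
  \<open>theta2 t * t powr e * exp (- t)\<close>, which is finite by \<open>theta2_bound\<close>.
\<close>

lemma r2_powr_summable:
  assumes e: "e > 0"
  shows "summable (\<lambda>n. real (r2 n) * (real n + 1) powr (- (1 + e)))"
proof -
  \<comment> \<open>The Laplace integrand in the variable \<open>t = exp \<tau>\<close>.\<close>
  define k where "k n \<tau> = exp ((1 + e) * \<tau> - (real n + 1) * exp \<tau>)" for n :: nat and \<tau>
  have ki: "integrable lborel (k n)" for n
    unfolding k_def by (rule exp_real_integrable_right) (use e in auto)
  have kv: "(\<integral>\<tau>. k n \<tau> \<partial>lborel) = Gamma (1 + e) * (real n + 1) powr (- (1 + e))" for n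
    unfolding k_def by (rule exp_real_Gamma) (use e in auto)
  define w where "w \<tau> = theta2 pi * (exp ((1 + e) * \<tau> - 1 * exp \<tau>) + pi * exp (e * \<tau> - 1 * exp \<tau>))" for \<tau>
  have wi: "integrable lborel w"
    unfolding w_def by (intro integrable_mult_right Bochner_Integration.integrable_add exp_real_integrable_right) (use e in auto)
  have le: "(\<Sum>n<N. real (r2 n) * k n \<tau>) \<le> w \<tau>" for N \<tau>
  proof -
    have "(\<Sum>n<N. real (r2 n) * k n \<tau>) = exp ((1 + e) * \<tau> - exp \<tau>) * (\<Sum>n<N. real (r2 n) * exp (- real n * exp \<tau>))"
      by (simp add: sum_distrib_left k_def algebra_simps flip: exp_add)
    also have "(\<Sum>n<N. real (r2 n) * exp (- real n * exp \<tau>)) \<le> theta2 (exp \<tau>)"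
    proof -
      have "exp \<tau> > 0" by simp
      from theta2_sums[OF this] show ?thesis
        unfolding sums_iff by (metis (no_types, lifting) sum_le_suminf finite_lessThan mult_nonneg_nonneg of_nat_0_le_iff exp_ge_zero)
    qed
    also have "theta2 (exp \<tau>) \<le> theta2 pi * (1 + pi / exp \<tau>)" by (rule theta2_bound) simp
    also have "exp ((1 + e) * \<tau> - exp \<tau>) * (theta2 pi * (1 + pi / exp \<tau>)) = w \<tau>"
      by (simp add: w_def algebra_simps exp_add exp_diff add_divide_distrib)
    finally show ?thesis by simp
  qed
  have "summable (\<lambda>n. real (r2 n) * (\<integral>\<tau>. k n \<tau> \<partial>lborel))"
  proof (rule summableI_nonneg_bounded)
    show "0 \<le> real (r2 n) * (\<integral>\<tau>. k n \<tau> \<partial>lborel)" for n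
      by (intro mult_nonneg_nonneg integral_nonneg_AE) (auto simp: k_def)
    fix N
    have "(\<Sum>n<N. real (r2 n) * (\<integral>\<tau>. k n \<tau> \<partial>lborel)) = (\<integral>\<tau>. (\<Sum>n<N. real (r2 n) * k n \<tau>) \<partial>lborel)"
      using ki by (subst Bochner_Integration.integral_sum) auto
    also have "\<dots> \<le> (\<integral>\<tau>. w \<tau> \<partial>lborel)"
      by (intro integral_mono le wi Bochner_Integration.integrable_sum integrable_mult_right ki)
    finally show "(\<Sum>n<N. real (r2 n) * (\<integral>\<tau>. k n \<tau> \<partial>lborel)) \<le> (\<integral>\<tau>. w \<tau> \<partial>lborel)" .
  qed
  then have "summable (\<lambda>n. Gamma (1 + e) * (real (r2 n) * (real n + 1) powr (- (1 + e))))"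
    unfolding kv by (simp add: mult_ac)
  moreover have "Gamma (1 + e) \<noteq> 0" by (metis Gamma_real_pos add_pos_pos e less_irrefl zero_less_one)
  ultimately show ?thesis by (simp add: summable_cmult_iff)
qed

section \<open>Laguerre expansion of the Laplace kernel\<close>

text \<open>
  The coefficient of \<open>x ^ k\<close> in \<open>(- 1) ^ m / \<Gamma> (\<nu> + m + 1)\<close> times the Laguerre polynomial of degree \<open>m\<close> and
  parameter \<open>\<nu>\<close>.
\<close>

definition laguerre_coeff :: "complex \<Rightarrow> nat \<Rightarrow> nat \<Rightarrow> complex" where
  "laguerre_coeff \<nu> m k = (if k \<le> m then (- 1) ^ (m - k) / (fact (m - k) * fact k) * rGamma (\<nu> + of_nat k + 1) else 0)"

text \<open>
  Coefficientwise form of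
  \<open>(m + 1) * L\<^sub>m\<^sub>+\<^sub>1 x = (m + \<nu> + 1 - x) * L\<^sub>m x + x * L\<^sub>m' x\<close>. With the common factor \<open>E\<close> split off it is the identity
  \<open>k * (\<nu> + k) + (\<nu> + m + k + 1) * (m - k + 1) = (m + 1) * (\<nu> + m + 1)\<close>.
\<close>

lemma laguerre_coeff_recurrence:
  "(if k = 0 then 0 else laguerre_coeff \<nu> m (k - 1)) - (\<nu> + of_nat m + of_nat k + 1) * laguerre_coeff \<nu> m k
     = of_nat (Suc m) * (\<nu> + of_nat m + 1) * laguerre_coeff \<nu> (Suc m) k"
proof -
  consider "k > Suc m" | "k = Suc m" | "k \<le> m" by linarith
  then show ?thesis
  proof cases
    case 1
    then show ?thesis by (auto simp: laguerre_coeff_def)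
  next
    case 2
    define R where "R = rGamma (\<nu> + of_nat (Suc m) + 1)"
    have "rGamma (\<nu> + of_nat m + 1) = (\<nu> + of_nat m + 1) * R"
      using rGamma_plus1[of "\<nu> + of_nat m + 1"] by (simp add: R_def add_ac)
    then have 1: "laguerre_coeff \<nu> m (k - 1) = (1 / fact m) * ((\<nu> + of_nat m + 1) * R)" using 2 by (simp add: laguerre_coeff_def)
    have 3: "laguerre_coeff \<nu> (Suc m) k = R / fact (Suc m)" using 2 by (simp add: laguerre_coeff_def R_def del: of_nat_Suc fact_Suc)
    have 4: "laguerre_coeff \<nu> m k = 0" using 2 by (simp add: laguerre_coeff_def)
    have f: "of_nat (Suc m) / fact (Suc m) = (1 / fact m :: complex)"
      by (simp only: fact_Suc of_nat_mult nonzero_divide_mult_cancel_left of_nat_neq_0 not_False_eq_True)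
    have "of_nat (Suc m) * (\<nu> + of_nat m + 1) * (R / fact (Suc m)) = (of_nat (Suc m) / fact (Suc m)) * ((\<nu> + of_nat m + 1) * R)"
      by simp
    then show ?thesis unfolding 1 3 4 f using 2 by simp
  next
    case 3
    define j where "j = m - k"
    have m: "m = j + k" using 3 by (simp add: j_def)
    define R where "R = rGamma (\<nu> + of_nat k + 1)"
    define E where "E = (- 1) ^ j / (fact (Suc j) * fact k) * R"
    have c1: "laguerre_coeff \<nu> m k = of_nat (Suc j) * E"
      using 3 by (simp add: laguerre_coeff_def m E_def R_def del: of_nat_Suc)
    have c2: "laguerre_coeff \<nu> (Suc m) k = - E"
      using 3 by (simp add: laguerre_coeff_def m E_def R_def Suc_diff_le del: of_nat_Suc fact_Suc)
    have c3: "(if k = 0 then 0 else laguerre_coeff \<nu> m (k - 1)) = - (of_nat k * (\<nu> + of_nat k) * E)"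
    proof (cases k)
      case (Suc k')
      have "rGamma (\<nu> + of_nat k' + 1) = (\<nu> + of_nat k) * R"
        using rGamma_plus1[of "\<nu> + of_nat k' + 1"] Suc by (simp add: R_def add_ac)
      moreover have "m - k' = Suc j" using Suc m by simp
      moreover have "1 / fact k' = (of_nat k / fact k :: complex)" using Suc by (simp del: of_nat_Suc)
      ultimately show ?thesis using Suc m
        by (simp add: laguerre_coeff_def E_def del: of_nat_Suc fact_Suc) (simp add: field_simps del: of_nat_Suc fact_Suc)
    qed simp
    show ?thesis unfolding c1 c2 c3 by (simp add: m algebra_simps)
  qed
qed

definition laguerre_moment :: "complex \<Rightarrow> complex \<Rightarrow> complex \<Rightarrow> nat \<Rightarrow> nat \<Rightarrow> complex" where
  "laguerre_moment \<nu> \<sigma> A \<kappa> m = (\<Sum>k\<le>m. laguerre_coeff \<nu> m k * \<sigma> ^ k * exp_int (\<nu> + of_nat \<kappa> + of_nat m + of_nat k) \<sigma> A)"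

text \<open>
  Rewriting \<open>A\<close> times each integral by \<open>exp_int_recurrence\<close> turns the right-hand side into a combination of
  the integrals of order \<open>\<nu> + \<kappa> + m + k + 1\<close>, whose coefficients are those of degree \<open>m + 1\<close> by
  \<open>laguerre_coeff_recurrence\<close>.
\<close>

lemma laguerre_moment_recurrence:
  assumes \<sigma>: "Re \<sigma> > 0" and A: "Re A > 0 \<or> A = 0" and \<nu>: "Re \<nu> > 0"
  shows "of_nat (Suc m) * (\<nu> + of_nat m + 1) * laguerre_moment \<nu> \<sigma> A \<kappa> (Suc m)
     = of_nat \<kappa> * laguerre_moment \<nu> \<sigma> A (Suc \<kappa>) m + A * laguerre_moment \<nu> \<sigma> A \<kappa> m"
proof -
  define b where "b k = exp_int (\<nu> + of_nat \<kappa> + of_nat m + of_nat k + 1) \<sigma> A" for k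
  have rec: "of_nat \<kappa> * b k + A * exp_int (\<nu> + of_nat \<kappa> + of_nat m + of_nat k) \<sigma> A
      = \<sigma> * b (Suc k) - (\<nu> + of_nat m + of_nat k + 1) * b k" for k
    using exp_int_recurrence[of \<sigma> A "\<nu> + of_nat \<kappa> + of_nat m + of_nat k + 1"] \<sigma> A \<nu>
    by (simp add: b_def algebra_simps)
  have "of_nat \<kappa> * laguerre_moment \<nu> \<sigma> A (Suc \<kappa>) m + A * laguerre_moment \<nu> \<sigma> A \<kappa> m
     = (\<Sum>k\<le>m. laguerre_coeff \<nu> m k * \<sigma> ^ k * (of_nat \<kappa> * b k + A * exp_int (\<nu> + of_nat \<kappa> + of_nat m + of_nat k) \<sigma> A))"
    unfolding laguerre_moment_def sum_distrib_left sum.distrib[symmetric]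
    by (rule sum.cong) (simp_all add: b_def algebra_simps)
  also have "\<dots> = (\<Sum>k\<le>m. laguerre_coeff \<nu> m k * \<sigma> ^ Suc k * b (Suc k))
        - (\<Sum>k\<le>m. (\<nu> + of_nat m + of_nat k + 1) * laguerre_coeff \<nu> m k * \<sigma> ^ k * b k)"
    unfolding rec sum_subtractf[symmetric] by (rule sum.cong) (simp_all add: algebra_simps)
  also have "(\<Sum>k\<le>m. laguerre_coeff \<nu> m k * \<sigma> ^ Suc k * b (Suc k))
      = (\<Sum>k\<le>Suc m. (if k = 0 then 0 else laguerre_coeff \<nu> m (k - 1)) * \<sigma> ^ k * b k)"
    by (subst sum.atMost_Suc_shift) simp
  also have "(\<Sum>k\<le>m. (\<nu> + of_nat m + of_nat k + 1) * laguerre_coeff \<nu> m k * \<sigma> ^ k * b k)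
      = (\<Sum>k\<le>Suc m. (\<nu> + of_nat m + of_nat k + 1) * laguerre_coeff \<nu> m k * \<sigma> ^ k * b k)"
    by (simp add: laguerre_coeff_def)
  also have "(\<Sum>k\<le>Suc m. (if k = 0 then 0 else laguerre_coeff \<nu> m (k - 1)) * \<sigma> ^ k * b k)
      - (\<Sum>k\<le>Suc m. (\<nu> + of_nat m + of_nat k + 1) * laguerre_coeff \<nu> m k * \<sigma> ^ k * b k)
      = (\<Sum>k\<le>Suc m. ((if k = 0 then 0 else laguerre_coeff \<nu> m (k - 1)) - (\<nu> + of_nat m + of_nat k + 1) * laguerre_coeff \<nu> m k) * (\<sigma> ^ k * b k))"
    unfolding sum_subtractf[symmetric] by (rule sum.cong) (simp_all add: left_diff_distrib mult.assoc)
  also have "\<dots> = of_nat (Suc m) * (\<nu> + of_nat m + 1) * laguerre_moment \<nu> \<sigma> A \<kappa> (Suc m)"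
    unfolding laguerre_coeff_recurrence laguerre_moment_def sum_distrib_left
    by (rule sum.cong) (simp_all add: b_def add_ac mult_ac)
  finally show ?thesis by simp
qed

lemma laguerre_moment_0:
  assumes \<sigma>: "Re \<sigma> > 0" and A: "Re A > 0 \<or> A = 0" and \<nu>: "Re \<nu> > 0"
  shows "laguerre_moment \<nu> \<sigma> A 0 m = A ^ m / fact m * rGamma (\<nu> + of_nat m + 1) * exp_int \<nu> \<sigma> A"
proof (induction m)
  case 0
  then show ?case by (simp add: laguerre_moment_def laguerre_coeff_def)
next
  case (Suc m)
  have nz: "of_nat (Suc m) * (\<nu> + of_nat m + 1) \<noteq> 0"
    using \<nu> by (auto simp: complex_eq_iff simp del: of_nat_Suc)
  have g: "rGamma (\<nu> + of_nat m + 1) = (\<nu> + of_nat m + 1) * rGamma (\<nu> + of_nat (Suc m) + 1)"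
    using rGamma_plus1[of "\<nu> + of_nat m + 1"] by (simp add: add_ac)
  have "of_nat (Suc m) * (\<nu> + of_nat m + 1) * laguerre_moment \<nu> \<sigma> A 0 (Suc m) = A * laguerre_moment \<nu> \<sigma> A 0 m"
    using laguerre_moment_recurrence[OF assms, of m 0] by simp
  also have "\<dots> = of_nat (Suc m) * (\<nu> + of_nat m + 1) *
      (A ^ Suc m / fact (Suc m) * rGamma (\<nu> + of_nat (Suc m) + 1) * exp_int \<nu> \<sigma> A)"
  proof -
    have "of_nat (Suc m) / fact (Suc m) = (1 / fact m :: complex)" by (simp del: of_nat_Suc)
    then have f: "1 / fact m = (of_nat (Suc m) / fact (Suc m) :: complex)" by simp
    have "A * laguerre_moment \<nu> \<sigma> A 0 m = A ^ Suc m * (1 / fact m) * rGamma (\<nu> + of_nat m + 1) * exp_int \<nu> \<sigma> A"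
      unfolding Suc by simp
    then show ?thesis unfolding f g by (simp del: of_nat_Suc fact_Suc add: mult_ac)
  qed
  finally show ?case using nz mult_left_cancel by blast
qed

lemma laguerre_moment_Laplace:
  assumes \<sigma>: "Re \<sigma> > 0" and \<nu>: "Re \<nu> > 0"
  shows "laguerre_moment \<nu> \<sigma> 0 \<kappa> m = pochhammer (of_nat \<kappa>) m / fact m * rGamma (\<nu> + of_nat m + 1) * exp_int (\<nu> + of_nat \<kappa> + of_nat m) \<sigma> 0"
proof (induction m arbitrary: \<kappa>)
  case 0
  then show ?case by (simp add: laguerre_moment_def laguerre_coeff_def)
next
  case (Suc m)
  have nz: "of_nat (Suc m) * (\<nu> + of_nat m + 1) \<noteq> 0"
    using \<nu> by (auto simp: complex_eq_iff simp del: of_nat_Suc)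
  have g: "rGamma (\<nu> + of_nat m + 1) = (\<nu> + of_nat m + 1) * rGamma (\<nu> + of_nat (Suc m) + 1)"
    using rGamma_plus1[of "\<nu> + of_nat m + 1"] by (simp add: add_ac)
  have "of_nat (Suc m) * (\<nu> + of_nat m + 1) * laguerre_moment \<nu> \<sigma> 0 \<kappa> (Suc m) = of_nat \<kappa> * laguerre_moment \<nu> \<sigma> 0 (Suc \<kappa>) m"
    using laguerre_moment_recurrence[OF \<sigma> _ \<nu>, of 0 m \<kappa>] by simp
  also have "\<dots> = of_nat (Suc m) * (\<nu> + of_nat m + 1) *
      (pochhammer (of_nat \<kappa>) (Suc m) / fact (Suc m) * rGamma (\<nu> + of_nat (Suc m) + 1) * exp_int (\<nu> + of_nat \<kappa> + of_nat (Suc m)) \<sigma> 0)"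
  proof -
    have "of_nat (Suc m) / fact (Suc m) = (1 / fact m :: complex)" by (simp del: of_nat_Suc)
    then have f: "1 / fact m = (of_nat (Suc m) / fact (Suc m) :: complex)" by simp
    have p: "of_nat \<kappa> * pochhammer (of_nat (Suc \<kappa>)) m = (pochhammer (of_nat \<kappa>) (Suc m) :: complex)"
      by (simp add: pochhammer_rec add.commute)
    have e: "\<nu> + of_nat (Suc \<kappa>) + of_nat m = \<nu> + of_nat \<kappa> + of_nat (Suc m)" by simp
    have "of_nat \<kappa> * laguerre_moment \<nu> \<sigma> 0 (Suc \<kappa>) m = (of_nat \<kappa> * pochhammer (of_nat (Suc \<kappa>)) m) * (1 / fact m) * rGamma (\<nu> + of_nat m + 1)
        * exp_int (\<nu> + of_nat (Suc \<kappa>) + of_nat m) \<sigma> 0"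
      unfolding Suc by simp
    then show ?thesis unfolding f g p e by (simp del: of_nat_Suc fact_Suc pochhammer_Suc add: mult_ac)
  qed
  finally show ?case using nz mult_left_cancel by blast
qed

text \<open>
  The function whose Laplace transform is the summand of the algebraic series, in the variables \<open>s = p + q\<close>,
  \<open>d = p - q\<close> and \<open>t = exp \<tau>\<close>: it equals
  \<open>exp (- (p\<^sup>2 + q\<^sup>2) * t / 2) * I\<^sub>\<nu> ((p\<^sup>2 - q\<^sup>2) * t / 2) / (p\<^sup>2 - q\<^sup>2) powr \<nu>\<close>.
\<close>

definition lap_kernel :: "complex \<Rightarrow> real \<Rightarrow> real \<Rightarrow> real \<Rightarrow> complex" where
  "lap_kernel \<nu> s d \<tau> = exp (\<nu> * of_real (\<tau> - ln 4)) * clifford \<nu> (of_real ((s * d * exp \<tau> / 4)\<^sup>2))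
      * of_real (exp (- ((s\<^sup>2 + d\<^sup>2) / 4 * exp \<tau>)))"

lemma lap_kernel_continuous: "continuous_on UNIV (lap_kernel \<nu> s d)"
  unfolding lap_kernel_def by (intro continuous_intros) auto

lemma lap_kernel_measurable [measurable]: "lap_kernel \<nu> s d \<in> borel_measurable borel"
  by (intro borel_measurable_continuous_onI lap_kernel_continuous)

text \<open>
  A rate of exponential decay in \<open>t\<close> that survives when the expansion of the kernel in powers of \<open>d\<^sup>2\<close> is
  replaced by absolute values.
\<close>

definition decay_rate :: "real \<Rightarrow> real \<Rightarrow> real" where
  "decay_rate s d = s\<^sup>2 / 4 - d\<^sup>2 / 4 - s * d / 2"

lemma lap_kernel_bound:
  assumes \<nu>: "Re \<nu> > 0" and s: "s > 0" "d \<ge> 0"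
  shows "norm (lap_kernel \<nu> s d \<tau>) \<le> norm (rGamma (\<nu> + 1)) * exp (- Re \<nu> * ln 4) * exp (Re \<nu> * \<tau> - decay_rate s d * exp \<tau>)"
proof -
  let ?x = "s * d * exp \<tau> / 4"
  have x: "?x \<ge> 0" using s by simp
  have sq: "(of_real (2 * x))\<^sup>2 / 4 = (of_real (x\<^sup>2) :: complex)" for x :: real
    by (simp add: power_mult_distrib)
  have "norm (clifford \<nu> (of_real (y\<^sup>2))) \<le> norm (rGamma (\<nu> + 1)) * exp (2 * y)" if "y \<ge> 0" for y :: real
    using clifford_exp_bound[of \<nu> "of_real (2 * y)"] \<nu> that unfolding sq by simp
  from this[OF x] have c: "norm (clifford \<nu> (of_real (?x\<^sup>2))) \<le> norm (rGamma (\<nu> + 1)) * exp (2 * ?x)" .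
  have "norm (lap_kernel \<nu> s d \<tau>) = exp (Re \<nu> * (\<tau> - ln 4)) * norm (clifford \<nu> (of_real (?x\<^sup>2))) * exp (- ((s\<^sup>2 + d\<^sup>2) / 4 * exp \<tau>))"
    unfolding lap_kernel_def norm_mult by simp
  also have "\<dots> \<le> exp (Re \<nu> * (\<tau> - ln 4)) * (norm (rGamma (\<nu> + 1)) * exp (2 * ?x)) * exp (- ((s\<^sup>2 + d\<^sup>2) / 4 * exp \<tau>))"
    by (intro mult_right_mono mult_left_mono c) auto
  also have "\<dots> = norm (rGamma (\<nu> + 1)) * exp (Re \<nu> * (\<tau> - ln 4) + 2 * ?x - (s\<^sup>2 + d\<^sup>2) / 4 * exp \<tau>)"
  proof -
    have "exp a * (M * exp b) * exp (- c) = M * exp (a + b - c)" for a b c M :: real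
      by (simp add: exp_add exp_diff exp_minus field_simps)
    then show ?thesis .
  qed
  also have "\<dots> \<le> norm (rGamma (\<nu> + 1)) * exp (- Re \<nu> * ln 4 + (Re \<nu> * \<tau> - decay_rate s d * exp \<tau>))"
  proof (intro mult_left_mono)
    have "d\<^sup>2 * exp \<tau> \<ge> 0" by simp
    then show "exp (Re \<nu> * (\<tau> - ln 4) + 2 * ?x - (s\<^sup>2 + d\<^sup>2) / 4 * exp \<tau>)
       \<le> exp (- Re \<nu> * ln 4 + (Re \<nu> * \<tau> - decay_rate s d * exp \<tau>))"
      by (simp add: decay_rate_def algebra_simps add_divide_distrib diff_divide_distrib)
  qed simp
  finally show ?thesis unfolding exp_add by (simp only: mult.assoc)
qed

text \<open>
  Cauchy product of the series of \<open>clifford \<nu> ((s * d * t / 4)\<^sup>2)\<close> and \<open>exp (- d\<^sup>2 * t / 4)\<close>, integrated term by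
  term: the coefficient of \<open>d ^ (2 * m)\<close> is a Laguerre polynomial in \<open>s\<^sup>2 * t / 4\<close>.
\<close>

lemma lap_kernel_expansion_sums:
  fixes \<nu> :: complex and s d A :: real
  assumes \<nu>: "Re \<nu> > 0" and s: "s > 0" "d \<ge> 0" "decay_rate s d > 0" and A: "A \<ge> 0"
  shows "(\<lambda>m. exp (- \<nu> * of_real (ln 4)) * of_real (d\<^sup>2 / 4) ^ m * laguerre_moment \<nu> (of_real (s\<^sup>2 / 4)) (of_real A) \<kappa> m)
     sums (\<integral>\<tau>. lap_kernel \<nu> s d \<tau> * of_real (exp (real \<kappa> * \<tau> - A * exp (- \<tau>))) \<partial>lborel)"
proof -
  define \<sigma> where "\<sigma> = s\<^sup>2 / 4"
  define E where "E = exp (- \<nu> * of_real (ln 4))"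
  define a where "a \<tau> k = (of_real ((s * d * exp \<tau> / 4)\<^sup>2)) ^ k / fact k * rGamma (\<nu> + of_nat k + 1)" for \<tau> k
  define b :: "real \<Rightarrow> nat \<Rightarrow> complex" where "b \<tau> j = of_real (- (d\<^sup>2 / 4 * exp \<tau>)) ^ j /\<^sub>R fact j" for \<tau> j
  define P where "P \<tau> = exp (\<nu> * of_real (\<tau> - ln 4)) * of_real (exp (- (s\<^sup>2 / 4 * exp \<tau>))) * of_real (exp (real \<kappa> * \<tau> - A * exp (- \<tau>)))" for \<tau>
  define h where "h m \<tau> = P \<tau> * (\<Sum>k\<le>m. a \<tau> k * b \<tau> (m - k))" for m \<tau>
  have \<sigma>: "\<sigma> > 0" using s by (simp add: \<sigma>_def)
  have na: "summable (\<lambda>k. norm (a \<tau> k))" for \<tau>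
    unfolding a_def by (rule clifford_summable_norm)
  have nb: "summable (\<lambda>j. norm (b \<tau> j))" for \<tau>
    unfolding b_def by (rule summable_norm_exp)
  have sa: "(\<Sum>k. a \<tau> k) = clifford \<nu> (of_real ((s * d * exp \<tau> / 4)\<^sup>2))" for \<tau>
    by (simp add: a_def clifford_def)
  have sb: "(\<Sum>j. b \<tau> j) = of_real (exp (- (d\<^sup>2 / 4 * exp \<tau>)))" for \<tau>
  proof -
    have "(\<Sum>j. of_real x ^ j /\<^sub>R fact j) = (of_real (exp x) :: complex)" for x :: real
      unfolding exp_of_real[symmetric] by (simp only: exp_def)
    then show ?thesis unfolding b_def .
  qed
  have hsums: "(\<lambda>m. h m \<tau>) sums (lap_kernel \<nu> s d \<tau> * of_real (exp (real \<kappa> * \<tau> - A * exp (- \<tau>))))" for \<tau>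
  proof -
    have "(\<lambda>m. \<Sum>k\<le>m. a \<tau> k * b \<tau> (m - k)) sums ((\<Sum>k. a \<tau> k) * (\<Sum>j. b \<tau> j))"
      by (rule Cauchy_product_sums[OF na nb])
    then have "(\<lambda>m. h m \<tau>) sums (P \<tau> * (clifford \<nu> (of_real ((s * d * exp \<tau> / 4)\<^sup>2)) * of_real (exp (- (d\<^sup>2 / 4 * exp \<tau>)))))"
      unfolding h_def sa sb by (rule sums_mult)
    also have "P \<tau> * (clifford \<nu> (of_real ((s * d * exp \<tau> / 4)\<^sup>2)) * of_real (exp (- (d\<^sup>2 / 4 * exp \<tau>))))
       = lap_kernel \<nu> s d \<tau> * of_real (exp (real \<kappa> * \<tau> - A * exp (- \<tau>)))"
    proof -
      have "exp (- ((s\<^sup>2 + d\<^sup>2) / 4 * exp \<tau>)) = exp (- (s\<^sup>2 / 4 * exp \<tau>)) * exp (- (d\<^sup>2 / 4 * exp \<tau>))"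
        by (simp add: algebra_simps add_divide_distrib flip: exp_add)
      then show ?thesis unfolding P_def lap_kernel_def by simp
    qed
    finally show ?thesis .
  qed
  have hek: "h m \<tau> = E * of_real (d\<^sup>2 / 4) ^ m * (\<Sum>k\<le>m. laguerre_coeff \<nu> m k * of_real \<sigma> ^ k
        * exp_ker (\<nu> + of_nat \<kappa> + of_nat m + of_nat k) (of_real \<sigma>) (of_real A) \<tau>)" for m \<tau>
  proof -
    have "P \<tau> * (a \<tau> k * b \<tau> (m - k)) = E * of_real (d\<^sup>2 / 4) ^ m * (laguerre_coeff \<nu> m k * of_real \<sigma> ^ k
        * exp_ker (\<nu> + of_nat \<kappa> + of_nat m + of_nat k) (of_real \<sigma>) (of_real A) \<tau>)" if "k \<le> m" for k
    proof -
      from le_Suc_ex[OF that] obtain j where m: "m = k + j" by (rule exE)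
      define x where "x = exp (of_real \<tau> :: complex)"
      have P: "P \<tau> = E * exp_ker (\<nu> + of_nat \<kappa>) (of_real \<sigma>) (of_real A) \<tau>"
        unfolding P_def E_def exp_ker_def \<sigma>_def
        unfolding exp_of_real[symmetric] mult_exp_exp by (simp add: algebra_simps exp_of_real exp_of_real[of "- \<tau>", unfolded of_real_minus])
      have e: "exp_ker (\<nu> + of_nat \<kappa> + of_nat m + of_nat k) (of_real \<sigma>) (of_real A) \<tau>
          = exp_ker (\<nu> + of_nat \<kappa>) (of_real \<sigma>) (of_real A) \<tau> * x ^ (m + k)"
        unfolding exp_ker_def x_def exp_of_nat_mult[symmetric] mult_exp_exp by (simp add: algebra_simps)
      have ab: "a \<tau> k * b \<tau> (m - k) = of_real (d\<^sup>2 / 4) ^ m * (laguerre_coeff \<nu> m k * of_real \<sigma> ^ k * x ^ (m + k))"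
      proof -
        have 1: "of_real ((s * d * exp \<tau> / 4)\<^sup>2) = of_real (d\<^sup>2 / 4) * of_real \<sigma> * x ^ 2"
          by (simp add: \<sigma>_def x_def power_mult_distrib power_divide exp_of_real)
        have 2: "of_real (- (d\<^sup>2 / 4 * exp \<tau>)) = (- 1) * of_real (d\<^sup>2 / 4) * x"
          by (simp add: x_def exp_of_real)
        define D where "D = (of_real (d\<^sup>2 / 4) :: complex)"
        define R where "R = rGamma (\<nu> + of_nat k + 1)"
        have mk: "m - k = j" using m by simp
        have b': "b \<tau> (m - k) = ((- 1) * D * x) ^ j / fact j"
          unfolding b_def 2 mk D_def by (simp add: scaleR_conv_of_real field_simps)
        have a': "a \<tau> k = (D * of_real \<sigma> * x ^ 2) ^ k / fact k * R"
          unfolding a_def 1 D_def R_def ..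
        have l: "laguerre_coeff \<nu> m k = (- 1) ^ j / (fact j * fact k) * R"
          using m by (simp add: laguerre_coeff_def R_def)
        have "x ^ (m + k) = (x ^ 2) ^ k * x ^ j" unfolding m by (simp add: power_add mult_2 flip: power_mult)
        moreover have "D ^ m = D ^ k * D ^ j" unfolding m by (rule power_add)
        ultimately show ?thesis unfolding a' b' l D_def[symmetric] power_mult_distrib by (simp add: mult_ac)
      qed
      show ?thesis unfolding P e ab by (simp only: mult_ac)
    qed
    then show ?thesis unfolding h_def sum_distrib_left by (intro sum.cong) auto
  qed
  have ekint: "integrable lborel (exp_ker (\<nu> + of_nat \<kappa> + of_nat m + of_nat k) (of_real \<sigma>) (of_real A))" for m k
    by (rule exp_ker_integrable) (use \<sigma> A \<nu> in auto)
  have hint: "integrable lborel (h m)" for m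
    unfolding hek by (intro integrable_mult_right Bochner_Integration.integrable_sum ekint)
  have hval: "(\<integral>\<tau>. h m \<tau> \<partial>lborel) = E * of_real (d\<^sup>2 / 4) ^ m * laguerre_moment \<nu> (of_real \<sigma>) (of_real A) \<kappa> m" for m
    unfolding hek laguerre_moment_def exp_int_def
    by (subst integral_mult_right_zero, subst Bochner_Integration.integral_sum) (auto intro!: integrable_mult_right ekint)
  define M where "M = norm (rGamma (\<nu> + 1)) * exp (- Re \<nu> * ln 4)"
  define w where "w \<tau> = M * exp ((Re \<nu> + real \<kappa>) * \<tau> - decay_rate s d * exp \<tau>)" for \<tau>
  have wint: "integrable lborel w"
    unfolding w_def by (intro integrable_mult_right exp_real_integrable_right) (use s \<nu> in auto)
  have bound: "norm (\<Sum>m<N. h m \<tau>) \<le> w \<tau>" for N \<tau>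
  proof -
    let ?x = "s * d * exp \<tau> / 4"
    have x: "?x \<ge> 0" using s by simp
    have nas: "(\<Sum>k. norm (a \<tau> k)) \<le> norm (rGamma (\<nu> + 1)) * exp (2 * ?x)"
    proof -
      have "norm (a \<tau> k) = (?x\<^sup>2) ^ k / fact k * norm (rGamma (\<nu> + of_nat k + 1))" for k
        unfolding a_def norm_mult norm_divide norm_power norm_of_real by simp
      then show ?thesis using clifford_majorant[of \<nu> ?x] \<nu> x by simp
    qed
    have nbs: "(\<Sum>k. norm (b \<tau> k)) = exp (d\<^sup>2 / 4 * exp \<tau>)"
    proof -
      define y where "y = d\<^sup>2 / 4 * exp \<tau>"
      have "norm (b \<tau> k) = y ^ k /\<^sub>R fact k" for k
        unfolding b_def norm_scaleR norm_power norm_of_real y_def[symmetric] by (simp add: y_def)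
      then have "(\<Sum>k. norm (b \<tau> k)) = exp y" by (simp only: exp_def)
      then show ?thesis by (simp only: y_def)
    qed
    have "norm (\<Sum>m<N. \<Sum>k\<le>m. a \<tau> k * b \<tau> (m - k)) \<le> (\<Sum>m<N. \<Sum>k\<le>m. norm (a \<tau> k) * norm (b \<tau> (m - k)))"
      by (intro order_trans[OF norm_sum] sum_mono) (simp add: norm_mult)
    also have "\<dots> \<le> (\<Sum>m. \<Sum>k\<le>m. norm (a \<tau> k) * norm (b \<tau> (m - k)))"
    proof (rule sum_le_suminf)
      show "summable (\<lambda>m. \<Sum>k\<le>m. norm (a \<tau> k) * norm (b \<tau> (m - k)))"
        using Cauchy_product_sums[of "\<lambda>k. norm (a \<tau> k)" "\<lambda>k. norm (b \<tau> k)"] na nb by (simp add: sums_iff)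
    qed (auto intro!: sum_nonneg)
    also have "\<dots> = (\<Sum>k. norm (a \<tau> k)) * (\<Sum>k. norm (b \<tau> k))"
      using Cauchy_product_sums[of "\<lambda>k. norm (a \<tau> k)" "\<lambda>k. norm (b \<tau> k)"] na nb by (simp add: sums_iff)
    also have "\<dots> \<le> norm (rGamma (\<nu> + 1)) * exp (2 * ?x) * exp (d\<^sup>2 / 4 * exp \<tau>)"
      unfolding nbs by (intro mult_right_mono nas) simp
    finally have 1: "norm (\<Sum>m<N. \<Sum>k\<le>m. a \<tau> k * b \<tau> (m - k)) \<le> norm (rGamma (\<nu> + 1)) * exp (2 * ?x) * exp (d\<^sup>2 / 4 * exp \<tau>)" .
    have "A * exp (- \<tau>) \<ge> 0" using A by simp
    then have 2: "norm (P \<tau>) \<le> exp (Re \<nu> * (\<tau> - ln 4) - s\<^sup>2 / 4 * exp \<tau> + real \<kappa> * \<tau>)"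
      unfolding P_def norm_mult by (simp flip: exp_add)
    have "norm (\<Sum>m<N. h m \<tau>) = norm (P \<tau>) * norm (\<Sum>m<N. \<Sum>k\<le>m. a \<tau> k * b \<tau> (m - k))"
      unfolding h_def sum_distrib_left[symmetric] norm_mult ..
    also have "\<dots> \<le> exp (Re \<nu> * (\<tau> - ln 4) - s\<^sup>2 / 4 * exp \<tau> + real \<kappa> * \<tau>) *
        (norm (rGamma (\<nu> + 1)) * exp (2 * ?x) * exp (d\<^sup>2 / 4 * exp \<tau>))"
      by (intro mult_mono 1 2) auto
    also have "\<dots> = norm (rGamma (\<nu> + 1)) * exp (- Re \<nu> * ln 4 + ((Re \<nu> + real \<kappa>) * \<tau> - decay_rate s d * exp \<tau>))"
      by (simp add: decay_rate_def algebra_simps add_divide_distrib diff_divide_distrib flip: exp_add)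
    finally show ?thesis unfolding w_def M_def exp_add by (simp only: mult.assoc)
  qed
  have "(\<lambda>N. \<integral>\<tau>. (\<Sum>m<N. h m \<tau>) \<partial>lborel) \<longlonglongrightarrow> (\<integral>\<tau>. lap_kernel \<nu> s d \<tau> * of_real (exp (real \<kappa> * \<tau> - A * exp (- \<tau>))) \<partial>lborel)"
  proof (rule integral_dominated_convergence[where w = w])
    show "(\<lambda>\<tau>. \<Sum>m<N. h m \<tau>) \<in> borel_measurable lborel" for N
      using hint by (intro borel_measurable_sum borel_measurable_integrable) auto
    show "AE \<tau> in lborel. (\<lambda>N. \<Sum>m<N. h m \<tau>) \<longlonglongrightarrow> lap_kernel \<nu> s d \<tau> * of_real (exp (real \<kappa> * \<tau> - A * exp (- \<tau>)))"
      using hsums by (auto simp: sums_def)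
    show "AE \<tau> in lborel. norm (\<Sum>m<N. h m \<tau>) \<le> w \<tau>" for N
      using bound by auto
  qed (auto intro: wint)
  moreover have "(\<integral>\<tau>. (\<Sum>m<N. h m \<tau>) \<partial>lborel) = (\<Sum>m<N. E * of_real (d\<^sup>2 / 4) ^ m * laguerre_moment \<nu> (of_real \<sigma>) (of_real A) \<kappa> m)" for N
    by (subst Bochner_Integration.integral_sum) (auto simp: hint hval)
  ultimately show ?thesis unfolding sums_def E_def \<sigma>_def by simp
qed

text \<open>
  By \<open>laguerre_moment_0\<close> the series is the one of \<open>clifford\<close>, multiplied by a single exponential integral.
\<close>

lemma lap_kernel_integral_exp:
  assumes \<nu>: "Re \<nu> > 0" and s: "s > 0" "d \<ge> 0" "decay_rate s d > 0" and A: "A \<ge> 0"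
  shows "(\<integral>\<tau>. lap_kernel \<nu> s d \<tau> * of_real (exp (- A * exp (- \<tau>))) \<partial>lborel)
     = exp (- \<nu> * of_real (ln 4)) * clifford \<nu> (of_real (d\<^sup>2 * A / 4)) * exp_int \<nu> (of_real (s\<^sup>2 / 4)) (of_real A)"
proof -
  have "(\<lambda>m. (of_real (d\<^sup>2 * A / 4)) ^ m / fact m * rGamma (\<nu> + of_nat m + 1)
       * (exp (- \<nu> * of_real (ln 4)) * exp_int \<nu> (of_real (s\<^sup>2 / 4)) (of_real A)))
     sums (clifford \<nu> (of_real (d\<^sup>2 * A / 4)) * (exp (- \<nu> * of_real (ln 4)) * exp_int \<nu> (of_real (s\<^sup>2 / 4)) (of_real A)))"
    by (intro sums_mult2 clifford_sums)
  moreover have "(of_real (d\<^sup>2 * A / 4)) ^ m / fact m * rGamma (\<nu> + of_nat m + 1)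
       * (exp (- \<nu> * of_real (ln 4)) * exp_int \<nu> (of_real (s\<^sup>2 / 4)) (of_real A))
     = exp (- \<nu> * of_real (ln 4)) * of_real (d\<^sup>2 / 4) ^ m * laguerre_moment \<nu> (of_real (s\<^sup>2 / 4)) (of_real A) 0 m" for m
  proof -
    have "laguerre_moment \<nu> (of_real (s\<^sup>2 / 4)) (of_real A) 0 m
      = of_real A ^ m / fact m * rGamma (\<nu> + of_nat m + 1) * exp_int \<nu> (of_real (s\<^sup>2 / 4)) (of_real A)"
      by (rule laguerre_moment_0) (use s A \<nu> in auto)
    moreover have "of_real (d\<^sup>2 * A / 4) = of_real (d\<^sup>2 / 4) * (of_real A :: complex)" by simp
    ultimately show ?thesis by (simp only: power_mult_distrib) (simp add: mult_ac)
  qed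
  ultimately have "(\<lambda>m. exp (- \<nu> * of_real (ln 4)) * of_real (d\<^sup>2 / 4) ^ m * laguerre_moment \<nu> (of_real (s\<^sup>2 / 4)) (of_real A) 0 m)
     sums (clifford \<nu> (of_real (d\<^sup>2 * A / 4)) * (exp (- \<nu> * of_real (ln 4)) * exp_int \<nu> (of_real (s\<^sup>2 / 4)) (of_real A)))"
    by (simp only:)
  from sums_unique2[OF this lap_kernel_expansion_sums[OF assms, of 0]] show ?thesis by (simp add: mult_ac)
qed

lemma of_real_powr_exp:
  assumes "y > (0::real)"
  shows "(of_real y :: complex) powr z = exp (z * of_real (ln y))"
  using assms by (simp add: powr_def Ln_of_real)

lemma four_powr:
  assumes "s > (0::real)"
  shows "exp (- \<nu> * of_real (ln 4)) * of_real (s\<^sup>2 / 4) powr (- \<nu>) = (1 / of_real s powr (2 * \<nu>) :: complex)"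
proof -
  have "s\<^sup>2 / 4 > 0" using assms by simp
  then have "exp (- \<nu> * of_real (ln 4)) * of_real (s\<^sup>2 / 4) powr (- \<nu>) = exp (- \<nu> * of_real (ln 4 + ln (s\<^sup>2 / 4)))"
    by (simp only: of_real_powr_exp mult_exp_exp of_real_add ring_distribs)
  also have "ln 4 + ln (s\<^sup>2 / 4) = 2 * ln s" using assms by (simp add: ln_div ln_realpow)
  also have "exp (- \<nu> * of_real (2 * ln s)) = 1 / of_real s powr (2 * \<nu>)"
    unfolding of_real_powr_exp[OF assms] by (simp add: exp_minus divide_inverse mult_ac)
  finally show ?thesis .
qed

text \<open>
  Macdonald's integral appears after the translation that makes the two exponential rates equal.
\<close>

lemma lap_kernel_integral_K:
  assumes \<nu>: "Re \<nu> > 0" and s: "s > 0" "d \<ge> 0" "decay_rate s d > 0" and x: "x > 0"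
  shows "(\<integral>\<tau>. lap_kernel \<nu> s d \<tau> * of_real (exp (- x\<^sup>2 * exp (- \<tau>))) \<partial>lborel)
     = 2 * (of_real (x / 2)) powr \<nu> * clifford \<nu> (of_real ((d * x)\<^sup>2 / 4)) * of_real s powr (- \<nu>) * macdonald \<nu> (of_real (s * x))"
proof -
  define h where "h = ln (2 * x / s)"
  have eh: "exp h = 2 * x / s" using x s by (simp add: h_def)
  have "exp_int \<nu> (of_real (s\<^sup>2 / 4)) (of_real (x\<^sup>2)) = exp (\<nu> * of_real h) *
     exp_int \<nu> (of_real (s\<^sup>2 / 4) * of_real (exp h)) (of_real (x\<^sup>2) * of_real (exp (- h)))"
    by (rule exp_int_translate)
  also have "of_real (s\<^sup>2 / 4) * of_real (exp h) = (of_real (s * x) / 2 :: complex)"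
    unfolding eh using s by (simp add: power2_eq_square)
  also have "of_real (x\<^sup>2) * of_real (exp (- h)) = (of_real (s * x) / 2 :: complex)"
    unfolding exp_minus eh using s x by (simp add: power2_eq_square)
  finally have e: "exp_int \<nu> (of_real (s\<^sup>2 / 4)) (of_real (x\<^sup>2)) = exp (\<nu> * of_real h) * (2 * macdonald \<nu> (of_real (s * x)))"
    by (simp add: macdonald_def)
  have "exp (- \<nu> * of_real (ln 4)) * exp (\<nu> * of_real h) = exp (\<nu> * of_real (h - ln 4))"
    by (simp add: algebra_simps flip: exp_add)
  also have "h - ln 4 = ln (x / 2) - ln s"
  proof -
    have "ln 4 = ln 2 + ln (2::real)" using ln_mult[of 2 "2::real"] by simp
    then show ?thesis using x s by (simp add: h_def ln_div ln_mult)
  qed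
  also have "exp (\<nu> * of_real (ln (x / 2) - ln s)) = (of_real (x / 2)) powr \<nu> * of_real s powr (- \<nu>)"
  proof -
    have "x / 2 > 0" using x by simp
    then show ?thesis using s
      by (simp only: of_real_powr_exp mult_exp_exp of_real_diff) (simp add: algebra_simps)
  qed
  finally have p: "exp (- \<nu> * of_real (ln 4)) * exp (\<nu> * of_real h) = (of_real (x / 2)) powr \<nu> * of_real s powr (- \<nu>)" .
  have "(\<integral>\<tau>. lap_kernel \<nu> s d \<tau> * of_real (exp (- x\<^sup>2 * exp (- \<tau>))) \<partial>lborel)
     = (exp (- \<nu> * of_real (ln 4)) * exp (\<nu> * of_real h)) * (clifford \<nu> (of_real (d\<^sup>2 * x\<^sup>2 / 4)) * (2 * macdonald \<nu> (of_real (s * x))))"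
    using lap_kernel_integral_exp[OF \<nu> s, of "x\<^sup>2"] unfolding e by (simp add: mult_ac)
  then show ?thesis unfolding p by (simp add: power_mult_distrib mult_ac)
qed

lemma lap_kernel_integral_0:
  assumes \<nu>: "Re \<nu> > 0" and s: "s > 0" "d \<ge> 0" "decay_rate s d > 0"
  shows "(\<integral>\<tau>. lap_kernel \<nu> s d \<tau> \<partial>lborel) = 1 / (\<nu> * of_real s powr (2 * \<nu>))"
proof -
  have np: "\<nu> \<notin> \<int>\<^sub>\<le>\<^sub>0" "\<nu> + 1 \<notin> \<int>\<^sub>\<le>\<^sub>0" using \<nu> by (auto elim!: nonpos_Ints_cases' simp: complex_eq_iff)
  have nz: "\<nu> \<noteq> 0" using \<nu> by auto
  have "(\<integral>\<tau>. lap_kernel \<nu> s d \<tau> \<partial>lborel) = exp (- \<nu> * of_real (ln 4)) * clifford \<nu> 0 * exp_int \<nu> (of_real (s\<^sup>2 / 4)) 0"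
    using lap_kernel_integral_exp[OF assms, of 0] by simp
  also have "\<dots> = exp (- \<nu> * of_real (ln 4)) * rGamma (\<nu> + 1) * (Gamma \<nu> * of_real (s\<^sup>2 / 4) powr (- \<nu>))"
    using exp_int_Gamma[OF \<nu>, of "s\<^sup>2 / 4"] s by (simp add: clifford_0)
  also have "rGamma (\<nu> + 1) = rGamma \<nu> / \<nu>" using rGamma_plus1[of \<nu>] nz by (simp add: field_simps)
  also have "exp (- \<nu> * of_real (ln 4)) * (rGamma \<nu> / \<nu>) * (Gamma \<nu> * of_real (s\<^sup>2 / 4) powr (- \<nu>))
      = (rGamma \<nu> * Gamma \<nu>) * (exp (- \<nu> * of_real (ln 4)) * of_real (s\<^sup>2 / 4) powr (- \<nu>)) / \<nu>"
    by simp
  also have "rGamma \<nu> * Gamma \<nu> = 1" using np by (simp add: rGamma_inverse_Gamma Gamma_eq_zero_iff)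
  also have "exp (- \<nu> * of_real (ln 4)) * of_real (s\<^sup>2 / 4) powr (- \<nu>) = 1 / of_real s powr (2 * \<nu>)"
    by (rule four_powr[OF s(1)])
  finally show ?thesis by simp
qed

text \<open>
  By \<open>laguerre_moment_Laplace\<close> the Gamma factors cancel and the series is geometric with ratio \<open>d\<^sup>2 / s\<^sup>2\<close>.
\<close>

lemma lap_kernel_integral_Laplace:
  assumes \<nu>: "Re \<nu> > 0" and s: "s > 0" "d \<ge> 0" "decay_rate s d > 0"
  shows "(\<integral>\<tau>. lap_kernel \<nu> s d \<tau> * of_real (exp \<tau>) \<partial>lborel) = 4 / (of_real (s\<^sup>2 - d\<^sup>2) * of_real s powr (2 * \<nu>))"
proof -
  define E where "E = exp (- \<nu> * of_real (ln 4))"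
  define \<sigma> where "\<sigma> = s\<^sup>2 / 4"
  have \<sigma>: "\<sigma> > 0" using s by (simp add: \<sigma>_def)
  have ds: "d\<^sup>2 < s\<^sup>2"
  proof -
    have "s * d \<ge> 0" using s by simp
    then show ?thesis using s(3) unfolding decay_rate_def by linarith
  qed
  have W: "laguerre_moment \<nu> (of_real \<sigma>) (of_real 0) 1 m = of_real \<sigma> powr (- \<nu>) * of_real (1 / \<sigma>) ^ Suc m" for m
  proof -
    define \<mu> where "\<mu> = \<nu> + of_nat m + 1"
    have \<mu>: "Re \<mu> > 0" using \<nu> by (simp add: \<mu>_def)
    have np: "\<mu> \<notin> \<int>\<^sub>\<le>\<^sub>0" using \<mu> by (auto elim!: nonpos_Ints_cases')
    have "laguerre_moment \<nu> (of_real \<sigma>) (of_real 0) 1 m = pochhammer 1 m / fact m * rGamma (\<nu> + of_nat m + 1) * exp_int (\<nu> + of_nat 1 + of_nat m) (of_real \<sigma>) 0"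
      using laguerre_moment_Laplace[of "of_real \<sigma>" \<nu> 1 m] \<sigma> \<nu> by simp
    also have "pochhammer 1 m / fact m = (1 :: complex)" by (simp add: pochhammer_fact[symmetric])
    also have "\<nu> + of_nat 1 + of_nat m = \<mu>" by (simp add: \<mu>_def)
    also have "exp_int \<mu> (of_real \<sigma>) 0 = Gamma \<mu> * of_real \<sigma> powr (- \<mu>)" by (rule exp_int_Gamma[OF \<mu> \<sigma>])
    also have "1 * rGamma (\<nu> + of_nat m + 1) * (Gamma \<mu> * of_real \<sigma> powr (- \<mu>)) = of_real \<sigma> powr (- \<mu>)"
      using np by (simp add: \<mu>_def[symmetric] rGamma_inverse_Gamma Gamma_eq_zero_iff)
    also have "of_real \<sigma> powr (- \<mu>) = of_real \<sigma> powr (- \<nu>) * of_real \<sigma> powr (- of_nat (Suc m))"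
      by (simp add: \<mu>_def algebra_simps flip: powr_add)
    also have "of_real \<sigma> powr (- of_nat (Suc m)) = (of_real (1 / \<sigma>) :: complex) ^ Suc m"
      unfolding powr_minus using \<sigma> by (subst powr_nat') (auto simp: power_divide divide_inverse power_inverse)
    finally show ?thesis .
  qed
  define r where "r = d\<^sup>2 / s\<^sup>2"
  have r: "0 \<le> r" "r < 1" using ds s by (auto simp: r_def)
  have S1: "(\<lambda>m. E * of_real (d\<^sup>2 / 4) ^ m * laguerre_moment \<nu> (of_real \<sigma>) (of_real 0) 1 m)
     sums (\<integral>\<tau>. lap_kernel \<nu> s d \<tau> * of_real (exp (real 1 * \<tau> - 0 * exp (- \<tau>))) \<partial>lborel)"
    unfolding E_def \<sigma>_def by (rule lap_kernel_expansion_sums) (use assms in auto)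
  have S2: "E * of_real (d\<^sup>2 / 4) ^ m * laguerre_moment \<nu> (of_real \<sigma>) (of_real 0) 1 m
      = (E * of_real \<sigma> powr (- \<nu>) * of_real (1 / \<sigma>)) * of_real r ^ m" for m
  proof -
    have "of_real r = (of_real (d\<^sup>2 / 4) * of_real (1 / \<sigma>) :: complex)" using s by (simp add: r_def \<sigma>_def)
    then show ?thesis unfolding W by (simp only: power_mult_distrib power_Suc mult_ac)
  qed
  have S3: "(\<lambda>m. (E * of_real \<sigma> powr (- \<nu>) * of_real (1 / \<sigma>)) * of_real r ^ m)
      sums ((E * of_real \<sigma> powr (- \<nu>) * of_real (1 / \<sigma>)) * (1 / (1 - of_real r)))"
    by (intro sums_mult geometric_sums) (use r in simp)
  have "(\<integral>\<tau>. lap_kernel \<nu> s d \<tau> * of_real (exp \<tau>) \<partial>lborel) = (E * of_real \<sigma> powr (- \<nu>) * of_real (1 / \<sigma>)) * (1 / (1 - of_real r))"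
    using sums_unique2[OF S1[unfolded S2] S3] by (simp only: of_nat_1 mult_1 mult_zero_left diff_0_right)
  also have "E * of_real \<sigma> powr (- \<nu>) = 1 / of_real s powr (2 * \<nu>)"
    unfolding E_def \<sigma>_def by (rule four_powr[OF s(1)])
  also have "1 / of_real s powr (2 * \<nu>) * of_real (1 / \<sigma>) * (1 / (1 - of_real r)) = of_real (1 / \<sigma> * (1 / (1 - r))) / of_real s powr (2 * \<nu>)"
    by simp
  also have "1 / \<sigma> * (1 / (1 - r)) = 4 / (s\<^sup>2 - d\<^sup>2)" using s ds by (simp add: \<sigma>_def r_def field_simps)
  finally show ?thesis by simp
qed

section \<open>The identity for positive parameters\<close>

definition sqrt_term :: "complex \<Rightarrow> complex \<Rightarrow> complex \<Rightarrow> nat \<Rightarrow> complex" where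
  "sqrt_term \<nu> p q n = 1 / (csqrt (of_nat n + p\<^sup>2) * csqrt (of_nat n + q\<^sup>2)
     * (csqrt (of_nat n + p\<^sup>2) + csqrt (of_nat n + q\<^sup>2)) powr (2 * \<nu>))"

text \<open>
  The product of \<open>I\<^sub>\<nu>\<close> and \<open>K\<^sub>\<nu>\<close> in the \<open>n\<close>-th summand, divided by \<open>(p\<^sup>2 - q\<^sup>2) powr \<nu>\<close>, in a form
  that is holomorphic across \<open>p = q\<close>.
\<close>

definition bessel_term :: "complex \<Rightarrow> complex \<Rightarrow> complex \<Rightarrow> nat \<Rightarrow> complex" where
  "bessel_term \<nu> p q n = of_real (pi * sqrt (real n) / 2) powr \<nu> * clifford \<nu> ((of_real (pi * sqrt (real n)) * (p - q))\<^sup>2 / 4)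
     * (p + q) powr (- \<nu>) * macdonald \<nu> (of_real (pi * sqrt (real n)) * (p + q))"

text \<open>
  Term-by-term integration when the summands are non-negative multiples of one function \<open>L\<close>.
\<close>

lemma integral_series:
  fixes L :: "real \<Rightarrow> complex" and c :: "nat \<Rightarrow> real \<Rightarrow> real"
  assumes [measurable]: "L \<in> borel_measurable borel" "\<And>n. c n \<in> borel_measurable borel" "C \<in> borel_measurable borel"
    and c: "\<And>n \<tau>. c n \<tau> \<ge> 0" "\<And>\<tau>. (\<lambda>n. c n \<tau>) sums C \<tau>"
    and w: "integrable lborel w" "\<And>\<tau>. norm (L \<tau>) * C \<tau> \<le> w \<tau>"
  shows "(\<lambda>n. \<integral>\<tau>. L \<tau> * of_real (c n \<tau>) \<partial>lborel) sums (\<integral>\<tau>. L \<tau> * of_real (C \<tau>) \<partial>lborel)"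
proof -
  have partial: "(\<Sum>n<N. c n \<tau>) \<le> C \<tau>" for N \<tau>
    using sum_le_suminf[of "\<lambda>n. c n \<tau>" "{..<N}"] c by (auto simp: sums_iff)
  have single: "c n \<tau> \<le> C \<tau>" for n \<tau>
    using sum_le_suminf[of "\<lambda>n. c n \<tau>" "{n}"] c by (auto simp: sums_iff)
  have int: "integrable lborel (\<lambda>\<tau>. L \<tau> * of_real (c n \<tau>))" for n
  proof (rule Bochner_Integration.integrable_bound[OF w(1)])
    show "AE \<tau> in lborel. norm (L \<tau> * of_real (c n \<tau>)) \<le> norm (w \<tau>)"
    proof (rule AE_I2)
      fix \<tau>
      have "norm (L \<tau> * of_real (c n \<tau>)) \<le> norm (L \<tau>) * C \<tau>"
        using c(1)[of n \<tau>] single[of n \<tau>] by (simp add: norm_mult mult_left_mono)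
      also have "\<dots> \<le> w \<tau>" by (rule w)
      finally show "norm (L \<tau> * of_real (c n \<tau>)) \<le> norm (w \<tau>)" by simp
    qed
  qed measurable
  have "(\<lambda>N. \<integral>\<tau>. (\<Sum>n<N. L \<tau> * of_real (c n \<tau>)) \<partial>lborel) \<longlonglongrightarrow> (\<integral>\<tau>. L \<tau> * of_real (C \<tau>) \<partial>lborel)"
  proof (rule integral_dominated_convergence[where w = w])
    show "AE \<tau> in lborel. (\<lambda>N. \<Sum>n<N. L \<tau> * of_real (c n \<tau>)) \<longlonglongrightarrow> L \<tau> * of_real (C \<tau>)"
    proof (rule AE_I2)
      fix \<tau>
      have "(\<lambda>n. L \<tau> * of_real (c n \<tau>)) sums (L \<tau> * of_real (C \<tau>))"
        by (intro sums_mult sums_of_real c)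
      then show "(\<lambda>N. \<Sum>n<N. L \<tau> * of_real (c n \<tau>)) \<longlonglongrightarrow> L \<tau> * of_real (C \<tau>)" by (simp add: sums_def)
    qed
    show "AE \<tau> in lborel. norm (\<Sum>n<N. L \<tau> * of_real (c n \<tau>)) \<le> w \<tau>" for N
    proof (rule AE_I2)
      fix \<tau>
      have "norm (\<Sum>n<N. L \<tau> * of_real (c n \<tau>)) = norm (L \<tau>) * (\<Sum>n<N. c n \<tau>)"
        using c(1) by (simp add: sum_distrib_left[symmetric] norm_mult sum_nonneg flip: of_real_sum)
      also have "\<dots> \<le> norm (L \<tau>) * C \<tau>" by (intro mult_left_mono partial) simp
      also have "\<dots> \<le> w \<tau>" by (rule w)
      finally show "norm (\<Sum>n<N. L \<tau> * of_real (c n \<tau>)) \<le> w \<tau>" .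
    qed
  qed (use w in measurable)
  then show ?thesis unfolding sums_def by (subst (asm) Bochner_Integration.integral_sum) (auto intro: int)
qed

lemma theta2_measurable: "(\<lambda>x. theta2 (exp (x::real))) \<in> borel_measurable borel"
proof -
  have "(\<lambda>x::real. (\<Sum>n. real (r2 n) * exp (- real n * exp x))) \<in> borel_measurable borel"
    by measurable
  moreover have "(\<Sum>n. real (r2 n) * exp (- real n * exp x)) = theta2 (exp x)" for x :: real
    using theta2_sums[of "exp x"] by (simp add: sums_iff)
  ultimately show ?thesis by (simp only:)
qed

text \<open>
  Adding \<open>x\<close> to both \<open>p\<^sup>2\<close> and \<open>q\<^sup>2\<close> multiplies the kernel by \<open>exp (- x * t)\<close>.
\<close>

lemma lap_kernel_shift:
  assumes "S * D = s * d" "S\<^sup>2 + D\<^sup>2 = s\<^sup>2 + d\<^sup>2 + 4 * x"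
  shows "lap_kernel \<nu> S D \<tau> = lap_kernel \<nu> s d \<tau> * of_real (exp (- x * exp \<tau>))"
proof -
  have "- ((S\<^sup>2 + D\<^sup>2) / 4 * exp \<tau>) = - ((s\<^sup>2 + d\<^sup>2) / 4 * exp \<tau>) + - x * exp \<tau>"
    unfolding assms(2) by (simp add: algebra_simps add_divide_distrib)
  then show ?thesis unfolding lap_kernel_def assms(1) by (simp only: exp_add of_real_mult mult.assoc)
qed

text \<open>
  Both series are expansions of the integral of the kernel against \<open>exp \<tau> * theta2 (exp \<tau>)\<close>: the first through
  the definition of \<open>theta2\<close>, the second through its inversion formula.
\<close>

lemma real_identity:
  fixes p q :: real
  assumes \<nu>: "Re \<nu> > 0" and q: "q > 0" "q \<le> p" and small: "decay_rate (p + q) (p - q) > 0"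
  shows "\<exists>I. (\<lambda>n. of_nat (r2 n) * sqrt_term \<nu> (of_real p) (of_real q) n) sums I \<and>
    (\<lambda>n. of_nat (r2 n) * (if n = 0 then of_real pi / (\<nu> * (of_real p + of_real q) powr (2 * \<nu>))
        else 2 * of_real pi * bessel_term \<nu> (of_real p) (of_real q) n)) sums I"
proof -
  define s d where "s = p + q" and "d = p - q"
  define L where "L = lap_kernel \<nu> s d"
  define M where "M = norm (rGamma (\<nu> + 1)) * exp (- Re \<nu> * ln 4)"
  define C where "C \<tau> = exp \<tau> * theta2 (exp \<tau>)" for \<tau>
  define w where "w \<tau> = M * theta2 pi * (exp ((Re \<nu> + 1) * \<tau> - decay_rate s d * exp \<tau>) + pi * exp (Re \<nu> * \<tau> - decay_rate s d * exp \<tau>))" for \<tau>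
  have s: "s > 0" "d \<ge> 0" "decay_rate s d > 0" using q small by (auto simp: s_def d_def)
  have M: "M \<ge> 0" by (simp add: M_def)
  have Lm [measurable]: "L \<in> borel_measurable borel" unfolding L_def by measurable
  have Cm [measurable]: "C \<in> borel_measurable borel"
    unfolding C_def using theta2_measurable by measurable
  have wint: "integrable lborel w"
    unfolding w_def by (intro integrable_mult_right Bochner_Integration.integrable_add exp_real_integrable_right) (use s \<nu> in auto)
  have LC: "norm (L \<tau>) * C \<tau> \<le> w \<tau>" for \<tau>
  proof -
    have "norm (L \<tau>) \<le> M * exp (Re \<nu> * \<tau> - decay_rate s d * exp \<tau>)"
      unfolding L_def M_def by (rule lap_kernel_bound[OF \<nu> s(1,2)])
    moreover have "C \<tau> \<le> exp \<tau> * (theta2 pi * (1 + pi / exp \<tau>))"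
      unfolding C_def by (intro mult_left_mono theta2_bound) auto
    ultimately have "norm (L \<tau>) * C \<tau> \<le> (M * exp (Re \<nu> * \<tau> - decay_rate s d * exp \<tau>)) * (exp \<tau> * (theta2 pi * (1 + pi / exp \<tau>)))"
      by (intro mult_mono) (auto simp: C_def theta2_nonneg M)
    also have "\<dots> = w \<tau>"
      by (simp add: w_def algebra_simps exp_add exp_diff add_divide_distrib)
    finally show ?thesis .
  qed
  define I where "I = (\<integral>\<tau>. L \<tau> * of_real (C \<tau>) \<partial>lborel)"
  have "(\<lambda>n. \<integral>\<tau>. L \<tau> * of_real (real (r2 n) * (exp \<tau> * exp (- real n * exp \<tau>))) \<partial>lborel) sums I"
    unfolding I_def
  proof (rule integral_series[OF _ _ _ _ _ wint LC])
    show "(\<lambda>n. real (r2 n) * (exp \<tau> * exp (- real n * exp \<tau>))) sums C \<tau>" for \<tau>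
      using sums_mult[OF theta2_sums[of "exp \<tau>"], of "exp \<tau>"] by (simp add: C_def mult_ac)
  qed auto
  moreover have "(\<integral>\<tau>. L \<tau> * of_real (real (r2 n) * (exp \<tau> * exp (- real n * exp \<tau>))) \<partial>lborel)
      = of_nat (r2 n) * sqrt_term \<nu> (of_real p) (of_real q) n" for n
  proof -
    \<comment> \<open>The summand of index \<open>n\<close> is the kernel integral for the shifted parameters \<open>P\<close>, \<open>Q\<close>; their decay
    rate is at least that of \<open>p\<close>, \<open>q\<close>.\<close>
    define P Q where "P = sqrt (real n + p\<^sup>2)" and "Q = sqrt (real n + q\<^sup>2)"
    have PQ: "Q > 0" "Q \<le> P" "P\<^sup>2 = real n + p\<^sup>2" "Q\<^sup>2 = real n + q\<^sup>2"
      using q by (auto simp: P_def Q_def intro!: add_nonneg_pos power_mono)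
    have SD: "(P + Q) * (P - Q) = s * d"
      using PQ by (simp add: s_def d_def algebra_simps power2_eq_square)
    have SD2: "(P + Q)\<^sup>2 + (P - Q)\<^sup>2 = s\<^sup>2 + d\<^sup>2 + 4 * real n"
    proof -
      have "(P + Q)\<^sup>2 + (P - Q)\<^sup>2 = 2 * P\<^sup>2 + 2 * Q\<^sup>2" by (simp add: power2_eq_square algebra_simps)
      also have "\<dots> = s\<^sup>2 + d\<^sup>2 + 4 * real n" unfolding PQ s_def d_def by (simp add: power2_eq_square algebra_simps)
      finally show ?thesis .
    qed
    have ps: "p \<le> P" "q \<le> Q" unfolding P_def Q_def by (intro real_le_rsqrt; simp)+
    have dD: "P - Q \<le> d"
    proof -
      have "s * (P - Q) \<le> (P + Q) * (P - Q)" using ps PQ by (intro mult_right_mono) (auto simp: s_def)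
      then show ?thesis unfolding SD using s by simp
    qed
    have "decay_rate (P + Q) (P - Q) > 0"
    proof -
      have "(P - Q)\<^sup>2 \<le> d\<^sup>2" using dD PQ by (intro power_mono) auto
      moreover have "s\<^sup>2 \<le> (P + Q)\<^sup>2" using ps s q by (intro power_mono) (auto simp: s_def)
      ultimately show ?thesis using s(3) SD unfolding decay_rate_def by linarith
    qed
    then have "(\<integral>\<tau>. lap_kernel \<nu> (P + Q) (P - Q) \<tau> * of_real (exp \<tau>) \<partial>lborel)
        = 4 / (of_real ((P + Q)\<^sup>2 - (P - Q)\<^sup>2) * of_real (P + Q) powr (2 * \<nu>))"
      using PQ by (intro lap_kernel_integral_Laplace[OF \<nu>]) auto
    also have "(P + Q)\<^sup>2 - (P - Q)\<^sup>2 = 4 * (P * Q)" by (simp add: power2_eq_square algebra_simps)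
    also have "4 / (of_real (4 * (P * Q)) * of_real (P + Q) powr (2 * \<nu>)) = sqrt_term \<nu> (of_real p) (of_real q) n"
    proof -
      have "csqrt (of_nat n + (of_real x)\<^sup>2) = of_real (sqrt (real n + x\<^sup>2))" for x :: real
      proof -
        have "of_nat n + (of_real x)\<^sup>2 = (of_real (real n + x\<^sup>2) :: complex)" by simp
        then show ?thesis by (simp only: csqrt_of_real_nonneg) (simp add: csqrt_of_real_nonneg)
      qed
      then have "csqrt (of_nat n + (of_real p)\<^sup>2) = of_real P" "csqrt (of_nat n + (of_real q)\<^sup>2) = of_real Q"
        by (simp_all add: P_def Q_def)
      then show ?thesis by (simp add: sqrt_term_def)
    qed
    finally have "(\<integral>\<tau>. L \<tau> * of_real (exp (- real n * exp \<tau>)) * of_real (exp \<tau>) \<partial>lborel) = sqrt_term \<nu> (of_real p) (of_real q) n"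
      unfolding L_def lap_kernel_shift[OF SD SD2] .
    moreover have "L \<tau> * of_real (real (r2 n) * (exp \<tau> * exp (- real n * exp \<tau>)))
        = of_nat (r2 n) * (L \<tau> * of_real (exp (- real n * exp \<tau>)) * of_real (exp \<tau>))" for \<tau>
      by (simp add: mult_ac)
    ultimately show ?thesis by (simp only: integral_mult_right_zero)
  qed
  ultimately have 1: "(\<lambda>n. of_nat (r2 n) * sqrt_term \<nu> (of_real p) (of_real q) n) sums I" by (simp only:)
  have "(\<lambda>n. \<integral>\<tau>. L \<tau> * of_real (real (r2 n) * (pi * exp (- real n * (pi\<^sup>2 * exp (- \<tau>))))) \<partial>lborel) sums I"
    unfolding I_def
  proof (rule integral_series[OF _ _ _ _ _ wint LC])
    show "(\<lambda>n. real (r2 n) * (pi * exp (- real n * (pi\<^sup>2 * exp (- \<tau>))))) sums C \<tau>" for \<tau>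
    proof -
      have "pi\<^sup>2 * exp (- \<tau>) > 0" by simp
      from sums_mult[OF theta2_sums[OF this], of pi]
      have "(\<lambda>n. real (r2 n) * (pi * exp (- real n * (pi\<^sup>2 * exp (- \<tau>))))) sums (pi * theta2 (pi\<^sup>2 * exp (- \<tau>)))"
        by (simp add: mult_ac)
      moreover have "pi * theta2 (pi\<^sup>2 * exp (- \<tau>)) = C \<tau>"
        unfolding C_def using theta2_inversion[of "exp \<tau>"] by (simp add: exp_minus divide_inverse)
      ultimately show ?thesis by simp
    qed
  qed auto
  moreover have "(\<integral>\<tau>. L \<tau> * of_real (real (r2 n) * (pi * exp (- real n * (pi\<^sup>2 * exp (- \<tau>))))) \<partial>lborel)
      = of_nat (r2 n) * (if n = 0 then of_real pi / (\<nu> * (of_real p + of_real q) powr (2 * \<nu>))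
        else 2 * of_real pi * bessel_term \<nu> (of_real p) (of_real q) n)" for n
  proof -
    define x where "x = pi * sqrt (real n)"
    have x2: "x\<^sup>2 = pi\<^sup>2 * real n" by (simp add: x_def power_mult_distrib)
    have "L \<tau> * of_real (real (r2 n) * (pi * exp (- real n * (pi\<^sup>2 * exp (- \<tau>)))))
       = of_nat (r2 n) * of_real pi * (L \<tau> * of_real (exp (- x\<^sup>2 * exp (- \<tau>))))" for \<tau>
      unfolding x2 by (simp add: mult_ac)
    then have "(\<integral>\<tau>. L \<tau> * of_real (real (r2 n) * (pi * exp (- real n * (pi\<^sup>2 * exp (- \<tau>))))) \<partial>lborel)
       = of_nat (r2 n) * of_real pi * (\<integral>\<tau>. L \<tau> * of_real (exp (- x\<^sup>2 * exp (- \<tau>))) \<partial>lborel)"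
      by (simp only: integral_mult_right_zero)
    also have "\<dots> = of_nat (r2 n) * (if n = 0 then of_real pi / (\<nu> * (of_real p + of_real q) powr (2 * \<nu>))
        else 2 * of_real pi * bessel_term \<nu> (of_real p) (of_real q) n)"
    proof (cases "n = 0")
      case True
      then have "x = 0" by (simp add: x_def)
      then show ?thesis using True lap_kernel_integral_0[OF \<nu> s] by (simp add: L_def s_def)
    next
      case False
      then have "x > 0" by (simp add: x_def)
      have e: "(of_real x * (of_real p - of_real q))\<^sup>2 / 4 = (of_real ((d * x)\<^sup>2 / 4) :: complex)"
        "of_real x * of_real s = (of_real (s * x) :: complex)"
        "of_real p + of_real q = (of_real s :: complex)"
        by (simp_all add: s_def d_def mult.commute)
      have "bessel_term \<nu> (of_real p) (of_real q) n = of_real (x / 2) powr \<nu> * clifford \<nu> (of_real ((d * x)\<^sup>2 / 4))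
          * of_real s powr (- \<nu>) * macdonald \<nu> (of_real (s * x))"
        unfolding bessel_term_def x_def[symmetric] e ..
      then show ?thesis using False lap_kernel_integral_K[OF \<nu> s \<open>x > 0\<close>] by (simp add: L_def mult_ac)
    qed
    finally show ?thesis .
  qed
  ultimately have 2: "(\<lambda>n. of_nat (r2 n) * (if n = 0 then of_real pi / (\<nu> * (of_real p + of_real q) powr (2 * \<nu>))
        else 2 * of_real pi * bessel_term \<nu> (of_real p) (of_real q) n)) sums I" by (simp only:)
  from 1 2 show ?thesis by blast
qed

section \<open>Bounds for the two series\<close>

lemma norm_powr_ge:
  fixes w z :: complex
  assumes "w \<noteq> 0"
  shows "norm (w powr z) \<ge> norm w powr Re z * exp (- pi * \<bar>Im z\<bar>)"
    and "norm (w powr z) \<le> norm w powr Re z * exp (pi * \<bar>Im z\<bar>)"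
proof -
  have "\<bar>Im (Ln w)\<bar> \<le> pi" using assms mpi_less_Im_Ln[of w] Im_Ln_le_pi[of w] by simp
  then have "\<bar>Im z\<bar> * \<bar>Im (Ln w)\<bar> \<le> \<bar>Im z\<bar> * pi" by (intro mult_left_mono) auto
  then have le: "\<bar>Im z * Im (Ln w)\<bar> \<le> pi * \<bar>Im z\<bar>" by (simp add: abs_mult mult.commute)
  have n: "norm (w powr z) = exp (Re z * ln (norm w) - Im z * Im (Ln w))"
    using assms by (simp add: powr_def)
  have p: "norm w powr Re z = exp (Re z * ln (norm w))" using assms by (simp add: powr_def)
  show "norm (w powr z) \<ge> norm w powr Re z * exp (- pi * \<bar>Im z\<bar>)"
    unfolding n p mult_exp_exp using le by simp
  show "norm (w powr z) \<le> norm w powr Re z * exp (pi * \<bar>Im z\<bar>)"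
    unfolding n p mult_exp_exp using le by simp
qed

lemma sqrt_Re_le_Re_csqrt:
  assumes "Re w \<ge> 0" shows "sqrt (Re w) \<le> Re (csqrt w)"
proof -
  have "sqrt (Re w) \<le> sqrt ((norm w + Re w) / 2)"
    using complex_Re_le_cmod[of w] by (intro real_sqrt_le_mono) simp
  then show ?thesis by simp
qed

lemma sqrt_term_bound:
  assumes \<nu>: "Re \<nu> > 0" and pq: "norm p \<le> R" "norm q \<le> R" and n: "real n \<ge> 2 * R\<^sup>2" "n \<ge> 1"
  shows "norm (sqrt_term \<nu> p q n) \<le> 4 powr (1 + Re \<nu>) * exp (pi * \<bar>Im (2 * \<nu>)\<bar>) * (real n + 1) powr (- (1 + Re \<nu>))"
proof -
  define y where "y = real n / 2"
  have y: "y > 0" using n by (simp add: y_def)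
  have c: "sqrt y \<le> Re (csqrt (of_nat n + p\<^sup>2))" if "norm p \<le> R" for p
  proof -
    have "norm (p\<^sup>2) \<le> R\<^sup>2" using that by (simp add: norm_power power_mono)
    then have "Re (p\<^sup>2) \<ge> - R\<^sup>2" using abs_Re_le_cmod[of "p\<^sup>2"] by linarith
    then have "y \<le> Re (of_nat n + p\<^sup>2)" using n by (simp add: y_def)
    then have "sqrt y \<le> sqrt (Re (of_nat n + p\<^sup>2))" by (rule real_sqrt_le_mono)
    also have "\<dots> \<le> Re (csqrt (of_nat n + p\<^sup>2))"
      using \<open>y \<le> Re (of_nat n + p\<^sup>2)\<close> y by (intro sqrt_Re_le_Re_csqrt) linarith
    finally show ?thesis .
  qed
  define P Q where "P = csqrt (of_nat n + p\<^sup>2)" and "Q = csqrt (of_nat n + q\<^sup>2)"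
  have PQ: "sqrt y \<le> Re P" "sqrt y \<le> Re Q" unfolding P_def Q_def using c pq by auto
  have sy: "sqrt y > 0" using y by simp
  have nP: "sqrt y \<le> norm P" "sqrt y \<le> norm Q" using PQ complex_Re_le_cmod order_trans by blast+
  have nS: "sqrt y \<le> norm (P + Q)"
    using PQ sy complex_Re_le_cmod[of "P + Q"] unfolding plus_complex.sel by linarith
  have "P + Q \<noteq> 0" using nS sy by auto
  have nz: "P \<noteq> 0" "Q \<noteq> 0" using nP sy by auto
  have "y * (y powr Re \<nu> * exp (- (pi * \<bar>Im (2 * \<nu>)\<bar>))) \<le> norm P * norm Q * norm ((P + Q) powr (2 * \<nu>))"
  proof (intro mult_mono)
    have "sqrt y * sqrt y \<le> norm P * norm Q" using nP sy by (intro mult_mono) auto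
    then show "y \<le> norm P * norm Q" using y by simp
    have "y powr Re \<nu> = sqrt y powr (2 * Re \<nu>)"
      using y by (simp add: powr_half_sqrt[symmetric] powr_powr)
    also have "\<dots> \<le> norm (P + Q) powr (2 * Re \<nu>)" using nS sy \<nu> by (intro powr_mono2) auto
    finally have "y powr Re \<nu> * exp (- (pi * \<bar>Im (2 * \<nu>)\<bar>)) \<le> norm (P + Q) powr Re (2 * \<nu>) * exp (- pi * \<bar>Im (2 * \<nu>)\<bar>)"
      by (simp add: mult_right_mono)
    also have "\<dots> \<le> norm ((P + Q) powr (2 * \<nu>))" by (rule norm_powr_ge(1)) fact
    finally show "y powr Re \<nu> * exp (- (pi * \<bar>Im (2 * \<nu>)\<bar>)) \<le> norm ((P + Q) powr (2 * \<nu>))" .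
  qed (use y in auto)
  then have "norm (sqrt_term \<nu> p q n) \<le> 1 / (y * (y powr Re \<nu> * exp (- (pi * \<bar>Im (2 * \<nu>)\<bar>))))"
    unfolding sqrt_term_def P_def[symmetric] Q_def[symmetric] norm_divide norm_mult norm_one
    using y by (intro divide_left_mono mult_pos_pos) (use \<open>P + Q \<noteq> 0\<close> nz in auto)
  also have "\<dots> = exp (pi * \<bar>Im (2 * \<nu>)\<bar>) * y powr (- (1 + Re \<nu>))"
  proof -
    have "y * y powr Re \<nu> = y powr (1 + Re \<nu>)" using y by (simp add: powr_add)
    then show ?thesis unfolding mult.assoc[symmetric] powr_minus exp_minus by (simp add: divide_inverse)
  qed
  also have "\<dots> \<le> exp (pi * \<bar>Im (2 * \<nu>)\<bar>) * ((real n + 1) / 4) powr (- (1 + Re \<nu>))"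
    using n \<nu> by (intro mult_left_mono powr_mono2') (auto simp: y_def)
  also have "((real n + 1) / 4) powr (- (1 + Re \<nu>)) = 4 powr (1 + Re \<nu>) * (real n + 1) powr (- (1 + Re \<nu>))"
  proof -
    have "((real n + 1) / 4) powr (- a) = 4 powr a * (real n + 1) powr (- a)" for a
      by (simp add: powr_divide powr_minus field_simps)
    then show ?thesis .
  qed
  finally show ?thesis by (simp only: mult_ac)
qed

text \<open>
  Reduces the exponential decay of the Bessel series to \<open>r2_powr_summable\<close> with \<open>e = 1\<close>.
\<close>

lemma powr_exp_sqrt_bound:
  assumes "c > 0"
  obtains C where "C \<ge> 0" "\<And>n. (pi * sqrt (real n) / 2) powr a * exp (- c * (pi * sqrt (real n))) \<le> C * (real n + 1) powr (- 2)"
proof -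
  let ?f = "\<lambda>n. (pi * sqrt (real n) / 2) powr a * exp (- c * (pi * sqrt (real n))) * (real n + 1) powr 2"
  have "?f \<longlonglongrightarrow> 0" using assms by real_asymp
  then have "Bseq ?f" by (intro convergent_imp_Bseq convergentI)
  then obtain C where C: "C > 0" "\<And>n. norm (?f n) \<le> C" by (auto simp: Bseq_def)
  have "(pi * sqrt (real n) / 2) powr a * exp (- c * (pi * sqrt (real n))) \<le> C * (real n + 1) powr (- 2)" for n
  proof -
    have "?f n \<le> C" using C(2)[of n] by (metis abs_le_D1 real_norm_def)
    then show ?thesis by (simp add: powr_minus field_simps)
  qed
  with C(1) show thesis by (intro that[of C]) auto
qed

text \<open>
  The growth of the first Bessel factor and the decay of the second combine to
  \<open>exp (- 2 * x * min (Re p) (Re q))\<close> with \<open>x = pi * sqrt n\<close>.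
\<close>

lemma bessel_term_bound:
  assumes \<nu>: "Re \<nu> > 0" and \<delta>: "\<delta> > 0"
  obtains C where "C \<ge> 0" "\<And>p q n. Re p \<ge> \<delta> \<Longrightarrow> Re q \<ge> \<delta> \<Longrightarrow> n \<ge> 1 \<Longrightarrow> norm (bessel_term \<nu> p q n) \<le> C * (real n + 1) powr (- 2)"
proof -
  have "pi * (2 * \<delta>) > 0" using \<delta> by simp
  then obtain C1 where C1: "C1 \<ge> 0" "\<And>z. Re z \<ge> pi * (2 * \<delta>) \<Longrightarrow> norm (macdonald \<nu> z) \<le> C1 * exp (- Re z)"
    using macdonald_exp_bound by blast
  have "2 * \<delta> > 0" using \<delta> by simp
  then obtain C2 where C2: "C2 \<ge> 0" "\<And>n. (pi * sqrt (real n) / 2) powr Re \<nu> * exp (- (2 * \<delta>) * (pi * sqrt (real n))) \<le> C2 * (real n + 1) powr (- 2)"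
    using powr_exp_sqrt_bound[of "2 * \<delta>" "Re \<nu>"] by blast
  define G where "G = norm (rGamma (\<nu> + 1))"
  define B where "B = (2 * \<delta>) powr (- Re \<nu>) * exp (pi * \<bar>Im (- \<nu>)\<bar>)"
  have GB: "G \<ge> 0" "B \<ge> 0" by (auto simp: G_def B_def)
  have "norm (bessel_term \<nu> p q n) \<le> (G * B * C1 * C2) * (real n + 1) powr (- 2)" if pq: "Re p \<ge> \<delta>" "Re q \<ge> \<delta>" "n \<ge> 1" for p q n
  proof -
    define x where "x = pi * sqrt (real n)"
    have x: "x \<ge> pi" using that by (simp add: x_def)
    then have x0: "x > 0" using pi_gt_zero by linarith
    have 1: "norm (of_real (x / 2) powr \<nu> :: complex) = (x / 2) powr Re \<nu>"
      using x0 by (subst norm_powr_real_powr) auto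
    have 2: "norm (clifford \<nu> ((of_real x * (p - q))\<^sup>2 / 4)) \<le> G * exp (x * \<bar>Re p - Re q\<bar>)"
      using clifford_exp_bound[of \<nu> "of_real x * (p - q)"] \<nu> x0 by (simp add: G_def abs_mult)
    have 3: "norm ((p + q) powr (- \<nu>)) \<le> B"
    proof -
      have "Re (p + q) \<ge> 2 * \<delta>" using pq by simp
      then have g: "norm (p + q) \<ge> 2 * \<delta>" using complex_Re_le_cmod[of "p + q"] by linarith
      then have "p + q \<noteq> 0" using \<delta> by auto
      then have "norm ((p + q) powr (- \<nu>)) \<le> norm (p + q) powr Re (- \<nu>) * exp (pi * \<bar>Im (- \<nu>)\<bar>)"
        by (rule norm_powr_ge(2))
      also have "\<dots> \<le> B" unfolding B_def
        using g \<delta> \<nu> by (intro mult_right_mono) (auto intro!: powr_mono2')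
      finally show ?thesis .
    qed
    have 4: "norm (macdonald \<nu> (of_real x * (p + q))) \<le> C1 * exp (- (x * (Re p + Re q)))"
    proof -
      have "pi * (2 * \<delta>) \<le> x * (Re p + Re q)" using x x0 pq \<delta> by (intro mult_mono) auto
      then show ?thesis using C1(2)[of "of_real x * (p + q)"] by simp
    qed
    have "norm (bessel_term \<nu> p q n) \<le> (x / 2) powr Re \<nu> * (G * exp (x * \<bar>Re p - Re q\<bar>)) * B * (C1 * exp (- (x * (Re p + Re q))))"
      unfolding bessel_term_def norm_mult x_def[symmetric] 1
      by (intro mult_mono mult_nonneg_nonneg 2 3 4 order_refl) (auto simp: GB)
    also have "\<dots> = G * B * C1 * ((x / 2) powr Re \<nu> * exp (x * \<bar>Re p - Re q\<bar> - x * (Re p + Re q)))"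
      unfolding exp_minus exp_diff divide_inverse by (simp only: mult_ac)
    also have "\<dots> \<le> G * B * C1 * ((x / 2) powr Re \<nu> * exp (- (2 * \<delta>) * x))"
    proof (intro mult_left_mono)
      have "\<bar>Re p - Re q\<bar> - (Re p + Re q) \<le> - (2 * \<delta>)" using pq by linarith
      then have "x * (\<bar>Re p - Re q\<bar> - (Re p + Re q)) \<le> x * (- (2 * \<delta>))" using x0 by (intro mult_left_mono) auto
      then show "exp (x * \<bar>Re p - Re q\<bar> - x * (Re p + Re q)) \<le> exp (- (2 * \<delta>) * x)" by (simp add: algebra_simps)
    qed (use GB C1 in auto)
    also have "\<dots> \<le> G * B * C1 * (C2 * (real n + 1) powr (- 2))"
      using C2(2)[of n] GB C1 by (intro mult_left_mono) (auto simp: x_def)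
    finally show ?thesis by (simp add: mult_ac)
  qed
  then show thesis using that[of "G * B * C1 * C2"] GB C1 C2 by auto
qed

section \<open>Analytic continuation in the parameters\<close>

definition sqrt_series :: "complex \<Rightarrow> complex \<Rightarrow> complex \<Rightarrow> nat \<Rightarrow> complex" where
  "sqrt_series \<nu> p q n = of_nat (r2 n) * sqrt_term \<nu> p q n"

text \<open>
  The summand at \<open>n = 0\<close> is \<open>pi\<close> times the integral of the algebraic summand over \<open>n > 0\<close>.
\<close>

definition bessel_series :: "complex \<Rightarrow> complex \<Rightarrow> complex \<Rightarrow> nat \<Rightarrow> complex" where
  "bessel_series \<nu> p q n = of_nat (r2 n) * (if n = 0 then of_real pi / (\<nu> * (p + q) powr (2 * \<nu>)) else 2 * of_real pi * bessel_term \<nu> p q n)"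

abbreviation right_half_plane :: "complex set" where "right_half_plane \<equiv> {z. Re z > 0}"

lemma series_majorant:
  assumes \<nu>: "Re \<nu> > 0" and \<delta>: "\<delta> > 0"
  obtains h N where "summable h"
    "\<And>p q n. Re p \<ge> \<delta> \<Longrightarrow> Re q \<ge> \<delta> \<Longrightarrow> norm p \<le> R \<Longrightarrow> norm q \<le> R \<Longrightarrow> n \<ge> N \<Longrightarrow> norm (sqrt_series \<nu> p q n) \<le> h n"
    "\<And>p q n. Re p \<ge> \<delta> \<Longrightarrow> Re q \<ge> \<delta> \<Longrightarrow> norm p \<le> R \<Longrightarrow> norm q \<le> R \<Longrightarrow> n \<ge> N \<Longrightarrow> norm (bessel_series \<nu> p q n) \<le> h n"
proof -
  obtain C where C: "C \<ge> 0" "\<And>p q n. Re p \<ge> \<delta> \<Longrightarrow> Re q \<ge> \<delta> \<Longrightarrow> n \<ge> 1 \<Longrightarrow> norm (bessel_term \<nu> p q n) \<le> C * (real n + 1) powr (- 2)"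
    using bessel_term_bound[OF assms] by blast
  define K where "K = 4 powr (1 + Re \<nu>) * exp (pi * \<bar>Im (2 * \<nu>)\<bar>)"
  define h where "h n = K * (real (r2 n) * (real n + 1) powr (- (1 + Re \<nu>))) + 2 * pi * C * (real (r2 n) * (real n + 1) powr (- (1 + 1)))" for n
  have h: "summable h" unfolding h_def
    by (intro summable_add summable_mult r2_powr_summable \<nu>) auto
  have K: "K \<ge> 0" by (simp add: K_def)
  obtain N0 :: nat where N0: "real N0 \<ge> 2 * R\<^sup>2" using real_arch_simple by blast
  show thesis
  proof (rule that[OF h])
    fix p q n assume *: "Re p \<ge> \<delta>" "Re q \<ge> \<delta>" "norm p \<le> R" "norm q \<le> R" "n \<ge> Suc N0"
    have n: "real n \<ge> 2 * R\<^sup>2" "n \<ge> 1" using * N0 by linarith+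
    have "norm (sqrt_series \<nu> p q n) \<le> real (r2 n) * (K * (real n + 1) powr (- (1 + Re \<nu>)))"
      unfolding sqrt_series_def norm_mult K_def using sqrt_term_bound[OF \<nu> *(3,4) n] by (simp add: mult_left_mono)
    also have "\<dots> \<le> h n" using C(1) by (simp add: h_def mult_ac)
    finally show "norm (sqrt_series \<nu> p q n) \<le> h n" .
    have "norm (bessel_series \<nu> p q n) = real (r2 n) * (2 * pi * norm (bessel_term \<nu> p q n))"
      using n unfolding bessel_series_def by (simp add: norm_mult)
    also have "\<dots> \<le> real (r2 n) * (2 * pi * (C * (real n + 1) powr (- 2)))"
      by (intro mult_left_mono C * n) auto
    also have "\<dots> \<le> h n" using K by (simp add: h_def mult_ac)
    finally show "norm (bessel_series \<nu> p q n) \<le> h n" .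
  qed
qed

lemma square_not_nonpos: "Re p > 0 \<Longrightarrow> of_nat n + p\<^sup>2 \<notin> \<real>\<^sub>\<le>\<^sub>0"
proof
  assume p: "Re p > 0" and "of_nat n + p\<^sup>2 \<in> \<real>\<^sub>\<le>\<^sub>0"
  then have "real n + ((Re p)\<^sup>2 - (Im p)\<^sup>2) \<le> 0" "2 * Re p * Im p = 0"
    by (auto simp: complex_nonpos_Reals_iff power2_eq_square)
  then have "Im p = 0" "real n + (Re p)\<^sup>2 \<le> 0" using p by auto
  moreover have "(Re p)\<^sup>2 > 0" using p by simp
  ultimately show False by (smt (verit) of_nat_0_le_iff)
qed

lemma Re_csqrt_pos:
  assumes "w \<notin> \<real>\<^sub>\<le>\<^sub>0" shows "Re (csqrt w) > 0"
proof (rule ccontr)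
  assume "\<not> Re (csqrt w) > 0"
  then have "Re (csqrt w) = 0" using csqrt_principal[of w] by auto
  then have "Re ((csqrt w)\<^sup>2) \<le> 0" "Im ((csqrt w)\<^sup>2) = 0" unfolding power2_eq_square by simp_all
  then show False using assms by (simp add: complex_nonpos_Reals_iff)
qed

lemma pos_not_nonpos: "Re z > 0 \<Longrightarrow> z \<notin> \<real>\<^sub>\<le>\<^sub>0"
  by (auto simp: complex_nonpos_Reals_iff)

lemma macdonald_holomorphic: "macdonald \<nu> holomorphic_on right_half_plane"
  using macdonald_has_field_derivative by (auto simp: holomorphic_on_open open_halfspace_Re_gt)

lemma sqrt_series_holomorphic:
  assumes q: "Re q > 0"
  shows "(\<lambda>p. sqrt_series \<nu> p q n) holomorphic_on right_half_plane"
proof -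
  have P: "Re (csqrt (of_nat n + p\<^sup>2)) > 0" if "Re p > 0" for p
    using Re_csqrt_pos square_not_nonpos[OF that] by blast
  have "csqrt (of_nat n + p\<^sup>2) \<noteq> 0" if "Re p > 0" for p
    using P[OF that] by (metis less_irrefl zero_complex.sel(1))
  moreover have "csqrt (of_nat n + p\<^sup>2) + csqrt (of_nat n + q\<^sup>2) \<notin> \<real>\<^sub>\<le>\<^sub>0" if "Re p > 0" for p
    by (rule pos_not_nonpos) (use P[OF that] P[OF q] in \<open>simp only: plus_complex.sel\<close>)
  moreover have "csqrt (of_nat n + p\<^sup>2) + csqrt (of_nat n + q\<^sup>2) \<noteq> 0" if "Re p > 0" for p
    using P[OF that] P[OF q] by (metis add_pos_pos less_irrefl plus_complex.sel(1) zero_complex.sel(1))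
  ultimately show ?thesis unfolding sqrt_series_def sqrt_term_def
    by (intro holomorphic_intros) (use q square_not_nonpos in auto)
qed

lemma bessel_series_holomorphic:
  assumes \<nu>: "Re \<nu> > 0" and q: "Re q > 0"
  shows "(\<lambda>p. bessel_series \<nu> p q n) holomorphic_on right_half_plane"
proof (cases "n = 0")
  case True
  have "\<nu> \<noteq> 0" using \<nu> by auto
  moreover have "p + q \<notin> \<real>\<^sub>\<le>\<^sub>0" "p + q \<noteq> 0" if "Re p > 0" for p
    using that q by (auto simp: complex_nonpos_Reals_iff complex_eq_iff)
  ultimately show ?thesis unfolding bessel_series_def using True
    by (simp, intro holomorphic_intros) auto
next
  case False
  define x where "x = pi * sqrt (real n)"
  have x: "x > 0" using False by (simp add: x_def)
  have "(\<lambda>p. macdonald \<nu> (of_real x * (p + q))) holomorphic_on right_half_plane"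
    by (rule holomorphic_on_compose_gen[OF _ macdonald_holomorphic, unfolded o_def])
       (use x q in \<open>auto intro!: holomorphic_intros\<close>)
  moreover have "(\<lambda>p. clifford \<nu> ((of_real x * (p - q))\<^sup>2 / 4)) holomorphic_on right_half_plane"
    by (intro clifford_holomorphic holomorphic_intros) auto
  moreover have "(\<lambda>p. (p + q) powr (- \<nu>)) holomorphic_on right_half_plane"
    by (intro holomorphic_intros) (use q in \<open>auto simp: complex_nonpos_Reals_iff\<close>)
  ultimately have "(\<lambda>p. of_nat (r2 n) * (2 * of_real pi * (of_real (x / 2) powr \<nu> * clifford \<nu> ((of_real x * (p - q))\<^sup>2 / 4)
      * (p + q) powr (- \<nu>) * macdonald \<nu> (of_real x * (p + q))))) holomorphic_on right_half_plane"
    by (intro holomorphic_on_mult holomorphic_on_const)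
  then show ?thesis using False by (simp only: bessel_series_def bessel_term_def x_def if_False)
qed

lemma series_locally_bounded:
  assumes \<nu>: "Re \<nu> > 0" and q: "Re q > 0" and x: "Re x > 0"
  shows "\<exists>d h. 0 < d \<and> summable h \<and> (\<forall>\<^sub>F n in sequentially. \<forall>y\<in>ball x d \<inter> right_half_plane. norm (sqrt_series \<nu> y q n) \<le> h n)"
    and "\<exists>d h. 0 < d \<and> summable h \<and> (\<forall>\<^sub>F n in sequentially. \<forall>y\<in>ball x d \<inter> right_half_plane. norm (bessel_series \<nu> y q n) \<le> h n)"
proof -
  define d where "d = Re x / 2"
  define \<delta> where "\<delta> = min d (Re q)"
  define R where "R = max (norm x + d) (norm q)"
  have d: "d > 0" "\<delta> > 0" using x q by (auto simp: d_def \<delta>_def)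
  obtain h N where h: "summable h"
    "\<And>p q n. Re p \<ge> \<delta> \<Longrightarrow> Re q \<ge> \<delta> \<Longrightarrow> norm p \<le> R \<Longrightarrow> norm q \<le> R \<Longrightarrow> n \<ge> N \<Longrightarrow> norm (sqrt_series \<nu> p q n) \<le> h n"
    "\<And>p q n. Re p \<ge> \<delta> \<Longrightarrow> Re q \<ge> \<delta> \<Longrightarrow> norm p \<le> R \<Longrightarrow> norm q \<le> R \<Longrightarrow> n \<ge> N \<Longrightarrow> norm (bessel_series \<nu> p q n) \<le> h n"
    using series_majorant[OF \<nu> d(2), of R] by metis
  have y: "Re y \<ge> \<delta>" "norm y \<le> R" if "y \<in> ball x d" for y
  proof -
    have "norm (x - y) < d" using that by (simp add: dist_norm)
    then have "Re x - Re y < d" "norm y < norm x + d"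
      using complex_Re_le_cmod[of "x - y"] norm_triangle_ineq2[of y x] by (simp_all add: norm_minus_commute)
    then show "Re y \<ge> \<delta>" "norm y \<le> R" by (auto simp: \<delta>_def R_def d_def)
  qed
  have q': "Re q \<ge> \<delta>" "norm q \<le> R" by (auto simp: \<delta>_def R_def)
  show "\<exists>d h. 0 < d \<and> summable h \<and> (\<forall>\<^sub>F n in sequentially. \<forall>y\<in>ball x d \<inter> right_half_plane. norm (sqrt_series \<nu> y q n) \<le> h n)"
    using d(1) h(1,2) y q' unfolding eventually_sequentially by (intro exI[of _ d] exI[of _ h]) blast
  show "\<exists>d h. 0 < d \<and> summable h \<and> (\<forall>\<^sub>F n in sequentially. \<forall>y\<in>ball x d \<inter> right_half_plane. norm (bessel_series \<nu> y q n) \<le> h n)"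
    using d(1) h(1,3) y q' unfolding eventually_sequentially by (intro exI[of _ d] exI[of _ h]) blast
qed

lemma series_summable:
  assumes \<nu>: "Re \<nu> > 0" and pq: "Re p > 0" "Re q > 0"
  shows "summable (sqrt_series \<nu> p q)" "summable (bessel_series \<nu> p q)"
proof -
  have *: "summable f" if "\<exists>d h. 0 < d \<and> summable h \<and> (\<forall>\<^sub>F n in sequentially. \<forall>y\<in>ball p d \<inter> right_half_plane. norm (g y n) \<le> h n)"
    "f = g p" for f :: "nat \<Rightarrow> complex" and g
  proof -
    from that obtain d h where d: "0 < d" "summable h" "\<forall>\<^sub>F n in sequentially. \<forall>y\<in>ball p d \<inter> right_half_plane. norm (g y n) \<le> h n"
      by blast
    have "p \<in> ball p d \<inter> right_half_plane" using d(1) pq by simp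
    then have "\<forall>\<^sub>F n in sequentially. norm (f n) \<le> h n"
      using d(3) unfolding that(2) by (auto elim!: eventually_mono)
    then show ?thesis using d(2) by (rule summable_comparison_test_ev)
  qed
  show "summable (sqrt_series \<nu> p q)" by (rule *[OF series_locally_bounded(1)[OF \<nu> pq(2,1)] refl])
  show "summable (bessel_series \<nu> p q)" by (rule *[OF series_locally_bounded(2)[OF \<nu> pq(2,1)] refl])
qed

definition poisson_defect :: "complex \<Rightarrow> complex \<Rightarrow> complex \<Rightarrow> complex" where
  "poisson_defect \<nu> p q = (\<Sum>n. sqrt_series \<nu> p q n) - (\<Sum>n. bessel_series \<nu> p q n)"

lemma poisson_defect_commute: "poisson_defect \<nu> p q = poisson_defect \<nu> q p"
proof -
  have "bessel_term \<nu> p q n = bessel_term \<nu> q p n" for n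
    unfolding bessel_term_def by (simp add: power_mult_distrib power2_commute add.commute)
  then have "bessel_series \<nu> p q = bessel_series \<nu> q p"
    unfolding bessel_series_def by (intro ext) (simp only: add.commute[of p q])
  moreover have "sqrt_series \<nu> p q = sqrt_series \<nu> q p"
    unfolding sqrt_series_def sqrt_term_def by (intro ext) (simp only: add.commute mult.commute)
  ultimately show ?thesis unfolding poisson_defect_def by (simp only:)
qed

lemma poisson_defect_holomorphic:
  assumes \<nu>: "Re \<nu> > 0" and q: "Re q > 0"
  shows "(\<lambda>p. poisson_defect \<nu> p q) holomorphic_on right_half_plane"
  unfolding poisson_defect_def
  by (intro holomorphic_on_diff series_holomorphic open_halfspace_Re_gt sqrt_series_holomorphic bessel_series_holomorphic
      series_locally_bounded assms) auto

text \<open>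
  First \<open>q\<close> is real and \<open>p\<close> is continued from a real interval to the right of \<open>q\<close>; then \<open>p\<close> is arbitrary and
  \<open>q\<close> is continued from the positive reals, by the symmetry of the defect.
\<close>

lemma poisson_defect_zero:
  assumes \<nu>: "Re \<nu> > 0" and pq: "Re p > 0" "Re q > 0"
  shows "poisson_defect \<nu> p q = 0"
proof -
  have conn: "connected right_half_plane" by (intro convex_connected convex_halfspace_Re_gt)
  have 1: "poisson_defect \<nu> p (of_real q) = 0" if q: "q > 0" and p: "Re p > 0" for q :: real and p
  proof (rule analytic_continuation[where f = "\<lambda>p. poisson_defect \<nu> p (of_real q)" and S = right_half_plane
        and U = "of_real ` {q<..<11 / 10 * q}" and \<xi> = "of_real q"])
    show "(\<lambda>p. poisson_defect \<nu> p (of_real q)) holomorphic_on right_half_plane" by (rule poisson_defect_holomorphic) (use \<nu> q in auto)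
    show "of_real q islimpt (of_real ` {q<..<11 / 10 * q} :: complex set)"
      unfolding islimpt_approachable
    proof (intro allI impI)
      fix e :: real assume e: "e > 0"
      define x where "x = q + min (e / 2) (q / 20)"
      have "x \<in> {q<..<11 / 10 * q}" "\<bar>x - q\<bar> < e" "x \<noteq> q" using e q by (auto simp: x_def min_def)
      then show "\<exists>x'\<in>of_real ` {q<..<11 / 10 * q}. x' \<noteq> of_real q \<and> dist x' (of_real q :: complex) < e"
        by (intro bexI[of _ "of_real x"]) (auto simp: dist_of_real dist_real_def)
    qed
    \<comment> \<open>The factor \<open>11 / 10\<close> keeps \<open>d / s\<close> small enough for the decay rate to be positive.\<close>
    show "poisson_defect \<nu> z (of_real q) = 0" if z: "z \<in> of_real ` {q<..<11 / 10 * q}" for z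
    proof -
      obtain x where x: "z = of_real x" "q < x" "x < 11 / 10 * q" using z by auto
      have "decay_rate (x + q) (x - q) > 0"
      proof -
        have "decay_rate (x + q) (x - q) = x * q - (x\<^sup>2 - q\<^sup>2) / 2"
          by (simp add: decay_rate_def power2_eq_square algebra_simps add_divide_distrib diff_divide_distrib)
        moreover have "x * x \<le> (11 / 10 * q) * (11 / 10 * q)" using x q by (intro mult_mono) auto
        moreover have "q * q \<le> x * q" using x q by (intro mult_right_mono) auto
        moreover have "q * q > 0" using q by simp
        ultimately show ?thesis by (simp add: power2_eq_square)
      qed
      then obtain I where "(\<lambda>n. sqrt_series \<nu> z (of_real q) n) sums I" "(\<lambda>n. bessel_series \<nu> z (of_real q) n) sums I"
        using real_identity[OF \<nu> q, of x] x by (auto simp: sqrt_series_def bessel_series_def)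
      then show ?thesis by (simp add: poisson_defect_def sums_iff)
    qed
  qed (use conn open_halfspace_Re_gt q p in auto)
  have "poisson_defect \<nu> q p = 0"
  proof (rule analytic_continuation[where f = "\<lambda>q. poisson_defect \<nu> q p" and S = right_half_plane
        and U = "of_real ` {1<..<2}" and \<xi> = "1"])
    show "(\<lambda>q. poisson_defect \<nu> q p) holomorphic_on right_half_plane" by (rule poisson_defect_holomorphic) (use \<nu> pq in auto)
    show "1 islimpt (of_real ` {1<..<2} :: complex set)"
      unfolding islimpt_approachable
    proof (intro allI impI)
      fix e :: real assume e: "e > 0"
      define x where "x = 1 + min (e / 2) (1 / 2)"
      have "x \<in> {1<..<2}" "\<bar>x - 1\<bar> < e" "x \<noteq> 1" using e by (auto simp: x_def min_def)
      then show "\<exists>x'\<in>of_real ` {1<..<2}. x' \<noteq> 1 \<and> dist x' (1 :: complex) < e"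
        using dist_of_real[of x 1, where 'a = complex] by (intro bexI[of _ "of_real x"]) (auto simp: dist_real_def)
    qed
    show "poisson_defect \<nu> z p = 0" if z: "z \<in> of_real ` {1<..<2}" for z
      using z 1[OF _ pq(1)] by (auto simp: poisson_defect_commute[of \<nu> _ p])
  qed (use conn open_halfspace_Re_gt pq in auto)
  then show ?thesis by (simp add: poisson_defect_commute)
qed

section \<open>The summands\<close>

lemma csqrt_scale: "csqrt (of_nat n * w) = of_real (sqrt (real n)) * csqrt w"
proof (cases "n = 0")
  case False
  show ?thesis
  proof (rule csqrt_unique)
    show "(of_real (sqrt (real n)) * csqrt w)\<^sup>2 = of_nat n * w"
      by (simp add: power_mult_distrib flip: of_real_power)
    show "0 < Re (of_real (sqrt (real n)) * csqrt w) \<or> Re (of_real (sqrt (real n)) * csqrt w) = 0 \<and> 0 \<le> Im (of_real (sqrt (real n)) * csqrt w)"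
      using csqrt_principal[of w] False by (auto simp: zero_less_mult_iff)
  qed
qed simp

lemma powr_pos_scale:
  assumes "x > 0" "w \<noteq> 0"
  shows "(of_real x * w) powr z = of_real x powr z * (w powr z :: complex)"
  using assms by (simp add: powr_def Ln_times_of_real Ln_of_real ring_distribs exp_add)

text \<open>
  The arguments of \<open>p - q\<close> and \<open>p + q\<close> have modulus at most \<open>pi / 2\<close>, the second strictly, so the principal
  logarithms add up.
\<close>

lemma powr_difference_of_squares:
  assumes "Re p \<ge> Re q" "Re q > 0" "p \<noteq> q"
  shows "(p\<^sup>2 - q\<^sup>2) powr \<nu> = (p - q) powr \<nu> * (p + q) powr \<nu>"
proof -
  have nz: "p - q \<noteq> 0" "p + q \<noteq> 0" using assms by (auto simp: complex_eq_iff)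
  have "\<bar>Im (Ln (p - q))\<bar> \<le> pi / 2" using nz assms Re_Ln_pos_le[of "p - q"] by simp
  moreover have "\<bar>Im (Ln (p + q))\<bar> < pi / 2" using nz assms Re_Ln_pos_lt[of "p + q"] by simp
  ultimately have "Ln ((p - q) * (p + q)) = Ln (p - q) + Ln (p + q)"
    using nz by (intro Ln_times_simple) auto
  moreover have "p\<^sup>2 - q\<^sup>2 = (p - q) * (p + q)" by (simp add: power2_eq_square algebra_simps)
  moreover have "(p - q) * (p + q) \<noteq> 0" using nz by simp
  ultimately show ?thesis using nz by (simp only: powr_def if_False ring_distribs exp_add)
qed

lemma IK_quot_eq:
  assumes pq: "Re p \<ge> Re q" "Re q > 0" "p \<noteq> q" and n: "n \<ge> 1"
    and \<alpha>: "csqrt \<alpha> = p" "csqrt \<beta> = q"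
  shows "IK_quot \<nu> \<alpha> \<beta> n = of_nat (r2 n) * bessel_term \<nu> p q n"
proof -
  define x where "x = pi * sqrt (real n)"
  have x: "x > 0" using n by (simp add: x_def)
  have ab: "\<alpha> = p\<^sup>2" "\<beta> = q\<^sup>2" using \<alpha> by auto
  have args: "of_real pi * (csqrt (of_nat n * \<alpha>) - csqrt (of_nat n * \<beta>)) = of_real x * (p - q)"
    "of_real pi * (csqrt (of_nat n * \<alpha>) + csqrt (of_nat n * \<beta>)) = of_real x * (p + q)"
    unfolding csqrt_scale \<alpha> x_def by (simp_all add: algebra_simps)
  have K: "bessel_K \<nu> (of_real x * (p + q)) = macdonald \<nu> (of_real x * (p + q))"
    by (rule bessel_K_eq_macdonald) (use x pq in \<open>simp add: zero_less_mult_iff\<close>)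
  have "of_real x * (p - q) / 2 = of_real (x / 2) * (p - q)" by simp
  then have I: "bessel_I \<nu> (of_real x * (p - q)) = of_real (x / 2) powr \<nu> * (p - q) powr \<nu> * clifford \<nu> ((of_real x * (p - q))\<^sup>2 / 4)"
    unfolding bessel_I_clifford using x pq powr_pos_scale[of "x / 2" "p - q" \<nu>] by simp
  have nz: "(p - q) powr \<nu> \<noteq> 0" "(p + q) powr \<nu> \<noteq> 0" 
  proof -
    have "p - q \<noteq> 0" "p + q \<noteq> 0" using pq by (auto simp: complex_eq_iff)
    then show "(p - q) powr \<nu> \<noteq> 0" "(p + q) powr \<nu> \<noteq> 0" by simp_all
  qed
  have "IK_quot \<nu> \<alpha> \<beta> n = of_nat (r2 n) * (of_real (x / 2) powr \<nu> * (p - q) powr \<nu> * clifford \<nu> ((of_real x * (p - q))\<^sup>2 / 4))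
      * macdonald \<nu> (of_real x * (p + q)) / ((p - q) powr \<nu> * (p + q) powr \<nu>)"
    unfolding IK_quot_def unfolding args unfolding K I unfolding ab powr_difference_of_squares[OF pq] ..
  also have "\<dots> = of_nat (r2 n) * bessel_term \<nu> p q n"
    unfolding bessel_term_def x_def[symmetric] powr_minus using nz by (simp add: field_simps)
  finally show ?thesis .
qed

text \<open>
  For \<open>\<alpha> = \<beta>\<close> the limit within the region is the value of the continuous function on the right. The region
  accumulates at \<open>\<beta>\<close> because it contains \<open>(csqrt \<beta> + \<epsilon>)\<^sup>2\<close> for every \<open>\<epsilon> > 0\<close>.
\<close>

lemma IK_summand_eq:
  assumes \<nu>: "Re \<nu> > 0" and pq: "Re (csqrt \<alpha>) \<ge> Re (csqrt \<beta>)" "Re (csqrt \<beta>) > 0" and n: "n \<ge> 1"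
  shows "IK_summand \<nu> \<alpha> \<beta> n = of_nat (r2 n) * bessel_term \<nu> (csqrt \<alpha>) (csqrt \<beta>) n"
proof (cases "\<alpha> = \<beta>")
  case False
  then have "csqrt \<alpha> \<noteq> csqrt \<beta>" by (metis power2_csqrt)
  then show ?thesis using False IK_quot_eq[OF pq _ n refl refl] by (simp add: IK_summand_def)
next
  case True
  define q where "q = csqrt \<beta>"
  define A where "A = {a. Re (csqrt a) \<ge> Re (csqrt \<beta>)}"
  have q: "Re q > 0" using pq by (simp add: q_def)
  have q2: "q\<^sup>2 = \<beta>" by (simp add: q_def)
  have np: "\<beta> \<notin> \<real>\<^sub>\<le>\<^sub>0" using square_not_nonpos[OF q, of 0] q2 by simp
  have "(\<lambda>p. of_nat (r2 n) * bessel_term \<nu> p q n) holomorphic_on right_half_plane"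
  proof -
    have "(\<lambda>p. bessel_series \<nu> p q n / (2 * of_real pi)) holomorphic_on right_half_plane"
      by (intro holomorphic_intros bessel_series_holomorphic \<nu> q) auto
    then show ?thesis using n by (simp add: bessel_series_def)
  qed
  then have "isCont (\<lambda>p. of_nat (r2 n) * bessel_term \<nu> p q n) q"
    by (intro field_differentiable_imp_continuous_at holomorphic_on_imp_differentiable_at[OF _ open_halfspace_Re_gt])
       (use q in auto)
  moreover have "isCont csqrt \<beta>" using continuous_at_csqrt np by blast
  ultimately have "isCont (\<lambda>a. of_nat (r2 n) * bessel_term \<nu> (csqrt a) q n) \<beta>"
    unfolding q_def by (rule isCont_o2[rotated])
  then have "((\<lambda>a. of_nat (r2 n) * bessel_term \<nu> (csqrt a) q n) \<longlongrightarrow> of_nat (r2 n) * bessel_term \<nu> q q n) (at \<beta> within A)"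
    unfolding q_def isCont_def by (rule tendsto_within_subset) auto
  moreover have "\<forall>\<^sub>F a in at \<beta> within A. of_nat (r2 n) * bessel_term \<nu> (csqrt a) q n = IK_quot \<nu> a \<beta> n"
    unfolding eventually_at_filter
  proof (intro always_eventually allI impI)
    fix a assume a: "a \<noteq> \<beta>" "a \<in> A"
    have "csqrt a \<noteq> q" using a(1) unfolding q_def by (metis power2_csqrt)
    then show "of_nat (r2 n) * bessel_term \<nu> (csqrt a) q n = IK_quot \<nu> a \<beta> n"
      using a(2) q n by (intro IK_quot_eq[symmetric] refl) (simp_all only: A_def q_def mem_Collect_eq not_False_eq_True)
  qed
  ultimately have "((\<lambda>a. IK_quot \<nu> a \<beta> n) \<longlongrightarrow> of_nat (r2 n) * bessel_term \<nu> q q n) (at \<beta> within A)"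
    by (rule Lim_transform_eventually)
  moreover have "at \<beta> within A \<noteq> bot"
    unfolding trivial_limit_within
  proof
    assume "\<not> \<beta> islimpt A"
    moreover have "\<beta> islimpt A"
      unfolding islimpt_sequential
    proof (intro exI conjI allI)
      let ?f = "\<lambda>k. (q + of_real (1 / real (Suc k)))\<^sup>2"
      fix k
      have r: "Re (q + of_real (1 / real (Suc k))) > Re q" by (simp del: of_nat_Suc)
      then have c: "csqrt (?f k) = q + of_real (1 / real (Suc k))"
        using q by (intro csqrt_square disjI1) linarith
      have "?f k \<in> A" unfolding A_def mem_Collect_eq c using r by (simp add: q_def[symmetric])
      moreover have "?f k \<noteq> \<beta>" using c r unfolding q_def by (metis less_irrefl)
      ultimately show "?f k \<in> A - {\<beta>}" by simp
    next
      have "(\<lambda>k. (q + of_real (1 / real (Suc k)))\<^sup>2) \<longlonglongrightarrow> (q + of_real 0)\<^sup>2"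
        by (intro tendsto_intros lim_1_over_n[THEN LIMSEQ_Suc])
      then show "(\<lambda>k. (q + of_real (1 / real (Suc k)))\<^sup>2) \<longlonglongrightarrow> \<beta>" by (simp add: q2)
    qed
    ultimately show False by blast
  qed
  ultimately have "Lim (at \<beta> within A) (\<lambda>a. IK_quot \<nu> a \<beta> n) = of_nat (r2 n) * bessel_term \<nu> q q n"
    by (intro tendsto_Lim)
  then show ?thesis using True by (simp add: IK_summand_def A_def q_def)
qed

theorem corollary4p3:
  fixes \<alpha> \<beta> \<nu> :: complex
  assumes "Re \<nu> > 0"
    and "Re (csqrt \<alpha>) \<ge> Re (csqrt \<beta>)"
    and "Re (csqrt \<beta>) > 0"
  shows "summable (\<lambda>n. IK_summand \<nu> \<alpha> \<beta> (Suc n))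
    \<and> summable (\<lambda>n. sqrt_summand \<nu> \<alpha> \<beta> (Suc n))
    \<and> 2 * of_real pi * (\<Sum>n. IK_summand \<nu> \<alpha> \<beta> (Suc n))
      = (\<nu> - of_real pi * (csqrt \<alpha> * csqrt \<beta>))
          / (\<nu> * (csqrt \<alpha> * csqrt \<beta>) * (csqrt \<alpha> + csqrt \<beta>) powr (2 * \<nu>))
        + (\<Sum>n. sqrt_summand \<nu> \<alpha> \<beta> (Suc n))"
proof -
  define p q where "p = csqrt \<alpha>" and "q = csqrt \<beta>"
  have p: "Re p > 0" and q: "Re q > 0" using assms by (auto simp: p_def q_def)
  define S where "S = (p + q) powr (2 * \<nu>)"
  have "p + q \<noteq> 0" using p q by (auto simp: complex_eq_iff)
  then have nz: "p \<noteq> 0" "q \<noteq> 0" "\<nu> \<noteq> 0" "S \<noteq> 0" using p q assms(1) by (auto simp: S_def)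
  have sq: "sqrt_summand \<nu> \<alpha> \<beta> n = sqrt_series \<nu> p q n" for n
    by (simp add: sqrt_summand_def sqrt_series_def sqrt_term_def p_def q_def)
  have ik: "bessel_series \<nu> p q (Suc n) = 2 * of_real pi * IK_summand \<nu> \<alpha> \<beta> (Suc n)" for n
    using IK_summand_eq[OF assms, of "Suc n"] by (simp add: bessel_series_def p_def q_def)
  note sm = series_summable[OF assms(1) p q]
  have s1: "summable (\<lambda>n. sqrt_summand \<nu> \<alpha> \<beta> (Suc n))"
    unfolding sq using sm(1) by (subst summable_Suc_iff)
  have "summable (\<lambda>n. 2 * of_real pi * IK_summand \<nu> \<alpha> \<beta> (Suc n))"
    unfolding ik[symmetric] using sm(2) by (subst summable_Suc_iff)
  then have s2: "summable (\<lambda>n. IK_summand \<nu> \<alpha> \<beta> (Suc n))"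
    by (subst (asm) summable_cmult_iff) simp
  have sq0: "sqrt_series \<nu> p q 0 = 1 / (p * q * S)"
    using csqrt_square[of p] csqrt_square[of q] p q by (simp add: sqrt_series_def sqrt_term_def r2_0 S_def)
  have ik0: "bessel_series \<nu> p q 0 = of_real pi / (\<nu> * S)"
    by (simp add: bessel_series_def r2_0 S_def)
  have "(\<Sum>n. bessel_series \<nu> p q (Suc n)) = (\<Sum>n. bessel_series \<nu> p q n) - bessel_series \<nu> p q 0"
    by (rule suminf_split_head[OF sm(2)])
  also have "(\<Sum>n. bessel_series \<nu> p q n) = (\<Sum>n. sqrt_series \<nu> p q n)"
    using poisson_defect_zero[OF assms(1) p q] by (simp add: poisson_defect_def)
  also have "(\<Sum>n. sqrt_series \<nu> p q n) = (\<Sum>n. sqrt_series \<nu> p q (Suc n)) + sqrt_series \<nu> p q 0"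
    using suminf_split_head[OF sm(1)] by simp
  finally have "2 * of_real pi * (\<Sum>n. IK_summand \<nu> \<alpha> \<beta> (Suc n))
      = (\<Sum>n. sqrt_summand \<nu> \<alpha> \<beta> (Suc n)) + 1 / (p * q * S) - of_real pi / (\<nu> * S)"
    unfolding ik sq0 ik0 sq suminf_mult[OF s2] .
  moreover have "1 / (p * q * S) - of_real pi / (\<nu> * S) = (\<nu> - of_real pi * (p * q)) / (\<nu> * (p * q) * S)"
    using nz by (simp add: field_simps)
  ultimately show ?thesis using s1 s2 by (simp add: p_def q_def S_def)
qed

end
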